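(* Let $l\ge 1$ be an integer, let $F\subset(\mathbb{P}^1)^{l+1}$ be a smooth (Fano) hypersurface of degree $(1,\dots,1)$, and let $p_1,\dots,p_{l+1}\in H^2(F)$ be the pullbacks to $F$ of the hyperplane (point) classes of the factors of $(\mathbb{P}^1)^{l+1}$. Let $q_1,\dots,q_{l+1}>0$ be fixed, and let $\mathcal{F}(q,t)$ denote the $l$-loop Banana Feynman amplitude, analytically continued in $t$ to $\mathbb{C}\setminus[T,\infty)$ with $T=\left(\sum_{i=1}^{l+1}\sqrt{q_i}\right)^2$. Then, for real $t>0$ and for each of the two choices of sign, \[ \mathcal{F}(q,t\mp \mathtt{i}0)\;\sim\;\frac{1}{t}\int_{F} e^{-p\log(q/t)}\cup\widehat{\Gamma}_F\cdot e^{\pm\pi \mathtt{i}\,c_1(F)}\,\Gamma(1-c_1(F))\qquad\text{as } t\to\infty, \] where $\mathtt{i}=\sqrt{-1}$, $p\log(q/t)=\sum_{i=1}^{l+1}p_i\log(q_i/t)$ with real logarithms. The upper signs correspond to the boundary value $\mathcal{F}(q,t-\mathtt{i}0)$, reached by continuing anti-clockwise from a negative real value of the parameter (through the lower half-plane), and the lower signs to $\mathcal{F}(q,t+\mathtt{i}0)$, reached by continuing clockwise (through the upper half-plane). Here $A(t)\sim B(t)$ means that the right-hand side is the leading asymptotics at order $1/t$ with all its powers of $\log t$ included, i.e. $A(t)-B(t)=o(1/t)$ as $t\to\infty$.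
   Context: Feynman amplitude. For $q=(q_1,\dots,q_{l+1})$ with all $q_i>0$, define the Laurent polynomial \[ \phi_q(y)=(q_1y_1+\cdots+q_ly_l+q_{l+1})(y_1^{-1}+\cdots+y_l^{-1}+1). \] The $l$-loop Banana Feynman amplitude is \[ \mathcal{F}(q,t)=\int_{(\mathbb{R}_{>0})^l}\frac{1}{t-\phi_q(y)}\,\frac{dy_1\cdots dy_l}{y_1\cdots y_l}. \] The integral converges for $t<0$, and for fixed $q$ it extends analytically in $t$ to $\mathbb{C}\setminus[T,\infty)$, where $T=\left(\sum_{i=1}^{l+1}\sqrt{q_i}\right)^2=\min\{\phi_q(y):y\in(\mathbb{R}_{>0})^l\}$. This analytic continuation is also denoted $\mathcal{F}(q,t)$. For real $t>T$, $\mathcal{F}(q,t\mp \mathtt{i}0)=\lim_{\varepsilon\to0^+}\mathcal{F}(q,t\mp \mathtt{i}\varepsilon)$. Cohomology. One has $c_1(F)=p_1+\cdots+p_{l+1}$ and $\dim_{\mathbb{C}}F=l$. Cohomology is taken with complex coefficients, and $\int_F$ denotes pairing with the fundamental class of $F$; for a polynomial $f(p_1,\dots,p_{l+1})$, $\int_F f(p)=\int_{(\mathbb{P}^1)^{l+1}} f(p)\,(p_1+\cdots+p_{l+1})$, with $p_i^2=0$. An analytic function evaluated at (nilpotent) cohomology classes means its Taylor expansion at $0$ evaluated at these classes. Gamma class. $\Gamma(1+z)=\int_0^\infty e^{-s}s^z\,ds$ is the Euler Gamma function and $\gamma$ is Euler's constant. The Gamma class of the tangent bundle of $F$ is \[ \widehat{\Gamma}_F=\frac{\Gamma(1+p_1)^2\cdots\Gamma(1+p_{l+1})^2}{\Gamma(1+p_1+\cdots+p_{l+1})}=\frac{e^{-2\gamma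 c_1(F)}}{\Gamma(1+c_1(F))}\in H^*(F). \] *)

theory Defs
  imports "HOL-Analysis.Analysis" "HOL-Library.Poly_Mapping" "HOL-Library.Landau_Symbols"
begin

section \<open>The banana Feynman amplitude\<close>

definition banana_phi :: "nat \<Rightarrow> (nat \<Rightarrow> real) \<Rightarrow> (nat \<Rightarrow> real) \<Rightarrow> real" where
  "banana_phi l q y =
     ((\<Sum>i=1..l. q i * y i) + q (l + 1)) * ((\<Sum>i=1..l. inverse (y i)) + 1)"

definition banana_integral :: "nat \<Rightarrow> (nat \<Rightarrow> real) \<Rightarrow> real \<Rightarrow> real" where
  "banana_integral l q t =
     (LINT y : (\<Pi>\<^sub>E i\<in>{1..l}. {0<..}) | (\<Pi>\<^sub>M i\<in>{1..l}. lborel).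
        1 / (t - banana_phi l q y) / (\<Prod>i=1..l. y i))"

definition banana_threshold :: "nat \<Rightarrow> (nat \<Rightarrow> real) \<Rightarrow> real" where
  "banana_threshold l q = (\<Sum>i=1..l + 1. sqrt (q i))\<^sup>2"

text \<open>
  The analytic continuation from the negative real axis. By the identity theorem its values on
  the connected open set outside the cut do not depend on the choice; on the cut itself they are
  arbitrary and must not be used.
\<close>

definition feynman_amplitude :: "nat \<Rightarrow> (nat \<Rightarrow> real) \<Rightarrow> complex \<Rightarrow> complex" where
  "feynman_amplitude l q =
     (SOME f. f holomorphic_on (- complex_of_real ` {banana_threshold l q..}) \<and>
              (\<forall>t<0. f (complex_of_real t) = complex_of_real (banana_integral l q t)))"

text \<open>
  The limit of \<open>feynman_amplitude l q\<close> at \<open>t - \<sigma> \<i> \<epsilon>\<close> for \<open>\<epsilon> \<rightarrow> 0+\<close>: from below the cut for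
  \<open>\<sigma> = 1\<close>, from above for \<open>\<sigma> = -1\<close>.
\<close>

definition feynman_boundary_value :: "real \<Rightarrow> nat \<Rightarrow> (nat \<Rightarrow> real) \<Rightarrow> real \<Rightarrow> complex" where
  "feynman_boundary_value \<sigma> l q t =
     Lim (at_right 0)
       (\<lambda>\<epsilon>::real. feynman_amplitude l q
          (complex_of_real t - complex_of_real \<sigma> * \<i> * complex_of_real \<epsilon>))"


section \<open>Cohomology classes pulled back from products of projective lines\<close>

text \<open>
  The ring \<open>\<complex>[p\<^sub>0, p\<^sub>1, p\<^sub>2, \<dots>] / (p\<^sub>i\<^sup>2)\<close>; the generators with index in \<open>{1..n}\<close> generate the
  cohomology ring of \<open>(\<P>\<^sup>1)\<^sup>n\<close>. Two polynomials differ by an element of the monomial ideal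
  \<open>(p\<^sub>i\<^sup>2)\<close> iff their coefficients agree at all monomials not divisible by any \<open>p\<^sub>i\<^sup>2\<close>.
\<close>

definition squarefree_monomial :: "(nat \<Rightarrow>\<^sub>0 nat) \<Rightarrow> bool" where
  "squarefree_monomial m \<longleftrightarrow> (\<forall>i. Poly_Mapping.lookup m i \<le> 1)"

definition p1_rel :: "((nat \<Rightarrow>\<^sub>0 nat) \<Rightarrow>\<^sub>0 complex) \<Rightarrow> ((nat \<Rightarrow>\<^sub>0 nat) \<Rightarrow>\<^sub>0 complex) \<Rightarrow> bool" where
  "p1_rel f g \<longleftrightarrow> (\<forall>m. squarefree_monomial m \<longrightarrow> Poly_Mapping.lookup f m = Poly_Mapping.lookup g m)"

lemma equivp_p1_rel: "equivp p1_rel"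
  by (intro equivpI reflpI sympI transpI) (auto simp: p1_rel_def)

quotient_type p1_cohom = "(nat \<Rightarrow>\<^sub>0 nat) \<Rightarrow>\<^sub>0 complex" / p1_rel
  by (rule equivp_p1_rel)

lemma p1_rel_mult1:
  assumes "p1_rel f f'"
  shows "p1_rel (f * g) (f' * g)"
  unfolding p1_rel_def
proof (intro allI impI)
  fix m assume m: "squarefree_monomial m"
  have "Poly_Mapping.lookup f l * Sum_any (\<lambda>q. Poly_Mapping.lookup g q when m = l + q)
      = Poly_Mapping.lookup f' l * Sum_any (\<lambda>q. Poly_Mapping.lookup g q when m = l + q)" for l
  proof (cases "squarefree_monomial l")
    case True
    then show ?thesis using assms by (simp add: p1_rel_def)
  next
    case False
    have "m \<noteq> l + q" for q
      using False m unfolding squarefree_monomial_def by (metis lookup_add add_leD1)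
    then show ?thesis by simp
  qed
  then show "Poly_Mapping.lookup (f * g) m = Poly_Mapping.lookup (f' * g) m"
    by (simp only: lookup_mult)
qed

lemma p1_rel_mult:
  assumes "p1_rel f f'" "p1_rel g g'"
  shows "p1_rel (f * g) (f' * g')"
  using p1_rel_mult1[OF assms(1), of g] p1_rel_mult1[OF assms(2), of f']
  by (metis equivp_p1_rel equivp_transp mult.commute)

instantiation p1_cohom :: comm_ring_1
begin

lift_definition zero_p1_cohom :: p1_cohom is 0 .
lift_definition one_p1_cohom :: p1_cohom is 1 .
lift_definition plus_p1_cohom :: "p1_cohom \<Rightarrow> p1_cohom \<Rightarrow> p1_cohom" is "(+)"
  by (simp add: p1_rel_def lookup_add)
lift_definition uminus_p1_cohom :: "p1_cohom \<Rightarrow> p1_cohom" is uminus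
  by (simp add: p1_rel_def)
lift_definition minus_p1_cohom :: "p1_cohom \<Rightarrow> p1_cohom \<Rightarrow> p1_cohom" is "(-)"
  by (simp add: p1_rel_def lookup_minus)
lift_definition times_p1_cohom :: "p1_cohom \<Rightarrow> p1_cohom \<Rightarrow> p1_cohom" is "(*)"
  by (rule p1_rel_mult)

instance
proof
  have "\<not> p1_rel 0 1"
    by (auto simp: p1_rel_def squarefree_monomial_def lookup_one intro!: exI[of _ 0])
  then show "(0 :: p1_cohom) \<noteq> 1" by transfer
qed (transfer; simp add: p1_rel_def algebra_simps)+

end

lift_definition cohom_const :: "complex \<Rightarrow> p1_cohom" is "\<lambda>c. Poly_Mapping.single 0 c" .

lift_definition point_class :: "nat \<Rightarrow> p1_cohom" is
  "\<lambda>i. Poly_Mapping.single (Poly_Mapping.single i 1) 1" .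

text \<open>The coefficient of \<open>p\<^sub>1 \<cdots> p\<^sub>n\<close>.\<close>

lift_definition integral_P1_power :: "nat \<Rightarrow> p1_cohom \<Rightarrow> complex" is
  "\<lambda>n f. Poly_Mapping.lookup f (\<Sum>i=1..n. Poly_Mapping.single i 1)"
proof -
  fix n f g assume "p1_rel f g"
  moreover have "squarefree_monomial (\<Sum>i=1..n. Poly_Mapping.single i 1)"
    by (auto simp: squarefree_monomial_def lookup_sum lookup_single when_def sum.delta)
  ultimately show "Poly_Mapping.lookup f (\<Sum>i=1..n. Poly_Mapping.single i 1)
      = Poly_Mapping.lookup g (\<Sum>i=1..n. Poly_Mapping.single i 1)"
    by (simp add: p1_rel_def)
qed

lemma point_class_square: "point_class i ^ 2 = 0"
  unfolding power2_eq_square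
  by transfer
    (auto simp: p1_rel_def Poly_Mapping.mult_single lookup_single when_def squarefree_monomial_def
      lookup_add dest: spec[of _ i])


section \<open>Integration over a hypersurface of degree (1,...,1) and its Gamma class\<close>

text \<open>
  \<open>F\<close> is the \<open>l\<close>-dimensional smooth hypersurface of degree \<open>(1,\<dots>,1)\<close> in \<open>(\<P>\<^sup>1)\<^bsup>l+1\<^esup>\<close>. Classes on
  \<open>F\<close> that are polynomials in the pulled-back point classes are represented by the same
  polynomials on the ambient space. By adjunction \<open>c\<^sub>1(F)\<close> is the sum of the \<open>p\<^sub>i\<close>, and so is the
  Poincare dual of \<open>F\<close>; thus pairing with the fundamental class of \<open>F\<close> is integration over the
  ambient space after multiplication with that sum.
\<close>

definition c1_F :: "nat \<Rightarrow> p1_cohom" where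
  "c1_F l = (\<Sum>i=1..l + 1. point_class i)"

definition integral_F :: "nat \<Rightarrow> p1_cohom \<Rightarrow> complex" where
  "integral_F l a = integral_P1_power (l + 1) (a * (\<Sum>i=1..l + 1. point_class i))"

text \<open>
  The Taylor expansion of \<open>f\<close> at 0, evaluated at a nilpotent class. \<open>Sum_any\<close> adds up the nonzero
  terms, of which there are only finitely many when \<open>a\<close> is nilpotent.
\<close>

definition taylor_at :: "(complex \<Rightarrow> complex) \<Rightarrow> p1_cohom \<Rightarrow> p1_cohom" where
  "taylor_at f a = Sum_any (\<lambda>k. cohom_const ((deriv ^^ k) f 0 / fact k) * a ^ k)"

definition Gamma_class_F :: "nat \<Rightarrow> p1_cohom" where
  "Gamma_class_F l =
     (\<Prod>i=1..l + 1. (taylor_at (\<lambda>z. Gamma (1 + z)) (point_class i))\<^sup>2)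
       * taylor_at (\<lambda>z. 1 / Gamma (1 + z)) (\<Sum>i=1..l + 1. point_class i)"

definition p_log :: "nat \<Rightarrow> (nat \<Rightarrow> real) \<Rightarrow> real \<Rightarrow> p1_cohom" where
  "p_log l q t = (\<Sum>i=1..l + 1. point_class i * cohom_const (complex_of_real (ln (q i / t))))"

end

theory Submission
  imports Defs "HOL-Complex_Analysis.Complex_Analysis" "HOL-Real_Asymp.Real_Asymp"
begin

text \<open>
  The function \<open>macdonald x = \<integral> exp (- e\<^sup>u - e\<^bsup>x - u\<^esup>) du\<close> is a Bessel function \<open>K\<^sub>0\<close> in logarithmic
  coordinates. A substitution gives \<open>\<Prod>\<^sub>i macdonald (x + ln q\<^sub>i) = \<integral> macdonald (x + ln \<phi>(y)) dy/y\<close>, and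
  \<open>\<integral> e\<^sup>x macdonald x macdonald (x + z) dx = z / (e\<^sup>z - 1)\<close>. Hence
  \<open>M(z) = \<integral> todd (z + ln \<phi>(y)) dy/y\<close> equals \<open>\<integral> e\<^sup>x macdonald x \<Prod>\<^sub>i macdonald (x + z + ln q\<^sub>i) dx\<close>, and
  since \<open>1 / (t - \<phi>)\<close> is a multiple of a difference of two values of \<open>todd\<close> at distance \<open>2 \<pi> \<i>\<close>, the amplitude
  at \<open>t = -s\<close> is \<open>(M(\<i> \<pi> - ln s) - M(- \<i> \<pi> - ln s)) / (2 \<pi> \<i> s)\<close>.

  As \<open>macdonald\<close> extends to an entire function, the second expression for \<open>M\<close> continues it, for very
  negative \<open>Re z\<close>, across the lines \<open>\<bar>Im z\<bar> = 2 \<pi>\<close>; this yields the boundary values on the cut. There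
  \<open>macdonald z\<close> is \<open>- z - 2 \<gamma>\<close> up to an exponentially small error, so the leading term consists of
  moments of \<open>e\<^sup>x macdonald x\<close>, which are Taylor coefficients of \<open>e\<^bsup>c w\<^esup> \<Gamma>(1 - w)\<^sup>2\<close> at 0. The
  reflection formula identifies them with those of \<open>z e\<^bsup>\<plusminus> \<pi> \<i> z\<^esup> \<Gamma>(1 - z) / \<Gamma>(1 + z)\<close>. On the cohomological
  side \<open>p\<^sub>i\<^sup>2 = 0\<close> gives \<open>exp (X c\<^sub>1) \<Prod>\<^sub>i (1 + a\<^sub>i p\<^sub>i) = \<Prod>\<^sub>i (1 + (a\<^sub>i + X) p\<^sub>i)\<close>, whose top coefficient is
  the product of the logarithmic factors.
\<close>

section \<open>Integrals depending on a parameter\<close>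

text \<open>The obstacle is the cut. There \<open>1 / (t - \<phi>)\<close> is singular, and one of
  the two arguments of \<open>M\<close> tends to a point with imaginary part
  \<open>\<plusminus> 2 \<pi>\<close>, on the edge of the strip of holomorphy of
  \<open>todd\<close>. The integral defining \<open>macdonald\<close> does not reach that far
  either: for complex \<open>x\<close> with \<open>cos (Im x) < 0\<close> the term
  \<open>exp (- exp (x - u))\<close> explodes as \<open>u\<close> tends to
  \<open>-\<infinity>\<close>. Hence \<open>macdonald\<close> is identified with an explicit entire
  function, through the linear differential equation that both satisfy. The price is growth: off the
  real axis each of the \<open>l + 1\<close> factors is only bounded by a double exponential,
  against a single decaying weight. Moving \<open>z\<close> to the left shrinks these exponents
  until the weight wins; hence the restriction \<open>Re z < - S\<close>, that is
  \<open>t > exp S\<close>, harmless for asymptotics. The identities between multiple integrals are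
  proved for nonnegative real integrands by Tonelli and only then continued by the identity theorem,
  so no complex Fubini argument is needed. The kernel is dictated by the answer:
  \<open>\<Gamma>(1 - w)\<^sup>2\<close> is the Mellin transform of \<open>macdonald\<close> at
  \<open>1 - w\<close>.\<close>

lemma has_field_derivative_integral:
  fixes f :: "'k::{real_normed_field,banach,second_countable_topology} \<Rightarrow> 'b \<Rightarrow> 'k"
  assumes S: "open S" "convex S" "z \<in> S"
    and f: "\<And>w. w \<in> S \<Longrightarrow> integrable M (f w)"
    and f': "\<And>w y. w \<in> S \<Longrightarrow> y \<in> space M \<Longrightarrow> ((\<lambda>w. f w y) has_field_derivative f' w y) (at w)"
    and g: "\<And>w y. w \<in> S \<Longrightarrow> y \<in> space M \<Longrightarrow> norm (f' w y) \<le> g y" "integrable M g"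
  shows "((\<lambda>w. \<integral>y. f w y \<partial>M) has_field_derivative (\<integral>y. f' z y \<partial>M)) (at z)"
    and "integrable M (f' z)"
proof -
  obtain e where e: "e > 0" "ball z e \<subseteq> S"
    using S by (meson open_contains_ball)
  \<comment> \<open>The mean value inequality on the convex set \<open>S\<close> turns the bound on
    the derivative into a bound on all difference quotients, which is what dominated convergence
    needs.\<close>
  have quot: "norm ((f (z + h) y - f z y) / h) \<le> g y" if "z + h \<in> S" "h \<noteq> 0" "y \<in> space M" for h y
  proof -
    have "norm (f (z + h) y - f z y) \<le> g y * norm (z + h - z)"
      by (rule field_differentiable_bound[OF S(2), where f' = "\<lambda>w. f' w y"])
         (use f' g that S in \<open>auto intro: has_field_derivative_at_within\<close>)
    then show ?thesis using that by (simp add: norm_divide field_simps)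
  qed
  have lim: "(\<lambda>n. (f (z + h n) y - f z y) / h n) \<longlonglongrightarrow> f' z y"
    if "filterlim h (at 0) sequentially" "y \<in> space M" for h y
    using f'[OF S(3) that(2)] that(1) unfolding DERIV_def
    by (rule filterlim_compose)
  \<comment> \<open>One concrete null sequence inside \<open>S\<close>: the limit of its difference
    quotients shows that \<open>f' z\<close> is measurable, which is not assumed.\<close>
  define h0 :: "nat \<Rightarrow> 'k" where "h0 n = of_real (e / (2 + real n))" for n
  have "(\<lambda>n. e / (2 + real n)) \<longlonglongrightarrow> 0" by real_asymp
  then have "h0 \<longlonglongrightarrow> 0" unfolding h0_def by (metis of_real_0 tendsto_of_real)
  moreover have h0_nz: "h0 n \<noteq> 0" for n
    unfolding h0_def of_real_eq_0_iff using e by simp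
  ultimately have h0: "filterlim h0 (at 0) sequentially"
    unfolding filterlim_at using h0_nz by auto
  have h0S: "z + h0 n \<in> S" for n
  proof -
    have "norm (h0 n) = e / (2 + real n)" unfolding h0_def norm_of_real using e by simp
    also have "\<dots> < e" using e by (simp add: field_simps add_pos_nonneg)
    finally have "norm (h0 n) < e" .
    then show ?thesis using e by (auto simp: dist_norm)
  qed
  have meas: "(\<lambda>y. (f (z + h) y - f z y) / h) \<in> borel_measurable M" if "z + h \<in> S" for h
    using f[OF that] f[OF S(3)] by (intro borel_measurable_divide borel_measurable_diff) auto
  have f'meas: "f' z \<in> borel_measurable M"
    by (rule borel_measurable_LIMSEQ_metric[OF meas[OF h0S] lim[OF h0]])
  show "integrable M (f' z)"
    by (rule Bochner_Integration.integrable_bound[OF g(2) f'meas])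
       (use g S in \<open>auto intro!: AE_I2 order_trans[OF _ abs_ge_self]\<close>)
  show "((\<lambda>w. \<integral>y. f w y \<partial>M) has_field_derivative (\<integral>y. f' z y \<partial>M)) (at z)"
    unfolding DERIV_def tendsto_at_iff_sequentially
  proof (intro allI impI, unfold o_def)
    fix h :: "nat \<Rightarrow> 'k" assume h: "\<forall>i. h i \<in> UNIV - {0}" "h \<longlonglongrightarrow> 0"
    have "filterlim h (at 0) sequentially" using h by (auto simp: filterlim_at)
    note limh = lim[OF this]
    have "eventually (\<lambda>n. z + h n \<in> S) sequentially"
    proof -
      have "(\<lambda>n. z + h n) \<longlonglongrightarrow> z + 0" using h(2) by (intro tendsto_intros)
      then show ?thesis using S by (intro topological_tendstoD) auto
    qed
    then obtain N where N: "\<And>n. n \<ge> N \<Longrightarrow> z + h n \<in> S" by (auto simp: eventually_sequentially)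
    have "(\<lambda>n. \<integral>y. (f (z + h (n + N)) y - f z y) / h (n + N) \<partial>M) \<longlonglongrightarrow> (\<integral>y. f' z y \<partial>M)"
    proof (rule integral_dominated_convergence[where w = g])
      show "AE y in M. (\<lambda>n. (f (z + h (n + N)) y - f z y) / h (n + N)) \<longlonglongrightarrow> f' z y"
        using limh LIMSEQ_ignore_initial_segment by (intro AE_I2) fastforce
      show "AE y in M. norm ((f (z + h (n + N)) y - f z y) / h (n + N)) \<le> g y" for n
        using quot h N by (intro AE_I2) auto
      show "(\<lambda>y. (f (z + h (n + N)) y - f z y) / h (n + N)) \<in> borel_measurable M" for n
        using meas N by auto
    qed (use f'meas g in auto)
    moreover have "(\<integral>y. (f (z + h (n + N)) y - f z y) / h (n + N) \<partial>M)
        = ((\<integral>y. f (z + h (n + N)) y \<partial>M) - (\<integral>y. f z y \<partial>M)) / h (n + N)" for n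
      using f[OF S(3)] f[OF N[of "n+N"]] by (simp only: integral_divide_zero le_add2 Bochner_Integration.integral_diff)
    ultimately have "(\<lambda>n. ((\<integral>y. f (z + h (n + N)) y \<partial>M) - (\<integral>y. f z y \<partial>M)) / h (n + N)) \<longlonglongrightarrow> (\<integral>y. f' z y \<partial>M)"
      by (simp only:)
    then show "(\<lambda>n. ((\<integral>y. f (z + h n) y \<partial>M) - (\<integral>y. f z y \<partial>M)) / h n) \<longlonglongrightarrow> (\<integral>y. f' z y \<partial>M)"
      by (rule LIMSEQ_offset)
  qed
qed

text \<open>A local bound on \<open>f\<close> alone suffices: Cauchy's inequality on discs of half
  the radius bounds the derivative by \<open>g y / (r/2)\<close>, and differentiation under the
  integral applies.\<close>

lemma holomorphic_on_integral:
  fixes f :: "complex \<Rightarrow> 'b \<Rightarrow> complex"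
  assumes A: "open A"
    and hol: "\<And>y. y \<in> space M \<Longrightarrow> (\<lambda>z. f z y) holomorphic_on A"
    and meas: "\<And>z. z \<in> A \<Longrightarrow> f z \<in> borel_measurable M"
    and dom: "\<And>z. z \<in> A \<Longrightarrow> \<exists>r>0. \<exists>g. cball z r \<subseteq> A \<and> integrable M g \<and>
        (\<forall>w\<in>cball z r. \<forall>y\<in>space M. norm (f w y) \<le> g y)"
  shows "(\<lambda>z. \<integral>y. f z y \<partial>M) holomorphic_on A"
  unfolding holomorphic_on_open[OF A]
proof
  fix z assume "z \<in> A"
  then obtain r g where r: "r > 0" "cball z r \<subseteq> A" and g: "integrable M g"
    "\<And>w y. w \<in> cball z r \<Longrightarrow> y \<in> space M \<Longrightarrow> norm (f w y) \<le> g y"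
    using dom by meson
  have sub: "cball w (r/2) \<subseteq> cball z r" if "w \<in> ball z (r/2)" for w
  proof
    fix x assume "x \<in> cball w (r/2)"
    then have "dist z x \<le> r/2 + r/2" using that dist_triangle[of z x w] by auto
    then show "x \<in> cball z r" by simp
  qed
  have in_r: "w \<in> cball z r" if "w \<in> ball z (r/2)" for w using that r(1) by auto
  have "((\<lambda>w. \<integral>y. f w y \<partial>M) has_field_derivative (\<integral>y. deriv (\<lambda>w. f w y) z \<partial>M)) (at z)"
  proof (rule has_field_derivative_integral(1)[where S = "ball z (r/2)" and g = "\<lambda>y. g y / (r/2)"])
    show "integrable M (f w)" if "w \<in> ball z (r/2)" for w
      by (rule Bochner_Integration.integrable_bound[OF g(1) meas])
         (use g(2)[OF in_r[OF that]] r in_r[OF that] in \<open>auto intro!: AE_I2 order_trans[OF _ abs_ge_self]\<close>)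
    show "((\<lambda>w. f w y) has_field_derivative deriv (\<lambda>w. f w y) w) (at w)"
      if "w \<in> ball z (r/2)" "y \<in> space M" for w y
      using hol[OF that(2)] A r in_r[OF that(1)] by (intro holomorphic_derivI[where S = A]) auto
    show "norm (deriv (\<lambda>w. f w y) w) \<le> g y / (r/2)" if "w \<in> ball z (r/2)" "y \<in> space M" for w y
    proof -
      have h: "(\<lambda>w. f w y) holomorphic_on cball w (r/2)"
        using hol[OF that(2)] sub[OF that(1)] r by (meson holomorphic_on_subset subset_trans)
      have "norm ((deriv ^^ 1) (\<lambda>w. f w y) w) \<le> fact 1 * g y / (r/2)^1"
      proof (rule Cauchy_inequality)
        show "(\<lambda>w. f w y) holomorphic_on ball w (r/2)"
          using h by (rule holomorphic_on_subset) auto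
        show "continuous_on (cball w (r/2)) (\<lambda>w. f w y)"
          using h holomorphic_on_imp_continuous_on by blast
        show "norm (f x y) \<le> g y" if "norm (w - x) = r/2" for x
          using g(2)[of x y] sub[OF \<open>w \<in> _\<close>] that \<open>y \<in> _\<close> by (auto simp: dist_norm)
      qed (use r in auto)
      then show ?thesis by simp
    qed
  qed (use r g in auto)
  then show "\<exists>f'. ((\<lambda>z. \<integral>y. f z y \<partial>M) has_field_derivative f') (at z)" by blast
qed

section \<open>Logarithmic coordinates\<close>

lemma nn_integral_exp_substitution:
  fixes f :: "real \<Rightarrow> ennreal"
  assumes [measurable]: "f \<in> borel_measurable borel"
  shows "(\<integral>\<^sup>+ y. indicator {0<..} y * f y \<partial>lborel) = (\<integral>\<^sup>+ u. ennreal (exp u) * f (exp u) \<partial>lborel)"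
proof -
  \<comment> \<open>The substitution rule is applied on compact intervals, which then exhaust the
    line; \<open>Suc n\<close> keeps the interval nondegenerate at \<open>n = 0\<close>.\<close>
  define I where "I n = {- real (Suc n)..real (Suc n)}" for n
  have *: "(\<integral>\<^sup>+ y. f y * indicator (exp ` I n) y \<partial>lborel)
      = (\<integral>\<^sup>+ u. f (exp u) * ennreal (exp u) * indicator (I n) u \<partial>lborel)" for n
  proof -
    have "exp ` I n = {exp (- real (Suc n))..exp (real (Suc n))}"
      unfolding I_def
    proof (intro equalityI subsetI)
      fix y assume y: "y \<in> {exp (- real (Suc n))..exp (real (Suc n))}"
      then have "y > 0" by (smt (verit) atLeastAtMost_iff exp_gt_zero)
      then obtain v where v: "y = exp v" by (metis exp_ln)
      then have "v \<in> {- real (Suc n)..real (Suc n)}" using y by (simp del: of_nat_Suc)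
      then show "y \<in> exp ` {- real (Suc n)..real (Suc n)}" using v by blast
    qed auto
    then show ?thesis unfolding I_def
      by (simp only:) (rule nn_integral_substitution_aux, auto intro!: derivative_eq_intros continuous_intros)
  qed
  have inc: "incseq (\<lambda>n. I n)" by (auto simp: incseq_def I_def)
  have UI: "(\<Union>n. I n) = UNIV"
  proof -
    have "x \<in> (\<Union>n. I n)" for x :: real
    proof -
      obtain n where "\<bar>x\<bar> \<le> real n" using real_arch_simple by blast
      then show ?thesis by (auto simp: I_def intro!: exI[of _ n])
    qed
    then show ?thesis by auto
  qed
  have ball: "(SUP n. c * indicator (A n) x :: ennreal) = c * indicator (\<Union>n. A n) x"
    for x :: real and A :: "nat \<Rightarrow> real set" and c
  proof (rule antisym)
    show "c * indicator (\<Union>n. A n) x \<le> (SUP n. c * indicator (A n) x)"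
    proof (cases "x \<in> (\<Union>n. A n)")
      case True
      then obtain n where "x \<in> A n" by blast
      then show ?thesis using True by (intro SUP_upper2[of n]) auto
    qed auto
  qed (intro SUP_least, auto simp: indicator_def)
  have [measurable]: "exp ` I n \<in> sets lborel" for n
    unfolding I_def by (auto intro!: borel_compact compact_continuous_image continuous_intros)
  have "(\<integral>\<^sup>+ y. indicator {0<..} y * f y \<partial>lborel) = (\<integral>\<^sup>+ y. (SUP n. f y * indicator (exp ` I n) y) \<partial>lborel)"
  proof -
    have "(\<Union>n. exp ` I n) = {0::real<..}"
    proof -
      have "y \<in> range exp" if "y > 0" for y :: real using exp_ln[OF that] by (metis rangeI)
      then have "range exp = {0::real<..}" by auto
      moreover have "(\<Union>n. exp ` I n) = exp ` (\<Union>n. I n)" by blast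
      ultimately show ?thesis by (simp only: UI)
    qed
    then show ?thesis by (simp only: ball mult.commute)
  qed
  also have "\<dots> = (SUP n. \<integral>\<^sup>+ y. f y * indicator (exp ` I n) y \<partial>lborel)"
    using inc by (intro nn_integral_monotone_convergence_SUP)
      (fastforce simp: incseq_def le_fun_def intro!: mult_left_mono indicator_leI)+
  also have "\<dots> = (SUP n. \<integral>\<^sup>+ u. f (exp u) * ennreal (exp u) * indicator (I n) u \<partial>lborel)"
    by (simp only: *)
  also have "\<dots> = (\<integral>\<^sup>+ u. (SUP n. f (exp u) * ennreal (exp u) * indicator (I n) u) \<partial>lborel)"
    using inc by (intro nn_integral_monotone_convergence_SUP[symmetric])
      (fastforce simp: incseq_def le_fun_def I_def intro!: mult_left_mono indicator_leI)+
  also have "\<dots> = (\<integral>\<^sup>+ u. ennreal (exp u) * f (exp u) \<partial>lborel)"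
    by (simp only: ball UI indicator_UNIV mult_1_right mult.commute[of "f _"])
  finally show ?thesis .
qed

lemma nn_integral_Gamma_exp:
  assumes "s > (0::real)"
  shows "(\<integral>\<^sup>+ u. ennreal (exp (s * u - exp u)) \<partial>lborel) = ennreal (Gamma s)"
proof -
  have "ennreal (Gamma s) = (\<integral>\<^sup>+ t. indicator {0<..} t * ennreal (t powr (s - 1) / exp t) \<partial>lborel)"
    unfolding Gamma_conv_nn_integral_real[OF assms]
    by (intro nn_integral_cong) (auto simp: indicator_def)
  also have "\<dots> = (\<integral>\<^sup>+ u. ennreal (exp u) * ennreal (exp u powr (s - 1) / exp (exp u)) \<partial>lborel)"
    by (rule nn_integral_exp_substitution) simp
  also have "\<dots> = (\<integral>\<^sup>+ u. ennreal (exp (s * u - exp u)) \<partial>lborel)"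
    by (intro nn_integral_cong)
       (simp add: ennreal_mult'[symmetric] powr_def algebra_simps flip: exp_add exp_diff)
  finally show ?thesis by simp
qed

lemma integrable_Gamma_exp:
  assumes "s > (0::real)"
  shows "integrable lborel (\<lambda>u. exp (s * u - exp u))"
    and "(LINT u|lborel. exp (s * u - exp u)) = Gamma s"
proof -
  have "has_bochner_integral lborel (\<lambda>u. exp (s * u - exp u)) (Gamma s)"
    by (rule has_bochner_integral_nn_integral)
       (use nn_integral_Gamma_exp[OF assms] Gamma_real_pos[OF assms] in auto)
  then show "integrable lborel (\<lambda>u. exp (s * u - exp u))" "(LINT u|lborel. exp (s * u - exp u)) = Gamma s"
    by (auto simp: has_bochner_integral_iff)
qed

text \<open>The exponential series dominates each of its terms, here the one of index
  \<open>k\<close> at \<open>e * (1 + \<bar>x\<bar>)\<close>. A polynomial factor thus costs only an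
  arbitrarily small change of exponential rate.\<close>

lemma one_plus_abs_power_le_exp:
  assumes "e > (0::real)"
  obtains C where "C > 0" "\<And>x::real. (1 + \<bar>x\<bar>) ^ k \<le> C * (exp (e * x) + exp (- e * x))"
proof
  show "fact k / e ^ k * exp e > 0" using assms by simp
  fix x :: real
  have "(e * (1 + \<bar>x\<bar>)) ^ k / fact k \<le> exp (e * (1 + \<bar>x\<bar>))"
  proof -
    have "(\<lambda>n. (e * (1 + \<bar>x\<bar>)) ^ n / fact n) sums exp (e * (1 + \<bar>x\<bar>))"
      using exp_converges[of "e * (1 + \<bar>x\<bar>)"] by (simp add: divide_inverse_commute)
    then have "(\<Sum>n\<in>{k}. (e * (1 + \<bar>x\<bar>)) ^ n / fact n) \<le> exp (e * (1 + \<bar>x\<bar>))"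
      using assms sum_le_suminf[of "\<lambda>n. (e * (1 + \<bar>x\<bar>)) ^ n / fact n" "{k}"] by (simp add: sums_iff)
    then show ?thesis by simp
  qed
  also have "\<dots> = exp e * exp (e * \<bar>x\<bar>)" by (simp add: algebra_simps flip: exp_add)
  also have "\<dots> \<le> exp e * (exp (e * x) + exp (- e * x))"
    by (cases "x \<ge> 0") auto
  finally have "e ^ k * (1 + \<bar>x\<bar>) ^ k \<le> fact k * (exp e * (exp (e * x) + exp (- e * x)))"
    by (simp add: divide_le_eq power_mult_distrib mult.commute)
  then show "(1 + \<bar>x\<bar>) ^ k \<le> fact k / e ^ k * exp e * (exp (e * x) + exp (- e * x))"
    using assms by (simp add: field_simps)
qed

lemma integrable_power_Gamma_exp:
  assumes "s > (0::real)"
  shows "integrable lborel (\<lambda>u. (1 + \<bar>u\<bar>) ^ k * exp (s * u - exp u))"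
proof -
  obtain C where C: "C > 0" "\<And>x::real. (1 + \<bar>x\<bar>) ^ k \<le> C * (exp (s/2 * x) + exp (- (s/2) * x))"
    using one_plus_abs_power_le_exp[of "s/2" k] assms by auto
  have "integrable lborel (\<lambda>u. C * exp ((3 * s / 2) * u - exp u) + C * exp (s/2 * u - exp u))"
    using assms integrable_Gamma_exp(1)[of "3 * s / 2"] integrable_Gamma_exp(1)[of "s/2"] by auto
  then show ?thesis
  proof (rule Bochner_Integration.integrable_bound[OF _ _ AE_I2])
    fix u :: real
    have "(1 + \<bar>u\<bar>) ^ k * exp (s * u - exp u) \<le> C * (exp (s/2 * u) + exp (- (s/2) * u)) * exp (s * u - exp u)"
      by (intro mult_right_mono C) auto
    also have "\<dots> = C * exp ((3 * s / 2) * u - exp u) + C * exp (s/2 * u - exp u)"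
      by (simp add: algebra_simps flip: exp_add)
    finally show "norm ((1 + \<bar>u\<bar>) ^ k * exp (s * u - exp u)) \<le> norm (C * exp ((3 * s / 2) * u - exp u) + C * exp (s/2 * u - exp u))"
      by simp
  qed auto
qed

lemma nn_integral_exp_scaled:
  assumes "s > (0::real)" "B > 0"
  shows "(\<integral>\<^sup>+ x. ennreal (exp (s * x - B * exp x)) \<partial>lborel) = ennreal (Gamma s * exp (- s * ln B))"
proof -
  have "(\<integral>\<^sup>+ x. ennreal (exp (s * x - B * exp x)) \<partial>lborel)
      = (\<integral>\<^sup>+ x. ennreal (exp (s * (- ln B + 1 * x) - B * exp (- ln B + 1 * x))) \<partial>lborel)"
    by (subst nn_integral_real_affine[where c = 1 and t = "- ln B"]) auto
  also have "\<dots> = (\<integral>\<^sup>+ x. ennreal (exp (- s * ln B)) * ennreal (exp (s * x - exp x)) \<partial>lborel)"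
    using assms by (intro nn_integral_cong)
      (simp add: ennreal_mult'[symmetric] algebra_simps exp_diff flip: exp_add)
  also have "\<dots> = ennreal (exp (- s * ln B)) * ennreal (Gamma s)"
    using assms by (simp add: nn_integral_cmult nn_integral_Gamma_exp)
  finally show ?thesis using assms Gamma_real_pos[of s] by (simp add: ennreal_mult mult.commute)
qed

section \<open>The Macdonald function in logarithmic coordinates\<close>

text \<open>
  In terms of the modified Bessel function, \<open>macdonald x\<close> is \<open>2 K\<^sub>0(2 exp (x/2))\<close>.
\<close>

definition macdonald :: "real \<Rightarrow> real" where
  "macdonald x = (LINT u|lborel. exp (- exp u - exp (x - u)))"

text \<open>Reduces to \<open>s * v \<le> exp v\<close>. The free parameter \<open>s\<close> decides
  how the decay is shared between \<open>x\<close> and \<open>u\<close> in the integrand of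
  \<open>macdonald\<close>.\<close>

lemma exp_minus_exp_le:
  assumes "0 < s" "s \<le> (1::real)"
  shows "exp (- exp v) \<le> exp (- s * v)"
proof -
  have "s * v \<le> exp v"
  proof (cases "v \<ge> 0")
    case True
    then have "s * v \<le> v" using assms by (simp add: mult_left_le_one_le)
    then show ?thesis using exp_ge_add_one_self[of v] by linarith
  next
    case False
    then show ?thesis using assms by (smt (verit) exp_gt_zero mult_pos_neg)
  qed
  then show ?thesis by simp
qed

lemma macdonald_integrand_le:
  assumes "0 < s" "s \<le> (1::real)"
  shows "exp (- exp u - exp (x - u :: real)) \<le> exp (- s * x) * exp (s * u - exp u)"
proof -
  have "exp (- exp u - exp (x - u)) = exp (- exp (x - u)) * exp (- exp u)"
    by (simp flip: exp_add)
  also have "\<dots> \<le> exp (- s * (x - u)) * exp (- exp u)"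
    by (intro mult_right_mono exp_minus_exp_le assms) auto
  also have "\<dots> = exp (- s * x) * exp (s * u - exp u)"
    by (simp add: algebra_simps flip: exp_add)
  finally show ?thesis .
qed

lemma integrable_macdonald: "integrable lborel (\<lambda>u. exp (- exp u - exp (x - u :: real)))"
proof (rule Bochner_Integration.integrable_bound)
  show "integrable lborel (\<lambda>u. exp (- 1 * x) * exp (1 * u - exp u))"
    using integrable_Gamma_exp(1)[of 1] by (intro integrable_mult_right) simp
  show "AE u in lborel. norm (exp (- exp u - exp (x - u))) \<le> norm (exp (- 1 * x) * exp (1 * u - exp u))"
    using macdonald_integrand_le[of 1 _ x] by (intro AE_I2) simp
qed auto

lemma macdonald_nonneg [simp]: "macdonald x \<ge> 0"
  unfolding macdonald_def by (rule Bochner_Integration.integral_nonneg) auto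

lemma macdonald_measurable [measurable]: "macdonald \<in> borel_measurable borel"
proof -
  have "(\<lambda>x::real. LINT u|lborel. exp (- exp u - exp (x - u))) \<in> borel_measurable borel"
    by measurable
  then show ?thesis by (simp add: macdonald_def[abs_def])
qed

lemma nn_integral_macdonald:
  "(\<integral>\<^sup>+ u. ennreal (exp (- exp u - exp (x - u))) \<partial>lborel) = ennreal (macdonald x)" 
  unfolding macdonald_def by (intro nn_integral_eq_integral integrable_macdonald) auto

text \<open>At \<open>-\<infinity>\<close> the true growth is linear, so every positive rate
  \<open>s\<close> works; small \<open>s\<close> makes many such factors affordable at once.\<close>

lemma macdonald_le:
  assumes "0 < s" "s \<le> 1"
  shows "macdonald x \<le> Gamma s * exp (- s * x)"
proof -
  have "macdonald x \<le> (LINT u|lborel. exp (- s * x) * exp (s * u - exp u))"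
    unfolding macdonald_def using assms integrable_Gamma_exp(1)[of s]
    by (intro integral_mono integrable_macdonald macdonald_integrand_le) auto
  then show ?thesis using integrable_Gamma_exp(2)[of s] assms by (simp add: mult.commute)
qed

text \<open>Translating \<open>v\<close> by \<open>ln B\<close> moves both scales into the argument:
  only the product \<open>A * B\<close> matters. This is how the two factors of
  \<open>\<phi>\<close> recombine.\<close>

lemma nn_integral_macdonald_scaled:
  assumes "A > 0" "B > 0"
  shows "(\<integral>\<^sup>+ v. ennreal (exp (- (B * exp v) - A * exp (x - v))) \<partial>lborel)
    = ennreal (macdonald (x + ln A + ln B))"
proof -
  have "(\<integral>\<^sup>+ v. ennreal (exp (- (B * exp v) - A * exp (x - v))) \<partial>lborel)
      = (\<integral>\<^sup>+ v. ennreal (exp (- (B * exp (- ln B + 1 * v)) - A * exp (x - (- ln B + 1 * v)))) \<partial>lborel)"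
    by (subst nn_integral_real_affine[where c = 1 and t = "- ln B"]) auto
  also have "\<dots> = (\<integral>\<^sup>+ v. ennreal (exp (- exp v - exp ((x + ln A + ln B) - v))) \<partial>lborel)"
    using assms by (intro nn_integral_cong) (simp add: exp_add exp_diff exp_minus field_simps)
  finally show ?thesis by (simp add: nn_integral_macdonald)
qed

text \<open>Integrating over \<open>x\<close> first gives \<open>Gamma s * exp (s * u)\<close>, and
  the remaining integral over \<open>u\<close> is a second \<open>Gamma s\<close>.\<close>

lemma nn_integral_macdonald_Mellin:
  assumes "s > 0"
  shows "(\<integral>\<^sup>+ x. ennreal (exp (s * x) * macdonald x) \<partial>lborel) = ennreal ((Gamma s)\<^sup>2)"
proof -
  have "(\<integral>\<^sup>+ x. ennreal (exp (s * x) * macdonald x) \<partial>lborel)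
      = (\<integral>\<^sup>+ x. \<integral>\<^sup>+ u. ennreal (exp (s * x - exp u - exp (x - u))) \<partial>lborel \<partial>lborel)"
    by (simp add: ennreal_mult' nn_integral_macdonald[symmetric] nn_integral_cmult[symmetric] del: nn_integral_cmult)
       (simp add: ennreal_mult'[symmetric] algebra_simps flip: exp_add)
  also have "\<dots> = (\<integral>\<^sup>+ u. \<integral>\<^sup>+ x. ennreal (exp (s * x - exp u - exp (x - u))) \<partial>lborel \<partial>lborel)"
    by (rule lborel_pair.Fubini') measurable
  also have "\<dots> = (\<integral>\<^sup>+ u. ennreal (exp (s * u - exp u)) * ennreal (Gamma s) \<partial>lborel)"
  proof (intro nn_integral_cong)
    fix u :: real
    have "(\<integral>\<^sup>+ x. ennreal (exp (s * x - exp u - exp (x - u))) \<partial>lborel)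
        = (\<integral>\<^sup>+ x. ennreal (exp (- exp u)) * ennreal (exp (s * x - exp (- u) * exp x)) \<partial>lborel)"
      by (intro nn_integral_cong) (simp add: ennreal_mult'[symmetric] algebra_simps flip: exp_add)
    also have "\<dots> = ennreal (exp (- exp u)) * ennreal (Gamma s * exp (- s * ln (exp (- u))))"
      by (simp add: nn_integral_cmult nn_integral_exp_scaled[OF assms])
    also have "\<dots> = ennreal (exp (s * u - exp u)) * ennreal (Gamma s)"
      using Gamma_real_pos[OF assms]
      by (simp add: ennreal_mult'[symmetric] ennreal_mult''[symmetric] algebra_simps flip: exp_add)
    finally show "(\<integral>\<^sup>+ x. ennreal (exp (s * x - exp u - exp (x - u))) \<partial>lborel)
      = ennreal (exp (s * u - exp u)) * ennreal (Gamma s)" .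
  qed
  also have "\<dots> = ennreal (Gamma s) * ennreal (Gamma s)"
    by (simp add: nn_integral_multc nn_integral_Gamma_exp[OF assms])
  finally show ?thesis using Gamma_real_pos[OF assms] by (simp add: power2_eq_square ennreal_mult')
qed

lemma integrable_macdonald_Mellin:
  assumes "s > 0"
  shows "integrable lborel (\<lambda>x. exp (s * x) * macdonald x)"
    and "(LINT x|lborel. exp (s * x) * macdonald x) = (Gamma s)\<^sup>2"
proof -
  have "has_bochner_integral lborel (\<lambda>x. exp (s * x) * macdonald x) ((Gamma s)\<^sup>2)"
    by (rule has_bochner_integral_nn_integral) (use nn_integral_macdonald_Mellin[OF assms] in auto)
  then show "integrable lborel (\<lambda>x. exp (s * x) * macdonald x)"
    "(LINT x|lborel. exp (s * x) * macdonald x) = (Gamma s)\<^sup>2"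
    by (auto simp: has_bochner_integral_iff)
qed

lemma integrable_power_macdonald:
  assumes "s > (0::real)"
  shows "integrable lborel (\<lambda>x. (1 + \<bar>x\<bar>) ^ k * (exp (s * x) * macdonald (x - a)))"
proof -
  obtain C where C: "C > 0" "\<And>x::real. (1 + \<bar>x\<bar>) ^ k \<le> C * (exp (s/2 * x) + exp (- (s/2) * x))"
    using one_plus_abs_power_le_exp[of "s/2" k] assms by auto
  have shift: "integrable lborel (\<lambda>x. exp (r * x) * macdonald (x - a))" if "r > 0" for r
  proof -
    have "integrable lborel (\<lambda>x. exp (r * a) * (exp (r * (- a + 1 * x)) * macdonald (- a + 1 * x)))"
      using lborel_integrable_real_affine[OF integrable_macdonald_Mellin(1)[OF that], of 1 "- a"]
      by (intro integrable_mult_right) simp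
    moreover have "exp (r * a) * (exp (r * (- a + 1 * x)) * macdonald (- a + 1 * x))
        = exp (r * x) * macdonald (x - a)" for x
    proof -
      have "exp (r * a) * exp (r * (- a + 1 * x)) = exp (r * x)"
        by (simp add: algebra_simps flip: exp_add)
      then show ?thesis by (simp add: mult.assoc[symmetric])
    qed
    ultimately show ?thesis by (simp only:)
  qed
  have "integrable lborel (\<lambda>x. C * (exp ((3 * s / 2) * x) * macdonald (x - a)) + C * (exp (s/2 * x) * macdonald (x - a)))"
    using assms shift[of "3 * s / 2"] shift[of "s/2"]
    by (intro Bochner_Integration.integrable_add integrable_mult_right) auto
  then show ?thesis
  proof (rule Bochner_Integration.integrable_bound[OF _ _ AE_I2])
    fix x :: real
    have "(1 + \<bar>x\<bar>) ^ k * (exp (s * x) * macdonald (x - a))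
        \<le> C * (exp (s/2 * x) + exp (- (s/2) * x)) * (exp (s * x) * macdonald (x - a))"
      by (intro mult_right_mono C) auto
    also have "\<dots> = C * (exp ((3 * s / 2) * x) * macdonald (x - a)) + C * (exp (s/2 * x) * macdonald (x - a))"
    proof -
      have *: "exp ((3 * s / 2) * x) = exp (s/2 * x) * exp (s * x)"
          "exp (s/2 * x) = exp (- (s/2) * x) * exp (s * x)"
        by (simp_all add: field_simps flip: exp_add)
      show ?thesis by (subst *(1), subst (3) *(2)) (simp only: distrib_left distrib_right mult.assoc)
    qed
    finally show "norm ((1 + \<bar>x\<bar>) ^ k * (exp (s * x) * macdonald (x - a))) \<le>
        norm (C * (exp ((3 * s / 2) * x) * macdonald (x - a)) + C * (exp (s/2 * x) * macdonald (x - a)))"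
      using C(1) by simp
  qed simp
qed

text \<open>
  The arithmetic-geometric mean inequality \<open>2 exp (x/2) \<le> exp u + exp (x - u)\<close> leaves half of the
  exponent in the integrand.
\<close>

lemma macdonald_mult_exp_exp_le: "macdonald x * exp (exp (x / 2)) \<le> macdonald (x - ln 4)"
proof -
  have "ennreal (macdonald x * exp (exp (x/2)))
      = (\<integral>\<^sup>+ u. ennreal (exp (- exp u - exp (x - u))) * ennreal (exp (exp (x/2))) \<partial>lborel)"
    by (simp add: nn_integral_multc nn_integral_macdonald ennreal_mult')
  also have "\<dots> \<le> (\<integral>\<^sup>+ u. ennreal (exp (- ((1/2) * exp u) - (1/2) * exp (x - u))) \<partial>lborel)"
  proof (intro nn_integral_mono)
    fix u :: real
    have "0 \<le> (exp (u/2) - exp ((x-u)/2))\<^sup>2" by simp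
    also have "\<dots> = exp u + exp (x - u) - 2 * exp (x/2)"
      by (simp add: power2_eq_square algebra_simps diff_divide_distrib flip: exp_add)
    finally have "exp (- exp u - exp (x - u)) * exp (exp (x/2)) \<le> exp (- ((1/2) * exp u) - (1/2) * exp (x - u))"
      by (simp flip: exp_add)
    then show "ennreal (exp (- exp u - exp (x - u))) * ennreal (exp (exp (x/2)))
        \<le> ennreal (exp (- ((1/2) * exp u) - (1/2) * exp (x - u)))"
      by (simp add: ennreal_leI flip: ennreal_mult')
  qed
  also have "\<dots> = ennreal (macdonald (x + ln (1/2) + ln (1/2)))"
    by (rule nn_integral_macdonald_scaled) auto
  also have "x + ln (1/2) + ln (1/2) = x - ln (4::real)"
    using ln_realpow[of 2 2] by (simp add: ln_div)
  finally show ?thesis by simp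
qed

section \<open>The function z / (exp z - 1)\<close>

definition todd :: "'a::{real_normed_field,banach} \<Rightarrow> 'a" where
  "todd z = (if z = 0 then 1 else z / (exp z - 1))"

lemma todd_of_real: "todd (of_real x) = (of_real (todd x) :: 'a::{real_normed_field,banach})"
  by (auto simp: todd_def exp_of_real)

lemma todd_nonneg: "todd (x::real) \<ge> 0"
proof (cases "x > 0")
  case False
  then show ?thesis by (auto simp: todd_def intro!: divide_nonpos_nonpos)
qed (simp add: todd_def)

lemma nn_integral_todd:
  "(\<integral>\<^sup>+ w. ennreal (1 / ((1 + exp w) * (1 + exp (z - w)))) \<partial>lborel) = ennreal (todd (z::real))"
proof -
  define f where "f w = 1 / ((1 + exp w) * (1 + exp (z - w)))" for w :: real
  \<comment> \<open>A primitive from partial fractions in \<open>exp w\<close>, normalised to vanish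
    at \<open>+\<infinity>\<close>. At \<open>z = 0\<close> the two linear factors coincide, so a
    separate primitive is needed.\<close>
  define F where "F w = (if z = 0 then - 1 / (1 + exp w)
      else (ln (1 + exp w) - ln (exp w + exp z)) / (exp z - 1))" for w :: real
  have pos: "1 + exp w > 0" "exp w + exp z > 0" for w :: real
    by (auto intro!: add_pos_pos)
  have f_eq: "f w = exp w / ((1 + exp w) * (exp w + exp z))" for w
    unfolding f_def using pos[of w] by (simp add: exp_diff field_simps)
  have F': "(F has_real_derivative f w) (at w)" for w
  proof (cases "z = 0")
    case True
    have "(F has_real_derivative exp w / (1 + exp w)\<^sup>2) (at w)"
      unfolding F_def using True pos[of w]
      by (auto intro!: derivative_eq_intros simp: power2_eq_square)
    then show ?thesis using True by (simp add: f_eq power2_eq_square add.commute)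
  next
    case False
    have "((\<lambda>w. (ln (1 + exp w) - ln (exp w + exp z)) / (exp z - 1)) has_real_derivative
        (exp w / (1 + exp w) - exp w / (exp w + exp z)) / (exp z - 1)) (at w)"
      using pos[of w] False by (auto intro!: derivative_eq_intros)
    moreover have "(exp w / (1 + exp w) - exp w / (exp w + exp z)) / (exp z - 1) = f w"
      unfolding f_eq using pos[of w] False by (simp add: divide_simps) (simp add: algebra_simps)
    ultimately show ?thesis using False by (simp add: F_def[abs_def])
  qed
  have cont: "isCont f w" for w
    unfolding f_def using pos[of w] pos[of "z - w"]
    by (intro continuous_intros) (auto simp: add_pos_pos less_imp_neq[symmetric])
  have lim_top: "(F \<longlongrightarrow> 0) at_top"
  proof (cases "z = 0")
    case False
    define Z where "Z = exp z"
    have "((\<lambda>w. (ln (1 + exp w) - ln (exp w + Z)) / (Z - 1)) \<longlongrightarrow> 0 / (Z - 1)) at_top"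
    proof (intro tendsto_divide tendsto_const)
      have "Z > 0" by (simp add: Z_def)
      then show "((\<lambda>w. ln (1 + exp w) - ln (exp w + Z)) \<longlongrightarrow> 0) at_top" by real_asymp
    qed (use False in \<open>simp add: Z_def\<close>)
    then show ?thesis using False by (simp add: F_def[abs_def] Z_def)
  next
    case True
    have "((\<lambda>w::real. - 1 / (1 + exp w)) \<longlongrightarrow> 0) at_top" by real_asymp
    then show ?thesis using True by (simp add: F_def[abs_def])
  qed
  have lim_bot: "(F \<longlongrightarrow> - todd z) at_bot"
  proof (cases "z = 0")
    case False
    have "((\<lambda>w. (ln (1 + exp w) - ln (exp w + exp z)) / (exp z - 1)) \<longlongrightarrow> (ln (1 + 0) - ln (0 + exp z)) / (exp z - 1)) at_bot"
      using False by (intro tendsto_intros exp_at_bot) auto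
    then show ?thesis using False by (simp add: F_def[abs_def] todd_def)
  next
    case True
    have "((\<lambda>w::real. - 1 / (1 + exp w)) \<longlongrightarrow> - 1) at_bot" by real_asymp
    then show ?thesis using True by (simp add: F_def[abs_def] todd_def)
  qed
  have "set_integrable lborel (einterval (-\<infinity>) \<infinity>) f" "(LBINT x=-\<infinity>..\<infinity>. f x) = 0 - (- todd z)"
    using interval_integral_FTC_nonneg[of "-\<infinity>" "\<infinity>" F f "- todd z" 0] F' cont lim_top lim_bot
      pos by (auto simp: ereal_tendsto_simps f_def)
  then have "integrable lborel f" "integral\<^sup>L lborel f = todd z"
    by (auto simp: set_integrable_def interval_lebesgue_integral_def set_lebesgue_integral_def)
  moreover have "f w \<ge> 0" for w unfolding f_eq using pos[of w] by auto
  ultimately show ?thesis unfolding f_def by (subst nn_integral_eq_integral) auto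
qed

text \<open>Both Macdonald functions are written out and \<open>x\<close> is integrated first,
  giving the reciprocal of \<open>exp (- u) + exp (z - v)\<close>. The coordinate
  \<open>w = v - u\<close> then makes \<open>u\<close> elementary, and
  \<open>nn_integral_todd\<close> remains.\<close>

lemma nn_integral_macdonald_convolution:
  "(\<integral>\<^sup>+ x. ennreal (exp x * macdonald x * macdonald (x + z)) \<partial>lborel) = ennreal (todd z)"
proof -
  let ?G = "\<lambda>u w. ennreal (exp (1 * u - (1 + exp w) * exp u) / (1 + exp (z - w)))"
  let ?E = "\<lambda>x u v. ennreal (exp (x - exp u - exp (x - u) - exp v - exp (x + z - v)))"
  have prodint: "ennreal (exp x * macdonald x * macdonald (x + z)) =
     (\<integral>\<^sup>+ u. \<integral>\<^sup>+ v. ?E x u v \<partial>lborel \<partial>lborel)" for x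
  proof -
    have "(\<integral>\<^sup>+ v. ?E x u v \<partial>lborel)
      = ennreal (exp (x - exp u - exp (x - u))) * ennreal (macdonald (x + z))" for u
      by (simp add: nn_integral_macdonald[symmetric] nn_integral_cmult[symmetric] del: nn_integral_cmult)
         (simp add: ennreal_mult'[symmetric] algebra_simps flip: exp_add)
    moreover have "(\<integral>\<^sup>+ u. ennreal (exp (x - exp u - exp (x - u))) \<partial>lborel) = ennreal (exp x) * ennreal (macdonald x)"
      by (simp add: nn_integral_macdonald[symmetric] nn_integral_cmult[symmetric] del: nn_integral_cmult)
         (simp add: ennreal_mult'[symmetric] algebra_simps flip: exp_add)
    ultimately show ?thesis by (simp add: nn_integral_multc ennreal_mult')
  qed
  have "(\<integral>\<^sup>+ x. ennreal (exp x * macdonald x * macdonald (x + z)) \<partial>lborel)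
      = (\<integral>\<^sup>+ x. \<integral>\<^sup>+ u. \<integral>\<^sup>+ v. ?E x u v \<partial>lborel \<partial>lborel \<partial>lborel)"
    by (simp only: prodint)
  also have "\<dots> = (\<integral>\<^sup>+ u. \<integral>\<^sup>+ x. \<integral>\<^sup>+ v. ?E x u v \<partial>lborel \<partial>lborel \<partial>lborel)"
    by (rule lborel_pair.Fubini') measurable
  also have "\<dots> = (\<integral>\<^sup>+ u. \<integral>\<^sup>+ v. \<integral>\<^sup>+ x. ?E x u v \<partial>lborel \<partial>lborel \<partial>lborel)"
    by (rule nn_integral_cong) (rule lborel_pair.Fubini', measurable)
  also have "\<dots> = (\<integral>\<^sup>+ u. \<integral>\<^sup>+ v. ennreal (exp (- exp u - exp v) / (exp (- u) + exp (z - v))) \<partial>lborel \<partial>lborel)"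
  proof (intro nn_integral_cong)
    fix u v :: real
    define B where "B = exp (- u) + exp (z - v)"
    have B: "B > 0" by (simp add: B_def add_pos_pos)
    have "(\<integral>\<^sup>+ x. ?E x u v \<partial>lborel)
       = (\<integral>\<^sup>+ x. ennreal (exp (- exp u - exp v)) * ennreal (exp (1 * x - B * exp x)) \<partial>lborel)"
      by (intro nn_integral_cong) (simp add: B_def ennreal_mult'[symmetric] algebra_simps flip: exp_add)
    also have "\<dots> = ennreal (exp (- exp u - exp v)) * ennreal (Gamma 1 * exp (- 1 * ln B))"
      using B by (subst nn_integral_cmult) (simp_all only: nn_integral_exp_scaled zero_less_one, measurable)
    also have "\<dots> = ennreal (exp (- exp u - exp v) / B)"
      using B by (simp add: ennreal_mult'[symmetric] exp_minus divide_inverse)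
    finally show "(\<integral>\<^sup>+ x. ?E x u v \<partial>lborel)
      = ennreal (exp (- exp u - exp v) / (exp (- u) + exp (z - v)))" by (simp add: B_def)
  qed
  also have "\<dots> = (\<integral>\<^sup>+ u. \<integral>\<^sup>+ w. ?G u w \<partial>lborel \<partial>lborel)"
  proof (rule nn_integral_cong)
    fix u :: real
    \<comment> \<open>With \<open>v = u + w\<close> the denominator is \<open>exp (- u)\<close>
      times a function of \<open>w\<close> alone, and \<open>u\<close> occurs only in a Gamma type
      integrand.\<close>
    have pw: "exp (- exp u - exp (u + 1 * w)) / (exp (- u) + exp (z - (u + 1 * w)))
        = exp (1 * u - (1 + exp w) * exp u) / (1 + exp (z - w))" for w
    proof -
      have "exp (- u) + exp (z - (u + 1 * w)) = exp (- u) * (1 + exp (z - w))"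
        by (simp add: algebra_simps flip: exp_add)
      moreover have "exp (- exp u - exp (u + 1 * w)) = exp (- u) * exp (1 * u - (1 + exp w) * exp u)"
        by (simp add: algebra_simps flip: exp_add)
      ultimately show ?thesis by simp
    qed
    have "(\<integral>\<^sup>+ v. ennreal (exp (- exp u - exp v) / (exp (- u) + exp (z - v))) \<partial>lborel)
      = (\<integral>\<^sup>+ w. ennreal (exp (- exp u - exp (u + 1 * w)) / (exp (- u) + exp (z - (u + 1 * w)))) \<partial>lborel)"
      by (subst nn_integral_real_affine[where c = 1 and t = u]) auto
    also have "\<dots> = (\<integral>\<^sup>+ w. ?G u w \<partial>lborel)"
      by (simp only: pw)
    finally show "(\<integral>\<^sup>+ v. ennreal (exp (- exp u - exp v) / (exp (- u) + exp (z - v))) \<partial>lborel)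
      = (\<integral>\<^sup>+ w. ?G u w \<partial>lborel)" .
  qed
  also have "\<dots> = (\<integral>\<^sup>+ w. \<integral>\<^sup>+ u. ?G u w \<partial>lborel \<partial>lborel)"
    by (rule lborel_pair.Fubini') measurable
  also have "\<dots> = (\<integral>\<^sup>+ w. ennreal (1 / ((1 + exp w) * (1 + exp (z - w)))) \<partial>lborel)"
  proof (intro nn_integral_cong)
    fix w :: real
    have B: "1 + exp w > 0" "1 + exp (z - w) > 0" by (auto simp: add_pos_pos)
    have "(\<integral>\<^sup>+ u. ?G u w \<partial>lborel)
       = (\<integral>\<^sup>+ u. ennreal (exp (1 * u - (1 + exp w) * exp u)) * ennreal (1 / (1 + exp (z - w))) \<partial>lborel)"
      using B by (intro nn_integral_cong) (simp add: ennreal_mult'[symmetric])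
    also have "\<dots> = ennreal (Gamma 1 * exp (- 1 * ln (1 + exp w))) * ennreal (1 / (1 + exp (z - w)))"
      using B by (subst nn_integral_multc) (simp_all only: nn_integral_exp_scaled zero_less_one, measurable)
    also have "\<dots> = ennreal (1 / ((1 + exp w) * (1 + exp (z - w))))"
      using B by (simp add: ennreal_mult''[symmetric] exp_minus divide_inverse)
    finally show "(\<integral>\<^sup>+ u. ?G u w \<partial>lborel)
      = ennreal (1 / ((1 + exp w) * (1 + exp (z - w))))" .
  qed
  also have "\<dots> = ennreal (todd z)" by (rule nn_integral_todd)
  finally show ?thesis .
qed

lemma todd_nonzero_strip: "exp z \<noteq> 1" if "z \<noteq> 0" "\<bar>Im z\<bar> < 2 * pi"
proof
  assume "exp z = 1"
  then obtain n :: int where n: "Re z = 0" "Im z = of_int (2 * n) * pi" unfolding exp_eq_1 by auto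
  then have "\<bar>real_of_int n\<bar> < 1" using that(2) by (auto simp: abs_mult)
  then have "n = 0" by linarith
  then show False using n that(1) by (simp add: complex_eq_iff)
qed

text \<open>\<open>todd\<close> is the reciprocal of the difference quotient of \<open>exp\<close>
  at 0. That quotient is entire by removal of the singularity, and its zeros nearest to 0 are
  \<open>\<plusminus> 2 \<pi> \<i>\<close>.\<close>

lemma todd_holomorphic: "todd holomorphic_on {z. \<bar>Im z\<bar> < 2 * pi}"
proof -
  define h where "h z = (if z = 0 then deriv exp 0 else (exp z - exp 0) / (z - 0))" for z :: complex
  have "h holomorphic_on UNIV" unfolding h_def[abs_def]
    by (rule pole_lemma) (auto intro: holomorphic_intros)
  then have "h holomorphic_on {z. \<bar>Im z\<bar> < 2 * pi}" by (rule holomorphic_on_subset) auto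
  moreover have "h z \<noteq> 0" if "\<bar>Im z\<bar> < 2 * pi" for z
    using todd_nonzero_strip[OF _ that] by (auto simp: h_def DERIV_imp_deriv[OF DERIV_exp])
  ultimately have "(\<lambda>z. inverse (h z)) holomorphic_on {z. \<bar>Im z\<bar> < 2 * pi}"
    by (intro holomorphic_on_inverse) auto
  then show ?thesis
    by (rule holomorphic_transform) (auto simp: h_def todd_def DERIV_imp_deriv[OF DERIV_exp])
qed

text \<open>Compactness handles \<open>Re z \<le> 1\<close>. For larger real part the denominator
  has size \<open>exp (Re z)\<close>, and half of that rate is given up to absorb the numerator
  \<open>z\<close>.\<close>

lemma todd_bound_strip:
  assumes b: "b < 2 * pi"
  obtains C where "C > 0" "\<And>z. \<bar>Im z\<bar> \<le> b \<Longrightarrow> Re z \<ge> a \<Longrightarrow> norm (todd z) \<le> C * exp (- Re z / 2)"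
proof -
  define K where "K = cbox (Complex a (- b)) (Complex 1 b)"
  have Kim: "\<bar>Im z\<bar> < 2 * pi" if "z \<in> K" for z using that b by (auto simp: K_def in_cbox_complex_iff)
  have "continuous_on K (\<lambda>z. todd z * exp (z / 2))"
    using holomorphic_on_imp_continuous_on[OF todd_holomorphic] Kim
    by (intro continuous_intros) (auto elim!: continuous_on_subset)
  then have "compact ((\<lambda>z. todd z * exp (z / 2)) ` K)"
    by (intro compact_continuous_image) (auto simp: K_def)
  then obtain B where B: "B > 0" "\<And>z. z \<in> K \<Longrightarrow> norm (todd z * exp (z / 2)) \<le> B"
  proof -
    obtain B where "B > 0" "\<forall>y\<in>(\<lambda>z. todd z * exp (z / 2)) ` K. norm y \<le> B"
      using compact_imp_bounded[OF \<open>compact _\<close>] unfolding bounded_pos by blast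
    then show ?thesis using that by blast
  qed
  have large: "norm (todd z) \<le> 40 * exp (- Re z / 2)" if z: "\<bar>Im z\<bar> \<le> b" "Re z \<ge> 1" for z
  proof -
    have "norm z \<le> \<bar>Re z\<bar> + \<bar>Im z\<bar>" by (rule cmod_le)
    also have "\<dots> \<le> Re z + 2 * pi" using z b by auto
    also have "\<dots> \<le> 10 * Re z" using pi_less_4 z by linarith
    also have "\<dots> \<le> 10 * (2 * exp (Re z / 2))" using exp_ge_add_one_self[of "Re z / 2"] by linarith
    finally have 1: "norm z \<le> 20 * exp (Re z / 2)" by simp
    have "exp (Re z) \<ge> 2" using exp_ge_add_one_self[of "Re z"] z by linarith
    then have "exp (Re z) / 2 \<le> norm (exp z) - norm (1::complex)" by simp
    also have "\<dots> \<le> norm (exp z - 1)" by (rule norm_triangle_ineq2)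
    finally have 2: "exp (Re z) / 2 \<le> norm (exp z - 1)" .
    have "norm (todd z) = norm z / norm (exp z - 1)"
      using z by (auto simp: todd_def norm_divide)
    also have "\<dots> \<le> (20 * exp (Re z / 2)) / (exp (Re z) / 2)"
      using 1 2 by (intro frac_le) auto
    also have "\<dots> = 40 * exp (- Re z / 2)" by (simp add: exp_diff[symmetric] flip: exp_diff) (simp add: field_simps flip: exp_add)
    finally show ?thesis .
  qed
  have "norm (todd z) \<le> (B + 40) * exp (- Re z / 2)" if z: "\<bar>Im z\<bar> \<le> b" "Re z \<ge> a" for z
  proof (cases "Re z \<ge> 1")
    case True
    have "40 * exp (- Re z / 2) \<le> (B + 40) * exp (- Re z / 2)" using B by simp
    then show ?thesis using large[OF z(1) True] by linarith
  next
    case False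
    then have "z \<in> K" using z by (auto simp: K_def in_cbox_complex_iff)
    then have "norm (todd z) * exp (Re z / 2) \<le> B" using B(2)[of z] by (simp add: norm_mult)
    then have "norm (todd z) \<le> B * exp (- Re z / 2)" by (simp add: exp_minus field_simps)
    also have "\<dots> \<le> (B + 40) * exp (- Re z / 2)" by simp
    finally show ?thesis .
  qed
  then show ?thesis using B(1) by (intro that[of "B + 40"]) auto
qed

section \<open>Differential equation and behaviour at minus infinity of the Macdonald
  function\<close>

definition macdonald_slope :: "real \<Rightarrow> real" where
  "macdonald_slope x = (LINT u|lborel. exp (u - exp u - exp (x - u)))"

lemma integrable_macdonald_slope: "integrable lborel (\<lambda>u::real. exp (u - exp u - exp (x - u)))"
  by (rule Bochner_Integration.integrable_bound[OF integrable_Gamma_exp(1)[of 1] _ AE_I2]) auto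

lemma has_real_derivative_macdonald: "(macdonald has_real_derivative - macdonald_slope x) (at x)"
proof -
  define g where "g u = 2 * exp (1 - x) * exp (1 * u - exp u)" for u :: real
  have "((\<lambda>w. LINT u|lborel. exp (- exp u - exp (w - u))) has_real_derivative
      (LINT u|lborel. - exp (x - u) * exp (- exp u - exp (x - u)))) (at x)"
  proof (rule has_field_derivative_integral(1)[where S = "ball x 1" and g = g])
    show "((\<lambda>w. exp (- exp u - exp (w - u))) has_real_derivative - exp (w - u) * exp (- exp u - exp (w - u))) (at w)" for w u
      by (auto intro!: derivative_eq_intros)
    show "integrable lborel g" unfolding g_def
      by (intro integrable_mult_right integrable_Gamma_exp) auto
    show "norm (- exp (w - u) * exp (- exp u - exp (w - u))) \<le> g u" if "w \<in> ball x 1" for w u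
    proof -
      \<comment> \<open>Bounding \<open>y * exp (- y)\<close> by a constant would leave
        \<open>exp (- exp u)\<close>, which does not decay at \<open>-\<infinity>\<close>; the bound
        \<open>2 / y\<close> supplies a factor \<open>exp u\<close>.\<close>
      define y where "y = exp (w - u)"
      have "y > 0" by (simp add: y_def)
      have "y\<^sup>2 / 2 \<le> exp y" using exp_lower_Taylor_quadratic[of y] \<open>y > 0\<close> by simp
      then have "y * exp (- y) \<le> 2 / y" using \<open>y > 0\<close> by (simp add: exp_minus field_simps power2_eq_square)
      also have "2 / y = 2 * exp (u - w)" by (simp add: y_def exp_diff)
      also have "\<dots> \<le> 2 * exp (1 - x + u)" using that by (auto simp: dist_real_def)
      finally have "y * exp (- y) * exp (- exp u) \<le> 2 * exp (1 - x + u) * exp (- exp u)"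
        by (intro mult_right_mono) auto
      then show ?thesis by (simp add: y_def g_def abs_mult algebra_simps flip: exp_add)
    qed
  qed (auto intro: integrable_macdonald)
  moreover have "(LINT u|lborel. - exp (x - u) * exp (- exp u - exp (x - u))) = - macdonald_slope x"
  proof -
    \<comment> \<open>The reflection of \<open>u\<close> to \<open>x - u\<close> preserves the
      exponent \<open>- exp u - exp (x - u)\<close> and trades the factor \<open>exp (x - u)\<close>
      for \<open>exp u\<close>, the form used in \<open>macdonald_slope\<close>.\<close>
    have "(LINT u|lborel. - exp (x - u) * exp (- exp u - exp (x - u)))
        = (LINT u|lborel. - exp (x - (x + (-1) * u)) * exp (- exp (x + (-1) * u) - exp (x - (x + (-1) * u))))"
      by (subst lborel_integral_real_affine[where c = "-1" and t = x]) auto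
    also have "\<dots> = (LINT u|lborel. - exp (u - exp u - exp (x - u)))"
      by (intro Bochner_Integration.integral_cong) (simp_all add: algebra_simps flip: exp_add)
    finally show ?thesis by (simp add: macdonald_slope_def)
  qed
  ultimately show ?thesis by (simp add: macdonald_def[abs_def])
qed

text \<open>With the previous derivative this is \<open>K'' = exp x * K\<close>, the modified Bessel
  equation of order 0 in logarithmic coordinates.\<close>

lemma has_real_derivative_macdonald_slope:
  "(macdonald_slope has_real_derivative - exp x * macdonald x) (at x)"
proof -
  define g where "g u = exp 2 * exp (1 * u - exp u)" for u :: real
  have "((\<lambda>w. LINT u|lborel. exp (u - exp u - exp (w - u))) has_real_derivative
      (LINT u|lborel. - exp x * exp (- exp u - exp (x - u)))) (at x)"
  proof (rule has_field_derivative_integral(1)[where S = "ball x 1" and g = g])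
    show "((\<lambda>w. exp (u - exp u - exp (w - u))) has_real_derivative - exp w * exp (- exp u - exp (w - u))) (at w)" for w u
      by (auto intro!: derivative_eq_intros simp: algebra_simps simp flip: exp_add)
    show "integrable lborel g" unfolding g_def
      by (intro integrable_mult_right integrable_Gamma_exp) auto
    show "norm (- exp w * exp (- exp u - exp (w - u))) \<le> g u" if "w \<in> ball x 1" for w u
    proof -
      have "exp w * exp (- exp u - exp (w - u)) \<le> exp w * (exp (- 1 * w) * exp (1 * u - exp u))"
        by (intro mult_left_mono macdonald_integrand_le) auto
      also have "\<dots> = exp (1 * u - exp u)" by (simp flip: exp_add)
      also have "\<dots> \<le> g u" by (simp add: g_def)
      finally show ?thesis by (simp add: abs_mult)
    qed
  qed (auto intro: integrable_macdonald_slope)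
  then show ?thesis
    using integrable_macdonald by (simp add: macdonald_def macdonald_slope_def[abs_def])
qed

text \<open>This is \<open>\<Gamma>'(1)\<close>, by differentiating Euler's integral in
  \<open>s\<close>; it is the source of Euler's constant on the analytic side.\<close>

lemma has_bochner_integral_Gamma_deriv_1:
  "has_bochner_integral lborel (\<lambda>u. u * exp (u - exp u)) (- euler_mascheroni :: real)"
proof -
  \<comment> \<open>For \<open>s\<close> between 1/2 and 3/2 the exponential is at most the larger
    of its values at the two end points, hence at most their sum.\<close>
  define g where "g u = (1 + \<bar>u\<bar>) ^ 1 * exp (1/2 * u - exp u) + (1 + \<bar>u\<bar>) ^ 1 * exp (3/2 * u - exp u)" for u :: real
  note der = has_field_derivative_integral[where S = "{1/2<..<3/2}" and g = g and z = 1
      and f = "\<lambda>s u::real. exp (s * u - exp u)" and f' = "\<lambda>s u. u * exp (s * u - exp u)" and M = lborel]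
  have 1: "((\<lambda>s. exp (s * u - exp u)) has_real_derivative u * exp (s * u - exp u)) (at s)" for s u
    by (auto intro!: derivative_eq_intros)
  have 2: "norm (u * exp (s * u - exp u)) \<le> g u" if "s \<in> {1/2<..<3/2}" for s u
  proof -
    have "exp (s * u - exp u) \<le> exp (1/2 * u - exp u) + exp (3/2 * u - exp u)"
    proof (cases "u \<ge> 0")
      case True
      then have "s * u \<le> 3/2 * u" using that by (intro mult_right_mono) auto
      then have "exp (s * u - exp u) \<le> exp (3/2 * u - exp u)" by simp
      then show ?thesis by (smt (verit) exp_gt_zero)
    next
      case False
      then have "s * u \<le> 1/2 * u" using that by (intro mult_right_mono_neg) auto
      then have "exp (s * u - exp u) \<le> exp (1/2 * u - exp u)" by simp
      then show ?thesis by (smt (verit) exp_gt_zero)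
    qed
    then have "\<bar>u\<bar> * exp (s * u - exp u) \<le> (1 + \<bar>u\<bar>) * (exp (1/2 * u - exp u) + exp (3/2 * u - exp u))"
      by (intro mult_mono) auto
    then show ?thesis by (simp add: g_def abs_mult distrib_left)
  qed
  have 3: "integrable lborel g" unfolding g_def
    by (intro Bochner_Integration.integrable_add integrable_power_Gamma_exp) auto
  have int: "integrable lborel (\<lambda>u::real. u * exp (1 * u - exp u))"
    by (rule der(2)) (use 1 2 3 integrable_Gamma_exp(1) in auto)
  have "((\<lambda>s. LINT u|lborel. exp (s * u - exp u)) has_real_derivative (LINT u|lborel. u * exp (1 * u - exp u))) (at 1)"
    by (rule der(1)) (use 1 2 3 integrable_Gamma_exp(1) in auto)
  then have A: "(Gamma has_real_derivative (LINT u|lborel. u * exp (1 * u - exp u))) (at 1)"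
    by (rule has_field_derivative_transform_within_open[where S = "{0<..}"])
       (auto simp: integrable_Gamma_exp(2))
  have B: "(Gamma has_real_derivative Gamma 1 * Digamma 1) (at 1)"
    by (rule has_field_derivative_Gamma) (auto elim!: nonpos_Ints_cases)
  have "(LINT u|lborel. u * exp (1 * u - exp u)) = (- euler_mascheroni :: real)"
    using DERIV_unique[OF A B] by simp
  with int show ?thesis by (simp add: has_bochner_integral_iff)
qed

text \<open>Half of the natural rate \<open>exp v\<close> on purpose: with \<open>v = x - u\<close>,
  against the weight \<open>exp (u - exp u)\<close>, the full rate would cancel all decay at
  \<open>u = -\<infinity>\<close>.\<close>

lemma one_minus_exp_minus_exp_le: "1 - exp (- exp v) \<le> exp (v / 2)" for v :: real
proof (cases "v \<ge> 0")
  case True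
  then have "1 \<le> exp (v / 2)" by simp
  then show ?thesis by (smt (verit) exp_gt_zero)
next
  case False
  have "1 - exp (- exp v) \<le> exp v" using exp_ge_add_one_self[of "- exp v"] by linarith
  also have "\<dots> \<le> exp (v / 2)" using False by simp
  finally show ?thesis .
qed

lemma macdonald_slope_at_bot: "(macdonald_slope \<longlongrightarrow> 1) at_bot"
  and macdonald_slope_mult_at_bot: "((\<lambda>x. x * (1 - macdonald_slope x)) \<longlongrightarrow> 0) at_bot"
proof -
  have bound: "\<bar>1 - macdonald_slope x\<bar> \<le> Gamma (1/2) * exp (x / 2)" for x
  proof -
    have i1: "integrable lborel (\<lambda>u::real. exp (1 * u - exp u))" "(LINT u|lborel. exp (1 * u - exp u)) = (1::real)"
      using integrable_Gamma_exp[of 1] by (simp_all only: zero_less_one Gamma_1)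
    have eq: "1 - macdonald_slope x = (LINT u|lborel. exp (1 * u - exp u) - exp (u - exp u - exp (x - u)))"
      using i1 integrable_macdonald_slope by (simp add: macdonald_slope_def)
    have "0 \<le> 1 - macdonald_slope x" unfolding eq
      by (intro Bochner_Integration.integral_nonneg) auto
    moreover have "1 - macdonald_slope x \<le> (LINT u|lborel. exp (x / 2) * exp (1/2 * u - exp u))"
      unfolding eq
    proof (intro integral_mono)
      fix u :: real
      have "exp (1 * u - exp u) - exp (u - exp u - exp (x - u)) = exp (u - exp u) * (1 - exp (- exp (x - u)))"
        by (simp add: algebra_simps flip: exp_add)
      also have "\<dots> \<le> exp (u - exp u) * exp ((x - u) / 2)"
        by (intro mult_left_mono one_minus_exp_minus_exp_le) auto
      also have "\<dots> = exp (x / 2) * exp (1/2 * u - exp u)" by (simp add: field_simps flip: exp_add)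
      finally show "exp (1 * u - exp u) - exp (u - exp u - exp (x - u)) \<le> exp (x / 2) * exp (1/2 * u - exp u)" .
    qed (use i1(1) integrable_macdonald_slope integrable_Gamma_exp(1)[of "1/2"] in auto)
    moreover have "(LINT u|lborel. exp (x / 2) * exp (1/2 * u - exp u)) = exp (x/2) * Gamma (1/2)"
      by (subst integral_mult_right_zero) (subst integrable_Gamma_exp(2), auto)
    ultimately show ?thesis by (simp add: mult.commute)
  qed
  have "((\<lambda>x. 1 - macdonald_slope x) \<longlongrightarrow> 0) at_bot"
  proof (rule Lim_null_comparison[OF always_eventually])
    show "((\<lambda>x::real. Gamma (1/2) * exp (x / 2)) \<longlongrightarrow> 0) at_bot"
      by (rule tendsto_mult_right_zero) real_asymp
  qed (use bound in auto)
  from tendsto_diff[OF tendsto_const[of 1] this] show "(macdonald_slope \<longlongrightarrow> 1) at_bot" by simp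
  show "((\<lambda>x. x * (1 - macdonald_slope x)) \<longlongrightarrow> 0) at_bot"
  proof (rule Lim_null_comparison[OF always_eventually])
    show "((\<lambda>x::real. Gamma (1/2) * (\<bar>x\<bar> * exp (x / 2))) \<longlongrightarrow> 0) at_bot"
      by (rule tendsto_mult_right_zero) real_asymp
    show "\<forall>x. norm (x * (1 - macdonald_slope x)) \<le> Gamma (1/2) * (\<bar>x\<bar> * exp (x / 2))"
    proof
      fix x
      have "\<bar>x\<bar> * \<bar>1 - macdonald_slope x\<bar> \<le> \<bar>x\<bar> * (Gamma (1/2) * exp (x / 2))"
        by (intro mult_left_mono bound) auto
      then show "norm (x * (1 - macdonald_slope x)) \<le> Gamma (1/2) * (\<bar>x\<bar> * exp (x / 2))"
        unfolding real_norm_def abs_mult by (simp only: mult_ac)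
    qed
  qed
qed

lemma integrable_times_macdonald_slope: "integrable lborel (\<lambda>u::real. u * exp (u - exp u - exp (x - u)))"
  by (rule Bochner_Integration.integrable_bound[OF has_bochner_integral_Gamma_deriv_1[THEN integrable.intros] _ AE_I2])
     (auto simp: abs_mult intro!: mult_left_mono)

text \<open>Integration by parts of the constant 1 in the integral defining \<^const>\<open>macdonald\<close>.\<close>

lemma macdonald_by_parts:
  "macdonald x = 2 * (LINT u|lborel. u * exp (u - exp u - exp (x - u))) - x * macdonald_slope x"
proof -
  define L where "L = (LINT u|lborel. u * exp (u - exp u - exp (x - u)))"
  define e where "e u = exp (- exp u - exp (x - u))" for u
  \<comment> \<open>Differentiating \<open>u * e u\<close> gives three terms; \<open>r\<close> is
    the one that is not yet in the form of the claim.\<close>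
  define r where "r u = u * exp (x - u) * e u" for u
  have r_int: "integrable lborel r" "integral\<^sup>L lborel r = x * macdonald_slope x - L"
  proof -
    have *: "integrable lborel (\<lambda>u. (x - u) * exp (u - exp u - exp (x - u)))"
      "(LINT u|lborel. (x - u) * exp (u - exp u - exp (x - u))) = x * macdonald_slope x - L"
      using integrable_macdonald_slope[of x] integrable_times_macdonald_slope[of x]
      by (simp_all add: left_diff_distrib L_def macdonald_slope_def)
    \<comment> \<open>The exponent is symmetric under reflection of \<open>u\<close> to
      \<open>x - u\<close>, so \<open>r\<close> integrates to the two integrals already
      named.\<close>
    have r_eq: "r (x + (-1) * u) = (x - u) * exp (u - exp u - exp (x - u))" for u
      unfolding r_def e_def by (simp add: algebra_simps flip: exp_add)
    show "integrable lborel r"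
      using *(1) lborel_integrable_real_affine_iff[of "-1" r x] by (simp only: r_eq)
    show "integral\<^sup>L lborel r = x * macdonald_slope x - L"
      using *(2) by (subst lborel_integral_real_affine[where c = "-1" and t = x]) (simp_all only: r_eq, simp)
  qed
  define f where "f u = e u - u * exp (u - exp u - exp (x - u)) + r u" for u
  have f_int: "integrable lborel f"
    unfolding f_def e_def using integrable_times_macdonald_slope[of x] r_int integrable_macdonald[of x] by auto
  have "(LBINT u=-\<infinity>..\<infinity>. f u) = 0 - 0"
  proof (rule interval_integral_FTC_integrable[where F = "\<lambda>u. u * e u"])
    show "((\<lambda>u. u * e u) has_vector_derivative f u) (at u)" for u
      unfolding f_def e_def r_def has_real_derivative_iff_has_vector_derivative[symmetric]
      by (auto intro!: derivative_eq_intros simp: algebra_simps simp flip: exp_add)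
    show "isCont f u" for u unfolding f_def r_def e_def by (intro continuous_intros)
    show "set_integrable lborel (einterval (-\<infinity>) \<infinity>) f"
      using f_int by (simp add: set_integrable_def)
    have "((\<lambda>u::real. u * exp (- exp u)) \<longlongrightarrow> 0) at_top" by real_asymp
    then have "((\<lambda>u. u * e u) \<longlongrightarrow> 0) at_top"
      by (rule Lim_null_comparison[rotated, OF tendsto_norm_zero])
         (auto intro!: always_eventually simp: e_def abs_mult mult_left_mono)
    then show "(((\<lambda>u. u * e u) \<circ> real_of_ereal) \<longlongrightarrow> 0) (at_left \<infinity>)" by (simp add: ereal_tendsto_simps)
    define X where "X = exp x"
    have e_le: "e u \<le> exp (- (X * exp (- u)))" for u by (simp add: e_def X_def flip: exp_add)
    have e_abs: "\<bar>e u\<bar> = e u" for u by (simp add: e_def)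
    have "X > 0" by (simp add: X_def)
    then have "((\<lambda>u::real. u * exp (- (X * exp (- u)))) \<longlongrightarrow> 0) at_bot" by real_asymp
    then have "((\<lambda>u. u * e u) \<longlongrightarrow> 0) at_bot"
      by (rule Lim_null_comparison[rotated, OF tendsto_norm_zero])
         (auto intro!: always_eventually mult_left_mono simp: e_abs e_le abs_mult)
    then show "(((\<lambda>u. u * e u) \<circ> real_of_ereal) \<longlongrightarrow> 0) (at_right (-\<infinity>))" by (simp add: ereal_tendsto_simps)
  qed auto
  then have "integral\<^sup>L lborel f = 0"
    by (simp add: interval_lebesgue_integral_def set_lebesgue_integral_def)
  moreover have "integral\<^sup>L lborel f = macdonald x - L + (x * macdonald_slope x - L)"
    unfolding f_def e_def using integrable_times_macdonald_slope[of x] r_int integrable_macdonald[of x]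
    by (simp add: macdonald_def L_def)
  ultimately show ?thesis by (simp add: L_def)
qed

text \<open>Integration by parts writes the function as
  \<open>2 * L x + x * (1 - macdonald_slope x)\<close>, where \<open>L\<close> tends to
  \<open>\<Gamma>'(1)\<close>. The constant singles out one solution of the Bessel equation.\<close>

lemma macdonald_plus_at_bot: "((\<lambda>x. macdonald x + x) \<longlongrightarrow> - 2 * euler_mascheroni) at_bot"
proof -
  define L where "L x = (LINT u|lborel. u * exp (u - exp u - exp (x - u)))" for x :: real
  define C where "C = (LINT u|lborel. (1 + \<bar>u\<bar>) ^ 1 * exp (1/2 * u - exp (u::real)))"
  have bound: "\<bar>L x - (- euler_mascheroni)\<bar> \<le> C * exp (x / 2)" for x
  proof -
    note g = has_bochner_integral_Gamma_deriv_1[unfolded has_bochner_integral_iff]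
    note i = integrable_times_macdonald_slope[of x]
    have "L x - (- euler_mascheroni) = (LINT u|lborel. u * exp (u - exp u - exp (x - u)) - u * exp (u - exp u))"
      using g i by (simp add: L_def)
    also have "norm \<dots> \<le> (LINT u|lborel. exp (x / 2) * ((1 + \<bar>u\<bar>) ^ 1 * exp (1/2 * u - exp u)))"
    proof (rule Bochner_Integration.integral_norm_bound_integral)
      fix u :: real
      have "u * exp (u - exp u - exp (x - u)) - u * exp (u - exp u) = - u * exp (u - exp u) * (1 - exp (- exp (x - u)))"
        by (simp add: algebra_simps flip: exp_add)
      then have "norm (u * exp (u - exp u - exp (x - u)) - u * exp (u - exp u)) = \<bar>u\<bar> * exp (u - exp u) * (1 - exp (- exp (x - u)))"
        by (simp add: abs_mult)
      also have "\<dots> \<le> (1 + \<bar>u\<bar>) * exp (u - exp u) * exp ((x - u) / 2)"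
        by (intro mult_mono one_minus_exp_minus_exp_le) auto
      also have "\<dots> = exp (x / 2) * ((1 + \<bar>u\<bar>) ^ 1 * exp (1/2 * u - exp u))"
      proof -
        have "exp (u - exp u) * exp ((x - u) / 2) = exp (x / 2) * exp (1/2 * u - exp u)"
          by (simp add: field_simps flip: exp_add)
        then show ?thesis by simp
      qed
      finally show "norm (u * exp (u - exp u - exp (x - u)) - u * exp (u - exp u))
        \<le> exp (x / 2) * ((1 + \<bar>u\<bar>) ^ 1 * exp (1/2 * u - exp u))" .
    qed (use g i integrable_power_Gamma_exp[of "1/2" 1] in auto)
    also have "(LINT u|lborel. exp (x / 2) * ((1 + \<bar>u\<bar>) ^ 1 * exp (1/2 * u - exp u))) = C * exp (x / 2)"
      unfolding C_def by (subst integral_mult_right_zero) (rule mult.commute)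
    finally show ?thesis unfolding real_norm_def .
  qed
  have "((\<lambda>x. L x - (- euler_mascheroni)) \<longlongrightarrow> 0) at_bot"
  proof (rule Lim_null_comparison[OF always_eventually])
    show "((\<lambda>x::real. C * exp (x / 2)) \<longlongrightarrow> 0) at_bot"
      by (rule tendsto_mult_right_zero) real_asymp
  qed (use bound in auto)
  then have "(L \<longlongrightarrow> - euler_mascheroni) at_bot" by (rule LIM_zero_cancel)
  then have "((\<lambda>x. 2 * L x + x * (1 - macdonald_slope x)) \<longlongrightarrow> 2 * (- euler_mascheroni) + 0) at_bot"
    by (intro tendsto_intros macdonald_slope_mult_at_bot)
  moreover have "2 * L x + x * (1 - macdonald_slope x) = macdonald x + x" for x
    unfolding macdonald_by_parts L_def by (simp add: algebra_simps)
  ultimately show ?thesis by simp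
qed

section \<open>The entire continuation of the Macdonald function\<close>

text \<open>
  Frobenius' method at the singular point \<open>w = exp x = 0\<close> of the modified Bessel equation: the
  solutions are \<open>I\<close> and \<open>P - x I\<close>, with the following coefficients.
\<close>

definition bessel_coeff :: "nat \<Rightarrow> real" where
  "bessel_coeff k = 1 / (fact k)\<^sup>2"

text \<open>The harmonic numbers solve the recursion of Frobenius' method; Euler's constant adds the
  multiple of \<open>I\<close> that matches the limit of \<open>macdonald x + x\<close> at
  \<open>-\<infinity>\<close>.\<close>

definition frobenius_coeff :: "nat \<Rightarrow> real" where
  "frobenius_coeff k = 2 * (harm k - euler_mascheroni) / (fact k)\<^sup>2"

text \<open>Polymorphic, so that the real instance can enter the differential equation and the
  complex one the continuation.\<close>

definition entire_series :: "(nat \<Rightarrow> real) \<Rightarrow> 'a::{real_normed_field,banach} \<Rightarrow> 'a" where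
  "entire_series c w = suminf (\<lambda>k. of_real (c k) * w ^ k)"

text \<open>In the variable \<open>z\<close> instead of \<open>w = exp z\<close> the logarithm of
  the second solution is just \<open>z\<close>, so the function is entire.\<close>

definition macdonald_ext :: "'a::{real_normed_field,banach} \<Rightarrow> 'a" where
  "macdonald_ext z = entire_series frobenius_coeff (exp z) - z * entire_series bessel_coeff (exp z)"

text \<open>Comparison with the coefficients of \<open>M * cosh (sqrt (8 * w))\<close>: entire
  functions of growth order at most 1/2 in \<open>w\<close>.\<close>

definition order_half_coeff :: "(nat \<Rightarrow> real) \<Rightarrow> real \<Rightarrow> bool" where
  "order_half_coeff c M \<longleftrightarrow> M \<ge> 0 \<and> (\<forall>k. \<bar>c k\<bar> \<le> M * 8 ^ k / fact (2 * k))"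

text \<open>The central binomial coefficient is at most \<open>4 ^ k\<close>; the other factor
  \<open>2 ^ k\<close> pays for \<open>k + 1\<close>, needed because of the harmonic
  numbers.\<close>

lemma inverse_fact_square_le: "(real k + 1) / (fact k)\<^sup>2 \<le> 8 ^ k / fact (2 * k)"
proof -
  have "fact (2 * k) = fact k * fact k * (2 * k choose k)"
    using binomial_fact_lemma[of k "2 * k"] by simp
  then have "(fact (2 * k) :: real) = (fact k)\<^sup>2 * real (2 * k choose k)"
    by (metis of_nat_fact of_nat_mult power2_eq_square)
  also have "\<dots> \<le> (fact k)\<^sup>2 * 4 ^ k"
  proof -
    have "real (2 * k choose k) \<le> real (2 ^ (2 * k))" using binomial_le_pow2 of_nat_mono by blast
    then show ?thesis by (simp add: power_mult)
  qed
  finally have 1: "fact (2 * k) \<le> (fact k)\<^sup>2 * (4::real) ^ k" .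
  have "k + 1 \<le> 2 ^ k" by (induction k) auto
  then have 2: "real k + 1 \<le> 2 ^ k" using of_nat_mono[of "k + 1" "2 ^ k", where ?'a = real] by simp
  have "(real k + 1) * fact (2 * k) \<le> 2 ^ k * ((fact k)\<^sup>2 * 4 ^ k)"
    using 1 2 by (intro mult_mono) auto
  also have "\<dots> = 8 ^ k * (fact k)\<^sup>2" by (simp flip: power_mult_distrib)
  finally show ?thesis by (simp add: divide_simps mult.commute)
qed

lemma order_half_bessel: "order_half_coeff bessel_coeff 1"
  unfolding order_half_coeff_def
proof (intro conjI allI)
  fix k
  have "\<bar>bessel_coeff k\<bar> \<le> (real k + 1) / (fact k)\<^sup>2" by (simp add: bessel_coeff_def divide_right_mono)
  also note inverse_fact_square_le
  finally show "\<bar>bessel_coeff k\<bar> \<le> 1 * 8 ^ k / fact (2 * k)" by simp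
qed simp

lemma order_half_frobenius: "order_half_coeff frobenius_coeff (2 * (1 + euler_mascheroni))"
  unfolding order_half_coeff_def
proof (intro conjI allI)
  have g: "(euler_mascheroni :: real) > 0" by (rule euler_mascheroni_pos)
  then show "0 \<le> 2 * (1 + euler_mascheroni :: real)" by simp
  fix k
  have "harm k \<le> real k"
  proof (induction k)
    case (Suc k)
    have "inverse (real (Suc k)) \<le> 1" by (simp add: inverse_le_1_iff)
    then show ?case using Suc by (simp add: harm_Suc)
  qed (simp add: harm_def)
  then have "\<bar>harm k - euler_mascheroni\<bar> \<le> real k + (euler_mascheroni :: real)"
    using g harm_nonneg[of k, where ?'a = real] by linarith
  also have "\<dots> \<le> (1 + euler_mascheroni) * (real k + 1)" using g by (simp add: algebra_simps)
  finally have *: "\<bar>harm k - euler_mascheroni\<bar> \<le> (1 + euler_mascheroni) * (real k + 1)" .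
  have "\<bar>frobenius_coeff k\<bar> = 2 * (\<bar>harm k - euler_mascheroni\<bar> / (fact k)\<^sup>2)"
    unfolding frobenius_coeff_def abs_divide abs_mult by simp
  also have "\<dots> \<le> 2 * ((1 + euler_mascheroni) * (real k + 1) / (fact k)\<^sup>2)"
    using * by (intro mult_left_mono divide_right_mono) auto
  also have "\<dots> = 2 * (1 + euler_mascheroni) * ((real k + 1) / (fact k)\<^sup>2)" by simp
  also have "\<dots> \<le> 2 * (1 + euler_mascheroni) * (8 ^ k / fact (2 * k))"
    using g by (intro mult_left_mono inverse_fact_square_le) auto
  finally show "\<bar>frobenius_coeff k\<bar> \<le> 2 * (1 + euler_mascheroni) * 8 ^ k / fact (2 * k)" by simp
qed

text \<open>With \<open>y\<^sup>2 = 8 * r\<close> these are the even terms of the series of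
  \<open>exp y\<close>, and \<open>sqrt 8 \<le> 3\<close>.\<close>

lemma even_exp_terms:
  assumes "r \<ge> (0::real)"
  shows "summable (\<lambda>k. (8 * r) ^ k / fact (2 * k))"
    and "(suminf (\<lambda>k. (8 * r) ^ k / fact (2 * k))) \<le> exp (3 * sqrt r)"
proof -
  define y where "y = sqrt (8 * r)"
  have y: "y \<ge> 0" "8 * r = y ^ 2" using assms by (auto simp: y_def)
  have "8 * r \<le> (3 * sqrt r)\<^sup>2" using assms by (simp add: power_mult_distrib)
  then have y3: "y \<le> 3 * sqrt r" unfolding y_def using assms by (intro real_le_lsqrt) auto
  have nonneg: "(8 * r) ^ k / fact (2 * k) \<ge> 0" for k using assms by simp
  have part: "(\<Sum>k<n. (8 * r) ^ k / fact (2 * k)) \<le> exp (3 * sqrt r)" for n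
  proof -
    have "(\<Sum>k<n. (8 * r) ^ k / fact (2 * k)) = (\<Sum>k<n. y ^ (2 * k) /\<^sub>R fact (2 * k))"
    proof (rule sum.cong)
      fix k
      have "(8 * r) ^ k = y ^ (2 * k)" unfolding y(2) by (simp add: power_mult)
      then show "(8 * r) ^ k / fact (2 * k) = y ^ (2 * k) /\<^sub>R fact (2 * k)"
        by (simp add: divide_inverse mult.commute)
    qed simp
    also have "\<dots> = (\<Sum>j\<in>(\<lambda>k. 2 * k) ` {..<n}. y ^ j /\<^sub>R fact j)"
      by (subst sum.reindex) (auto simp: inj_on_def)
    also have "\<dots> \<le> (suminf (\<lambda>j. y ^ j /\<^sub>R fact j))"
      using y summable_exp_generic[of y] by (intro sum_le_suminf) auto
    also have "\<dots> = exp y" by (simp add: exp_def)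
    also have "\<dots> \<le> exp (3 * sqrt r)" using y3 by simp
    finally show ?thesis .
  qed
  show s: "summable (\<lambda>k. (8 * r) ^ k / fact (2 * k))"
    by (rule bounded_imp_summable[where B = "exp (3 * sqrt r)"])
       (use nonneg part[of "Suc _"] in \<open>auto simp: lessThan_Suc_atMost\<close>)
  show "(suminf (\<lambda>k. (8 * r) ^ k / fact (2 * k))) \<le> exp (3 * sqrt r)"
    by (rule suminf_le_const[OF s part])
qed

lemma entire_series_bounds:
  fixes w :: "'a::{real_normed_field,banach}"
  assumes "order_half_coeff c M"
  shows "summable (\<lambda>k. norm (of_real (c k) * w ^ k))"
    and "norm (entire_series c w) \<le> M * exp (3 * sqrt (norm w))"
    and "norm (entire_series c w - of_real (c 0)) \<le> 8 * M * norm w * exp (3 * sqrt (norm w))"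
proof -
  have M: "M \<ge> 0" "\<And>k. \<bar>c k\<bar> \<le> M * 8 ^ k / fact (2 * k)" using assms by (auto simp: order_half_coeff_def)
  define a where "a k = M * ((8 * norm w) ^ k / fact (2 * k))" for k
  have le: "norm (of_real (c k) * w ^ k) \<le> a k" for k
  proof -
    have "\<bar>c k\<bar> * norm w ^ k \<le> M * 8 ^ k / fact (2 * k) * norm w ^ k" by (intro mult_right_mono M) auto
    then show ?thesis by (simp add: norm_mult norm_power a_def power_mult_distrib)
  qed
  have a: "summable a" "suminf a \<le> M * exp (3 * sqrt (norm w))"
  proof -
    note e = even_exp_terms[OF norm_ge_zero[of w]]
    show "summable a" unfolding a_def by (rule summable_mult[OF e(1)])
    show "suminf a \<le> M * exp (3 * sqrt (norm w))"
      unfolding a_def suminf_mult[OF e(1)] by (rule mult_left_mono[OF e(2) M(1)])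
  qed
  show s: "summable (\<lambda>k. norm (of_real (c k) * w ^ k))"
    by (rule summable_comparison_test'[OF a(1)]) (use le in auto)
  have "norm (entire_series c w) \<le> suminf a"
    unfolding entire_series_def by (rule norm_suminf_le[OF le a(1)])
  then show "norm (entire_series c w) \<le> M * exp (3 * sqrt (norm w))" using a(2) by linarith
  have "entire_series c w - of_real (c 0) = (suminf (\<lambda>k. of_real (c (Suc k)) * w ^ Suc k))"
    unfolding entire_series_def using suminf_split_head[OF summable_norm_cancel[OF s]] by simp
  also have "norm \<dots> \<le> (suminf (\<lambda>k. 8 * norm w * a k))"
  proof (rule norm_suminf_le)
    fix k
    have "(fact (2 * k) :: real) \<le> fact (2 * Suc k)" by (rule fact_mono) auto
    then have "M * (8 * norm w) ^ Suc k / fact (2 * Suc k) \<le> M * (8 * norm w) ^ Suc k / fact (2 * k)"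
      using M(1) by (intro divide_left_mono mult_pos_pos) auto
    then show "norm (of_real (c (Suc k)) * w ^ Suc k) \<le> 8 * norm w * a k"
      using le[of "Suc k"] by (simp add: a_def mult_ac)
  qed (use a in \<open>auto intro: summable_mult\<close>)
  also have "\<dots> = 8 * norm w * suminf a" using a(1) by (rule suminf_mult)
  also have "\<dots> \<le> 8 * norm w * (M * exp (3 * sqrt (norm w)))" using a by (intro mult_left_mono) auto
  finally show "norm (entire_series c w - of_real (c 0)) \<le> 8 * M * norm w * exp (3 * sqrt (norm w))"
    by (simp add: mult_ac)
qed

lemma entire_series_of_real:
  assumes "order_half_coeff c M"
  shows "entire_series c (of_real x) = (of_real (entire_series c x) :: 'a::{real_normed_field,banach})"
  unfolding entire_series_def
  using summable_norm_cancel[OF entire_series_bounds(1)[OF assms, of x]]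
  by (simp add: suminf_of_real)

lemma macdonald_ext_of_real:
  "macdonald_ext (of_real x) = (of_real (macdonald_ext x) :: 'a::{real_normed_field,banach})"
  unfolding macdonald_ext_def exp_of_real
  by (simp add: entire_series_of_real[OF order_half_bessel] entire_series_of_real[OF order_half_frobenius])

lemma entire_series_has_derivative:
  fixes w :: "'a::{real_normed_field,banach}"
  assumes "order_half_coeff c M"
  shows "(entire_series c has_field_derivative (suminf (\<lambda>k. diffs (\<lambda>k. of_real (c k)) k * w ^ k))) (at w)"
  unfolding entire_series_def[abs_def]
  by (rule termdiffs_strong_converges_everywhere)
     (rule summable_norm_cancel[OF entire_series_bounds(1)[OF assms]])

lemma macdonald_ext_holomorphic: "macdonald_ext holomorphic_on A"
proof -
  have h: "entire_series c holomorphic_on UNIV" if "order_half_coeff c M" for c M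
    using entire_series_has_derivative[OF that] holomorphic_on_open by blast
  have "(\<lambda>z. entire_series c (exp z)) holomorphic_on A" if "order_half_coeff c M" for c M
    using holomorphic_on_compose_gen[OF holomorphic_on_exp h[OF that], of A] by (simp add: o_def)
  then show ?thesis unfolding macdonald_ext_def
    using order_half_bessel order_half_frobenius by (intro holomorphic_intros) auto
qed

text \<open>Both bounds hold for every imaginary part, since
  \<open>sqrt (norm (exp z)) = exp (Re z / 2)\<close>. The factor \<open>exp (Re z)\<close> of the
  first is what makes the remainder of the asymptotics small.\<close>

lemma macdonald_ext_approx:
  obtains C where "C > 0"
    "\<And>z::complex. norm (macdonald_ext z + z + 2 * of_real euler_mascheroni)
       \<le> C * (1 + norm z) * exp (Re z) * exp (3 * exp (Re z / 2))"
    "\<And>z::complex. norm (macdonald_ext z) \<le> C * (1 + norm z) * exp (3 * exp (Re z / 2))"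
proof -
  define M :: real where "M = 2 * (1 + euler_mascheroni)"
  have M: "M \<ge> 0" "order_half_coeff frobenius_coeff M"
    using order_half_frobenius by (simp_all add: M_def order_half_coeff_def)
  have sq: "sqrt (norm (exp z)) = exp (Re z / 2)" for z :: complex
    by (simp add: real_sqrt_unique power2_eq_square flip: exp_add)
  have 0: "frobenius_coeff 0 = - 2 * euler_mascheroni" "bessel_coeff 0 = 1"
    by (simp_all add: frobenius_coeff_def bessel_coeff_def harm_def)
  show ?thesis
  proof (rule that[of "8 * M + 8"])
    show "8 * M + 8 > 0" using M by linarith
    fix z :: complex
    define E where "E = exp (3 * exp (Re z / 2))"
    have E: "E > 0" by (simp add: E_def)
    note f = entire_series_bounds(2,3)[OF M(2), of "exp z", unfolded sq 0, folded E_def]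
    note b = entire_series_bounds(2,3)[OF order_half_bessel, of "exp z", unfolded sq 0, folded E_def]
    have "macdonald_ext z + z + 2 * of_real euler_mascheroni
        = (entire_series frobenius_coeff (exp z) - of_real (- 2 * euler_mascheroni))
          - z * (entire_series bessel_coeff (exp z) - of_real 1)"
      by (simp add: macdonald_ext_def algebra_simps)
    also have "norm \<dots> \<le> 8 * M * norm (exp z) * E + norm z * (8 * 1 * norm (exp z) * E)"
      by (rule order_trans[OF norm_triangle_ineq4 add_mono], rule f(2), unfold norm_mult, rule mult_left_mono[OF b(2)], simp)
    also have "\<dots> = 8 * M * 1 * (exp (Re z) * E) + 8 * norm z * (exp (Re z) * E)" by simp
    also have "\<dots> \<le> (8 * M) * (1 + norm z) * (exp (Re z) * E) + 8 * (1 + norm z) * (exp (Re z) * E)"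
      using M E by (intro add_mono mult_right_mono mult_left_mono) auto
    also have "\<dots> = (8 * M + 8) * (1 + norm z) * exp (Re z) * E" by (simp add: algebra_simps)
    finally show "norm (macdonald_ext z + z + 2 * of_real euler_mascheroni)
       \<le> (8 * M + 8) * (1 + norm z) * exp (Re z) * exp (3 * exp (Re z / 2))" by (simp add: E_def)
    have "norm (macdonald_ext z) \<le> M * E + norm z * (1 * E)"
      unfolding macdonald_ext_def 
      by (rule order_trans[OF norm_triangle_ineq4 add_mono], rule f(1), unfold norm_mult, rule mult_left_mono[OF b(1)], simp)
    also have "\<dots> = M * 1 * E + 1 * norm z * E" by simp
    also have "\<dots> \<le> (8 * M) * (1 + norm z) * E + 8 * (1 + norm z) * E"
      using M E by (intro add_mono mult_right_mono mult_mono) auto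
    also have "\<dots> = (8 * M + 8) * (1 + norm z) * E" by (simp add: algebra_simps)
    finally show "norm (macdonald_ext z) \<le> (8 * M + 8) * (1 + norm z) * exp (3 * exp (Re z / 2))"
      by (simp add: E_def)
  qed
qed

text \<open>The Euler derivative \<open>w d/dw\<close>, that is, differentiation with respect to \<open>x = ln w\<close>.\<close>

definition euler_series :: "(nat \<Rightarrow> real) \<Rightarrow> real \<Rightarrow> real" where
  "euler_series c w = suminf (\<lambda>k. real k * c k * w ^ k)"

lemma euler_series_eq:
  assumes "order_half_coeff c M"
  shows "summable (\<lambda>k. real k * c k * w ^ k)"
    and "euler_series c w = w * (suminf (\<lambda>k. diffs c k * w ^ k))"
proof -
  have "summable (\<lambda>k. diffs c k * w ^ k)"
    using termdiff_converges_all[of c w] summable_norm_cancel[OF entire_series_bounds(1)[where ?'a = real, OF assms]]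
    by simp
  from sums_mult[OF diffs_equiv[OF this], of w]
  have "(\<lambda>k. w * (real k * c k * w ^ (k - Suc 0))) sums (w * (suminf (\<lambda>k. diffs c k * w ^ k)))" .
  moreover have "w * (real k * c k * w ^ (k - Suc 0)) = real k * c k * w ^ k" for k
    by (cases k) auto
  ultimately have "(\<lambda>k. real k * c k * w ^ k) sums (w * (suminf (\<lambda>k. diffs c k * w ^ k)))" by simp
  then show "summable (\<lambda>k. real k * c k * w ^ k)" "euler_series c w = w * (suminf (\<lambda>k. diffs c k * w ^ k))"
    by (auto simp: sums_iff euler_series_def)
qed

lemma has_derivative_entire_series_exp:
  assumes "order_half_coeff c M"
  shows "((\<lambda>x. entire_series c (exp x)) has_real_derivative euler_series c (exp x)) (at x)"
  using DERIV_chain2[OF entire_series_has_derivative[OF assms, of "exp x"] DERIV_exp]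
  unfolding euler_series_eq(2)[OF assms] by (simp add: mult.commute)

lemma has_derivative_euler_series_exp:
  assumes "order_half_coeff c M"
  shows "((\<lambda>x. euler_series c (exp x)) has_real_derivative
    exp x * (suminf (\<lambda>k. diffs (\<lambda>k. real k * c k) k * exp x ^ k))) (at x)"
proof -
  have "((\<lambda>w. suminf (\<lambda>k. (real k * c k) * w ^ k)) has_real_derivative (suminf (\<lambda>k. diffs (\<lambda>k. real k * c k) k * exp x ^ k))) (at (exp x))"
    by (rule termdiffs_strong_converges_everywhere) (rule euler_series_eq(1)[OF assms])
  from DERIV_chain2[OF this DERIV_exp] show ?thesis
    by (simp add: euler_series_def mult.commute)
qed

text \<open>Coefficient form of \<open>(w d/dw)\<^sup>2 I = w I\<close>.\<close>

lemma diffs_bessel: "diffs (\<lambda>k. real k * bessel_coeff k) = bessel_coeff"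
proof
  fix n
  have "(fact (Suc n) :: real) = (real n + 1) * fact n" by simp
  then have "diffs (\<lambda>k. real k * bessel_coeff k) n = (real n + 1) * ((real n + 1) * (1 / ((real n + 1) * fact n)\<^sup>2))"
    by (simp add: diffs_def bessel_coeff_def del: fact_Suc) (simp add: add.commute)
  also have "\<dots> = bessel_coeff n"
    unfolding bessel_coeff_def by (simp add: power_mult_distrib power2_eq_square)
  finally show "diffs (\<lambda>k. real k * bessel_coeff k) n = bessel_coeff n" .
qed

text \<open>Coefficient form of \<open>(w d/dw)\<^sup>2 P = w P + 2 w dI/dw\<close>; the extra term
  cancels the one produced by differentiating \<open>x I\<close> twice.\<close>

lemma diffs_frobenius:
  "diffs (\<lambda>k. real k * frobenius_coeff k) n = frobenius_coeff n + 2 * diffs bessel_coeff n"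
proof -
  define h where "h = (harm n - euler_mascheroni :: real)"
  define F :: real where "F = fact n"
  define N where "N = real n + 1"
  have nz: "F \<noteq> 0" "N \<noteq> 0" by (auto simp: F_def N_def)
  have f: "(fact (Suc n) :: real) = N * F" by (simp add: F_def N_def)
  have 1: "diffs (\<lambda>k. real k * frobenius_coeff k) n = N * (N * (2 * (h + inverse N) / (N * F)\<^sup>2))"
    unfolding diffs_def frobenius_coeff_def f by (simp add: h_def N_def harm_Suc algebra_simps)
  have 2: "frobenius_coeff n = 2 * h / F\<^sup>2" by (simp add: frobenius_coeff_def F_def h_def)
  have 3: "diffs bessel_coeff n = N * (1 / (N * F)\<^sup>2)"
    unfolding diffs_def bessel_coeff_def f by (simp add: N_def)
  show ?thesis unfolding 1 2 3 using nz by (simp add: field_simps power2_eq_square)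
qed

lemma macdonald_ext_ODE:
  fixes x :: real
  defines "k1 \<equiv> (\<lambda>x::real. euler_series frobenius_coeff (exp x) - entire_series bessel_coeff (exp x)
    - x * euler_series bessel_coeff (exp x))"
  shows "(macdonald_ext has_real_derivative k1 x) (at x)"
    and "(k1 has_real_derivative exp x * macdonald_ext x) (at x)"
    and "((\<lambda>x. euler_series bessel_coeff (exp x)) has_real_derivative exp x * entire_series bessel_coeff (exp x)) (at x)"
proof -
  note I = has_derivative_entire_series_exp[OF order_half_bessel]
  note P = has_derivative_entire_series_exp[OF order_half_frobenius]
  note eI = has_derivative_euler_series_exp[OF order_half_bessel, unfolded diffs_bessel]
  show eI': "((\<lambda>x. euler_series bessel_coeff (exp x)) has_real_derivative exp x * entire_series bessel_coeff (exp x)) (at x)" for x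
    using eI by (simp add: entire_series_def)
  have sb: "summable (\<lambda>n. diffs bessel_coeff n * w ^ n)" "summable (\<lambda>n. frobenius_coeff n * w ^ n)" for w
    using termdiff_converges_all[of bessel_coeff w]
      summable_norm_cancel[OF entire_series_bounds(1)[where ?'a = real, OF order_half_bessel]]
      summable_norm_cancel[OF entire_series_bounds(1)[where ?'a = real, OF order_half_frobenius]]
    by simp_all
  have "(suminf (\<lambda>k. diffs (\<lambda>k. real k * frobenius_coeff k) k * w ^ k))
      = entire_series frobenius_coeff w + 2 * (suminf (\<lambda>k. diffs bessel_coeff k * w ^ k))" for w
    unfolding diffs_frobenius entire_series_def using sb[of w]
    by (simp add: distrib_right suminf_add[symmetric] suminf_mult[symmetric] summable_mult mult.assoc)
  then have "w * (suminf (\<lambda>k. diffs (\<lambda>k. real k * frobenius_coeff k) k * w ^ k))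
      = w * entire_series frobenius_coeff w + 2 * euler_series bessel_coeff w" for w
    by (simp add: euler_series_eq(2)[OF order_half_bessel] distrib_left)
  then have eP: "((\<lambda>x. euler_series frobenius_coeff (exp x)) has_real_derivative
      exp x * entire_series frobenius_coeff (exp x) + 2 * euler_series bessel_coeff (exp x)) (at x)" for x
    using has_derivative_euler_series_exp[OF order_half_frobenius, of x] by simp
  show "(macdonald_ext has_real_derivative k1 x) (at x)"
    unfolding macdonald_ext_def[abs_def] k1_def
    by (rule derivative_eq_intros I P refl)+ simp
  show "(k1 has_real_derivative exp x * macdonald_ext x) (at x)"
    unfolding macdonald_ext_def k1_def
    by (rule derivative_eq_intros I eI' eP refl)+ (simp add: algebra_simps)
qed

lemma entire_series_exp_at_bot:
  assumes "order_half_coeff c M"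
  shows "((\<lambda>x::real. entire_series c (exp x)) \<longlongrightarrow> c 0) at_bot"
    and "((\<lambda>x::real. x * (entire_series c (exp x) - c 0)) \<longlongrightarrow> 0) at_bot"
proof -
  have M: "M \<ge> 0" using assms by (simp add: order_half_coeff_def)
  have bound: "\<bar>entire_series c (exp x) - c 0\<bar> \<le> 8 * M * exp 3 * exp x" if "x \<le> 0" for x :: real
  proof -
    have "\<bar>entire_series c (exp x) - c 0\<bar> \<le> 8 * M * exp x * exp (3 * sqrt (exp x))"
      using entire_series_bounds(3)[OF assms, of "exp x"] by simp
    also have "\<dots> \<le> 8 * M * exp x * exp 3" using that M by (intro mult_left_mono) auto
    finally show ?thesis by (simp add: mult_ac)
  qed
  have ev: "eventually (\<lambda>x::real. x \<le> 0) at_bot" by (rule eventually_le_at_bot)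
  have "((\<lambda>x::real. entire_series c (exp x) - c 0) \<longlongrightarrow> 0) at_bot"
  proof (rule Lim_null_comparison)
    show "((\<lambda>x::real. 8 * M * exp 3 * exp x) \<longlongrightarrow> 0) at_bot"
      by (rule tendsto_mult_right_zero) (rule exp_at_bot)
    show "eventually (\<lambda>x. norm (entire_series c (exp x) - c 0) \<le> 8 * M * exp 3 * exp x) at_bot"
      using ev by eventually_elim (use bound in auto)
  qed
  then show "((\<lambda>x::real. entire_series c (exp x)) \<longlongrightarrow> c 0) at_bot" by (rule LIM_zero_cancel)
  show "((\<lambda>x::real. x * (entire_series c (exp x) - c 0)) \<longlongrightarrow> 0) at_bot"
  proof (rule Lim_null_comparison)
    show "((\<lambda>x::real. 8 * M * exp 3 * (\<bar>x\<bar> * exp x)) \<longlongrightarrow> 0) at_bot"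
      by (rule tendsto_mult_right_zero) real_asymp
    show "eventually (\<lambda>x. norm (x * (entire_series c (exp x) - c 0)) \<le> 8 * M * exp 3 * (\<bar>x\<bar> * exp x)) at_bot"
      using ev
    proof eventually_elim
      case (elim x)
      have "\<bar>x\<bar> * \<bar>entire_series c (exp x) - c 0\<bar> \<le> \<bar>x\<bar> * (8 * M * exp 3 * exp x)"
        by (intro mult_left_mono bound elim) auto
      then show ?case unfolding real_norm_def abs_mult by (simp only: mult_ac)
    qed
  qed
qed

lemma euler_series_exp_at_bot:
  assumes "order_half_coeff c M"
  shows "((\<lambda>x::real. euler_series c (exp x)) \<longlongrightarrow> 0) at_bot"
    and "((\<lambda>x::real. x * euler_series c (exp x)) \<longlongrightarrow> 0) at_bot"
proof -
  define D where "D w = suminf (\<lambda>k. diffs c k * w ^ k)" for w :: real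
  have "summable (\<lambda>k. diffs c k * w ^ k)" for w
    using termdiff_converges_all[of c w] summable_norm_cancel[OF entire_series_bounds(1)[where ?'a = real, OF assms]]
    by simp
  then have "isCont D 0" unfolding D_def by (rule isCont_powser_converges_everywhere)
  then have D: "((\<lambda>x. D (exp x)) \<longlongrightarrow> D 0) at_bot"
    using isCont_tendsto_compose exp_at_bot by blast
  have e: "((\<lambda>x::real. x * exp x) \<longlongrightarrow> 0) at_bot" by real_asymp
  have "((\<lambda>x. exp x * D (exp x)) \<longlongrightarrow> 0 * D 0) at_bot"
    by (rule tendsto_mult[OF exp_at_bot D])
  then show "((\<lambda>x::real. euler_series c (exp x)) \<longlongrightarrow> 0) at_bot"
    by (simp add: euler_series_eq(2)[OF assms] D_def)
  have "((\<lambda>x. x * exp x * D (exp x)) \<longlongrightarrow> 0 * D 0) at_bot"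
    by (rule tendsto_mult[OF e D])
  then show "((\<lambda>x::real. x * euler_series c (exp x)) \<longlongrightarrow> 0) at_bot"
    by (simp add: euler_series_eq(2)[OF assms] D_def mult.assoc)
qed

text \<open>
  The difference \<open>D\<close> of the two sides and \<open>V = I (exp x)\<close> solve the same linear equation of order two,
  so their Wronskian is constant; by the behaviour at \<open>-\<infinity>\<close> it vanishes, and so does the limit of \<open>D / V\<close>.
\<close>

theorem macdonald_eq_ext: "macdonald x = macdonald_ext x"
proof -
  define V where "V x = entire_series bessel_coeff (exp x)" for x :: real
  define V1 where "V1 x = euler_series bessel_coeff (exp x)" for x :: real
  define k1 where "k1 x = euler_series frobenius_coeff (exp x) - V x - x * V1 x" for x :: real
  define D where "D x = macdonald x - macdonald_ext x" for x :: real
  define D1 where "D1 x = - macdonald_slope x - k1 x" for x :: real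
  have c0: "frobenius_coeff 0 = - 2 * euler_mascheroni" "bessel_coeff 0 = 1"
    by (simp_all add: frobenius_coeff_def bessel_coeff_def harm_def)
  have V': "(V has_real_derivative V1 x) (at x)" for x
    unfolding V_def[abs_def] V1_def by (rule has_derivative_entire_series_exp[OF order_half_bessel])
  have V1': "(V1 has_real_derivative exp x * V x) (at x)" for x
    unfolding V_def V1_def[abs_def] by (rule macdonald_ext_ODE(3))
  have D': "(D has_real_derivative D1 x) (at x)" for x
    unfolding D_def[abs_def] D1_def k1_def V_def V1_def
    by (rule DERIV_diff[OF has_real_derivative_macdonald macdonald_ext_ODE(1)])
  have D1': "(D1 has_real_derivative exp x * D x) (at x)" for x
    using DERIV_diff[OF DERIV_minus[OF has_real_derivative_macdonald_slope] macdonald_ext_ODE(2), of x]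
    unfolding D_def D1_def[abs_def] k1_def V_def V1_def by (simp add: right_diff_distrib)
  have Vpos: "V x \<noteq> 0" for x
  proof -
    have s: "summable (\<lambda>k. bessel_coeff k * exp x ^ k)"
      using summable_norm_cancel[OF entire_series_bounds(1)[where ?'a = real, OF order_half_bessel]] by simp
    have "(\<Sum>k\<in>{0}. bessel_coeff k * exp x ^ k) \<le> suminf (\<lambda>k. bessel_coeff k * exp x ^ k)"
      by (rule sum_le_suminf[OF s]) (auto simp: bessel_coeff_def)
    then show ?thesis by (simp add: V_def entire_series_def bessel_coeff_def)
  qed
  note eb = entire_series_exp_at_bot[OF order_half_bessel, folded V_def, unfolded c0]
    and ub = euler_series_exp_at_bot[OF order_half_bessel, folded V1_def]
    and ep = entire_series_exp_at_bot[OF order_half_frobenius, unfolded c0]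
    and up = euler_series_exp_at_bot[OF order_half_frobenius]
  \<comment> \<open>The linear terms and the constants \<open>- 2 * euler_mascheroni\<close> cancel;
    this is where the normalisation of \<open>frobenius_coeff\<close> enters.\<close>
  have Dlim: "(D \<longlongrightarrow> 0) at_bot"
  proof -
    have "((\<lambda>x. (macdonald x + x) - (entire_series frobenius_coeff (exp x) - x * (V x - 1)))
       \<longlongrightarrow> - 2 * euler_mascheroni - (- 2 * euler_mascheroni - 0)) at_bot"
      by (intro tendsto_diff macdonald_plus_at_bot ep eb)
    then show ?thesis
      by (simp add: D_def[abs_def] macdonald_ext_def V_def algebra_simps)
  qed
  have D1lim: "(D1 \<longlongrightarrow> 0) at_bot"
  proof -
    have "((\<lambda>x. - macdonald_slope x - (euler_series frobenius_coeff (exp x) - V x - x * V1 x))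
        \<longlongrightarrow> - 1 - (0 - 1 - 0)) at_bot"
      by (intro tendsto_diff tendsto_minus macdonald_slope_at_bot up ub eb)
    then show ?thesis by (simp add: D1_def[abs_def] k1_def)
  qed
  define W where "W x = D1 x * V x - D x * V1 x" for x
  have "(W has_real_derivative 0) (at x)" for x
    unfolding W_def[abs_def] using DERIV_diff[OF DERIV_mult[OF D1' V'] DERIV_mult[OF D' V1'], of x]
    by (simp add: algebra_simps)
  then have Wc: "W x = W y" for x y using DERIV_isconst_all by blast
  have "(W \<longlongrightarrow> 0 * 1 - 0 * 0) at_bot" unfolding W_def[abs_def]
    by (intro tendsto_diff tendsto_mult D1lim Dlim ub eb)
  moreover have "(W \<longlongrightarrow> W x) at_bot" for x
    using tendsto_const[of "W x" at_bot] by (rule tendsto_cong[THEN iffD1, rotated]) (use Wc in auto)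
  ultimately have W0: "W x = 0" for x
    using tendsto_unique[OF trivial_limit_at_bot_linorder] by fastforce
  define Q where "Q x = D x / V x" for x
  have "(Q has_real_derivative 0) (at x)" for x
  proof -
    have "(Q has_real_derivative (D1 x * V x - D x * V1 x) / (V x * V x)) (at x)"
      unfolding Q_def[abs_def] by (rule DERIV_divide[OF D' V' Vpos])
    then show ?thesis using W0[of x] by (simp add: W_def)
  qed
  then have Qc: "Q x = Q y" for x y using DERIV_isconst_all by blast
  have "(Q \<longlongrightarrow> 0 / 1) at_bot" unfolding Q_def[abs_def]
    by (intro tendsto_divide Dlim eb) auto
  moreover have "(Q \<longlongrightarrow> Q x) at_bot"
    using tendsto_const[of "Q x" at_bot] by (rule tendsto_cong[THEN iffD1, rotated]) (use Qc in auto)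
  ultimately have "Q x = 0"
    using tendsto_unique[OF trivial_limit_at_bot_linorder] by fastforce
  then show ?thesis using Vpos[of x] by (simp add: Q_def D_def)
qed

lemma macdonald_ext_eq: "macdonald_ext (of_real x) = (of_real (macdonald x) :: complex)"
  by (simp add: macdonald_ext_of_real macdonald_eq_ext)

section \<open>The measure \<open>dy\<^sub>1 \<cdots> dy\<^sub>l / (y\<^sub>1 \<cdots> y\<^sub>l)\<close>\<close>

text \<open>
  Restricting the space to positive \<open>y\<close> makes the positivity of \<open>\<phi>\<close> hold everywhere rather than
  almost everywhere.
\<close>

definition banana_measure :: "nat \<Rightarrow> (nat \<Rightarrow> real) measure" where
  "banana_measure l = density
     (restrict_space (\<Pi>\<^sub>M i\<in>{1..l}. lborel) (\<Pi>\<^sub>E i\<in>{1..l}. {0<..}))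
     (\<lambda>y. ennreal (1 / (\<Prod>i=1..l. y i)))"

lemma positive_orthant_measurable [measurable]:
  "(\<Pi>\<^sub>E i\<in>{1..l::nat}. {0::real<..}) \<in> sets (\<Pi>\<^sub>M i\<in>{1..l}. lborel)"
  by (rule sets_PiM_I_finite) auto

lemma prod_coordinates_measurable [measurable]:
  "(\<lambda>y. \<Prod>i=1..l. y i) \<in> borel_measurable (\<Pi>\<^sub>M i\<in>{1..l}. (lborel :: real measure))"
  by (intro borel_measurable_prod) measurable

lemma banana_phi_measurable_PiM [measurable]:
  "banana_phi l q \<in> borel_measurable (\<Pi>\<^sub>M i\<in>{1..l}. lborel)"
  unfolding banana_phi_def[abs_def] inverse_eq_divide
  by (intro borel_measurable_times borel_measurable_add borel_measurable_sum borel_measurable_const borel_measurable_divide) measurable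

lemma space_banana_measure: "space (banana_measure l) = (\<Pi>\<^sub>E i\<in>{1..l}. {0<..})"
  by (auto simp: banana_measure_def space_restrict_space space_PiM)

lemma banana_measure_pos: "y \<in> space (banana_measure l) \<Longrightarrow> i \<in> {1..l} \<Longrightarrow> y i > 0"
  by (auto simp: space_banana_measure)

lemma measurable_banana_measure:
  "f \<in> measurable (\<Pi>\<^sub>M i\<in>{1..l}. lborel) M \<Longrightarrow> f \<in> measurable (banana_measure l) M"
  unfolding banana_measure_def by (simp add: measurable_restrict_space1)

lemma banana_phi_measurable [measurable]: "banana_phi l q \<in> borel_measurable (banana_measure l)"
  by (rule measurable_banana_measure) measurable

lemma density_measurable_restrict:
  "(\<lambda>y. ennreal (1 / (\<Prod>i=1..l. y i))) \<in> borel_measurable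
     (restrict_space (\<Pi>\<^sub>M i\<in>{1..l}. lborel) (\<Pi>\<^sub>E i\<in>{1..l}. {0<..}))"
  by (rule measurable_restrict_space1) measurable

lemma sigma_finite_banana_measure: "sigma_finite_measure (banana_measure l)"
proof -
  interpret product_sigma_finite "\<lambda>_::nat. lborel :: real measure" ..
  interpret sigma_finite_measure "\<Pi>\<^sub>M i\<in>{1..l}. (lborel :: real measure)"
    by (rule sigma_finite) simp
  have "sigma_finite_measure (restrict_space (\<Pi>\<^sub>M i\<in>{1..l}. lborel) (\<Pi>\<^sub>E i\<in>{1..l}. {0::real<..}))"
    by (rule sigma_finite_measure_restrict_space[OF sigma_finite_measure_axioms]) measurable
  then show ?thesis unfolding banana_measure_def
    by (subst sigma_finite_measure.sigma_finite_iff_density_finite[OF _ density_measurable_restrict]) auto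
qed

text \<open>The density and the restriction to the orthant are distributed over the coordinates, so
  that product integrands split into one-dimensional integrals.\<close>

lemma nn_integral_banana_measure:
  assumes [measurable]: "f \<in> borel_measurable (\<Pi>\<^sub>M i\<in>{1..l}. lborel)"
  shows "(\<integral>\<^sup>+ y. f y \<partial>banana_measure l)
    = (\<integral>\<^sup>+ y. (\<Prod>i=1..l. indicator {0<..} (y i) * ennreal (1 / y i)) * f y \<partial>(\<Pi>\<^sub>M i\<in>{1..l}. lborel))"
proof -
  have "(\<integral>\<^sup>+ y. f y \<partial>banana_measure l) =
     (\<integral>\<^sup>+ y. ennreal (1 / (\<Prod>i=1..l. y i)) * f y * indicator (\<Pi>\<^sub>E i\<in>{1..l}. {0<..}) y \<partial>(\<Pi>\<^sub>M i\<in>{1..l}. lborel))"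
    unfolding banana_measure_def
    by (subst nn_integral_density[OF density_measurable_restrict measurable_restrict_space1[OF assms]],
        subst nn_integral_restrict_space) (use positive_orthant_measurable[of l] in \<open>auto intro!: sets.Int\<close>)
  also have "\<dots> = (\<integral>\<^sup>+ y. (\<Prod>i=1..l. indicator {0<..} (y i) * ennreal (1 / y i)) * f y \<partial>(\<Pi>\<^sub>M i\<in>{1..l}. lborel))"
  proof (rule nn_integral_cong)
    fix y :: "nat \<Rightarrow> real" assume "y \<in> space (\<Pi>\<^sub>M i\<in>{1..l}. lborel)"
    \<comment> \<open>Points of the product space are undefined outside \<open>{1..l}\<close>, so
      membership in the orthant is just positivity of the coordinates.\<close>
    then have ext: "y \<in> extensional {1..l}" by (auto simp: space_PiM PiE_def)
    show "ennreal (1 / (\<Prod>i=1..l. y i)) * f y * indicator (\<Pi>\<^sub>E i\<in>{1..l}. {0<..}) y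
        = (\<Prod>i=1..l. indicator {0<..} (y i) * ennreal (1 / y i)) * f y"
    proof (cases "\<forall>i\<in>{1..l}. y i > 0")
      case True
      then have "(\<Prod>i=1..l. indicator {0<..} (y i) * ennreal (1 / y i)) = (\<Prod>i=1..l. ennreal (1 / y i))"
        by (intro prod.cong) auto
      also have "\<dots> = ennreal (\<Prod>i=1..l. 1 / y i)"
        using True by (intro prod_ennreal) (auto intro: less_imp_le)
      also have "(\<Prod>i=1..l. 1 / y i) = 1 / (\<Prod>i=1..l. y i)" by (simp add: prod_dividef)
      finally show ?thesis using True ext by (auto simp: PiE_def)
    next
      case False
      then obtain i where i: "i \<in> {1..l}" "\<not> y i > 0" by blast
      then have "(\<Prod>i=1..l. indicator {0<..} (y i) * ennreal (1 / y i)) = 0"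
        by (intro prod_zero) (auto intro!: bexI[of _ i])
      moreover have "y \<notin> (\<Pi>\<^sub>E i\<in>{1..l}. {0<..})" using i by auto
      ultimately show ?thesis by simp
    qed
  qed
  finally show ?thesis .
qed

lemma banana_integral_eq:
  "banana_integral l q t = (LINT y|banana_measure l. 1 / (t - banana_phi l q y))"
proof -
  have "(LINT y|banana_measure l. 1 / (t - banana_phi l q y))
      = (LINT y|restrict_space (\<Pi>\<^sub>M i\<in>{1..l}. lborel) (\<Pi>\<^sub>E i\<in>{1..l}. {0<..}).
          (1 / (\<Prod>i=1..l. y i)) *\<^sub>R (1 / (t - banana_phi l q y)))"
    unfolding banana_measure_def
  proof (rule integral_density)
    show "(\<lambda>y. 1 / (t - banana_phi l q y)) \<in> borel_measurable (restrict_space (\<Pi>\<^sub>M i\<in>{1..l}. lborel) (\<Pi>\<^sub>E i\<in>{1..l}. {0<..}))"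
      by (rule measurable_restrict_space1) measurable
    show "(\<lambda>y. 1 / (\<Prod>i=1..l. y i) :: real) \<in> borel_measurable (restrict_space (\<Pi>\<^sub>M i\<in>{1..l}. lborel) (\<Pi>\<^sub>E i\<in>{1..l}. {0<..}))"
      by (rule measurable_restrict_space1, intro borel_measurable_divide borel_measurable_const prod_coordinates_measurable)
    show "AE y in restrict_space (\<Pi>\<^sub>M i\<in>{1..l}. lborel) (\<Pi>\<^sub>E i\<in>{1..l}. {0<..}). 0 \<le> 1 / (\<Prod>i=1..l. y i :: real)"
    proof (rule AE_I2)
      fix y assume "y \<in> space (restrict_space (\<Pi>\<^sub>M i\<in>{1..l}. lborel) (\<Pi>\<^sub>E i\<in>{1..l}. {0::real<..}))"
      then have "y i \<ge> 0" if "i \<in> {1..l}" for i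
        using that by (auto simp: space_restrict_space dest: PiE_mem[of _ _ _ i])
      then show "0 \<le> 1 / (\<Prod>i=1..l. y i)" by (intro divide_nonneg_nonneg prod_nonneg) auto
    qed
  qed
  also have "\<dots> = banana_integral l q t"
    unfolding banana_integral_def set_lebesgue_integral_def
    by (subst integral_restrict_space) (auto intro!: Bochner_Integration.integral_cong simp: mult_ac)
  finally show ?thesis ..
qed

locale banana =
  fixes l :: nat and q :: "nat \<Rightarrow> real"
  assumes q_pos: "i \<in> {1..l + 1} \<Longrightarrow> q i > 0"
begin

abbreviation "\<mu> \<equiv> banana_measure l"

definition lphi :: "(nat \<Rightarrow> real) \<Rightarrow> real" where "lphi y = ln (banana_phi l q y)"

definition FA :: "(nat \<Rightarrow> real) \<Rightarrow> real" where "FA y = (\<Sum>i=1..l. q i * y i) + q (l + 1)"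
definition FB :: "(nat \<Rightarrow> real) \<Rightarrow> real" where "FB y = (\<Sum>i=1..l. inverse (y i)) + 1"

lemma FA_pos: "y \<in> space \<mu> \<Longrightarrow> FA y > 0"
  using banana_measure_pos[of y l] q_pos
  unfolding FA_def by (intro add_nonneg_pos sum_nonneg mult_nonneg_nonneg) (auto intro!: less_imp_le)

lemma FB_pos: "y \<in> space \<mu> \<Longrightarrow> FB y > 0"
  using banana_measure_pos[of y l]
  unfolding FB_def by (intro add_nonneg_pos sum_nonneg) (auto intro!: less_imp_le)

lemma phi_eq: "banana_phi l q y = FA y * FB y"
  by (simp add: banana_phi_def FA_def FB_def)

lemma phi_pos: "y \<in> space \<mu> \<Longrightarrow> banana_phi l q y > 0"
  by (simp add: phi_eq FA_pos FB_pos)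

lemma exp_lphi: "y \<in> space \<mu> \<Longrightarrow> exp (lphi y) = banana_phi l q y"
  using phi_pos by (simp add: lphi_def)

lemma lphi_measurable [measurable]: "lphi \<in> borel_measurable \<mu>"
  unfolding lphi_def[abs_def] by measurable

lemma FA_measurable' [measurable]: "FA \<in> borel_measurable (\<Pi>\<^sub>M i\<in>{1..l}. lborel)"
  unfolding FA_def[abs_def]
  by (intro borel_measurable_times borel_measurable_add borel_measurable_sum borel_measurable_const) measurable

lemma FB_measurable' [measurable]: "FB \<in> borel_measurable (\<Pi>\<^sub>M i\<in>{1..l}. lborel)"
  unfolding FB_def[abs_def] inverse_eq_divide
  by (intro borel_measurable_times borel_measurable_add borel_measurable_sum borel_measurable_const borel_measurable_divide) measurable

lemma FA_measurable [measurable]: "FA \<in> borel_measurable \<mu>"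
  and FB_measurable [measurable]: "FB \<in> borel_measurable \<mu>"
  by (rule measurable_banana_measure, measurable)+

text \<open>
  Sending \<open>v\<close> to \<open>(v - ln y\<^sub>1, \<dots>, v - ln y\<^sub>l, v)\<close> turns the product of the integrals for
  \<open>macdonald (x + ln (q i))\<close> into an integral over \<open>v\<close> and \<open>y\<close>, whose integral over \<open>v\<close>
  is again a Macdonald function.
\<close>

lemma nn_integral_macdonald_phi:
  "(\<integral>\<^sup>+ y. ennreal (macdonald (x + lphi y)) \<partial>\<mu>) = ennreal (\<Prod>i=1..l + 1. macdonald (x + ln (q i)))"
proof -
  let ?H = "\<lambda>v. ennreal (exp (- (1 * exp v) - q (l + 1) * exp (x - v)))"
  let ?P = "ennreal (\<Prod>i=1..l. macdonald (x + ln (q i)))"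
  let ?E = "\<lambda>v y. ennreal (exp (- (FB y * exp v) - FA y * exp (x - v)))"
  interpret N: sigma_finite_measure \<mu> by (rule sigma_finite_banana_measure)
  interpret pair_sigma_finite lborel \<mu> ..
  interpret product_sigma_finite "\<lambda>_::nat. lborel :: real measure" ..
  \<comment> \<open>The integrand of one coordinate, with its share of the measure
    \<open>dy / y\<close> included.\<close>
  define f where "f v i r = indicator {0<..} r * (ennreal (1 / r) * ennreal (exp (- (exp v * inverse r) - q i * r * exp (x - v))))"
    for v r :: real and i
  have [measurable]: "f v i \<in> borel_measurable borel" for v i
    unfolding f_def by measurable
  have f_int: "(\<integral>\<^sup>+ r. f v i r \<partial>lborel) = ennreal (macdonald (x + ln (q i)))" if "i \<in> {1..l}" for v i
  proof -
    have qi: "q i > 0" using q_pos that by auto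
    have "(\<integral>\<^sup>+ r. f v i r \<partial>lborel)
       = (\<integral>\<^sup>+ u. ennreal (exp u) * (ennreal (1 / exp u) * ennreal (exp (- (exp v * inverse (exp u)) - q i * exp u * exp (x - v)))) \<partial>lborel)"
      unfolding f_def by (rule nn_integral_exp_substitution) measurable
    \<comment> \<open>After \<open>r = exp u\<close> the measure \<open>dr / r\<close> is
      \<open>du\<close>. The shape \<open>v + (- 1) * u\<close> prepares the reflection that sends
      \<open>u\<close> to \<open>w = v - u\<close>.\<close>
    also have "\<dots> = (\<integral>\<^sup>+ u. ennreal (exp (- (1 * exp (v + (- 1) * u)) - q i * exp (x - (v + (- 1) * u)))) \<partial>lborel)"
    proof (rule nn_integral_cong)
      fix u :: real
      have "ennreal (exp u) * (ennreal (1 / exp u) * X) = X" for X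
        by (simp add: mult.assoc[symmetric] flip: ennreal_mult')
      moreover have "exp (- (exp v * inverse (exp u)) - q i * exp u * exp (x - v))
          = exp (- (1 * exp (v + (- 1) * u)) - q i * exp (x - (v + (- 1) * u)))"
        by (simp add: exp_diff exp_add exp_minus field_simps)
      ultimately show "ennreal (exp u) * (ennreal (1 / exp u) * ennreal (exp (- (exp v * inverse (exp u)) - q i * exp u * exp (x - v))))
          = ennreal (exp (- (1 * exp (v + (- 1) * u)) - q i * exp (x - (v + (- 1) * u))))"
        by (simp only:)
    qed
    also have "\<dots> = (\<integral>\<^sup>+ w. ennreal (exp (- (1 * exp w) - q i * exp (x - w))) \<partial>lborel)"
      by (subst (2) nn_integral_real_affine[where c = "-1" and t = v]) auto
    also have "\<dots> = ennreal (macdonald (x + ln (q i)))"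
      by (subst nn_integral_macdonald_scaled) (use qi in auto)
    finally show ?thesis .
  qed
  \<comment> \<open>The two sums in \<open>\<phi>\<close> become a product over the coordinates; the
    constant terms of the sums contribute the factor of index \<open>l + 1\<close>, with
    \<open>v\<close> itself as variable.\<close>
  have factor: "exp (- (FB y * exp v) - FA y * exp (x - v))
     = exp (- (1 * exp v) - q (l + 1) * exp (x - v)) * (\<Prod>i=1..l. exp (- (exp v * inverse (y i)) - q i * y i * exp (x - v)))" for y v
  proof -
    have "- (FB y * exp v) - FA y * exp (x - v) = (- (1 * exp v) - q (l + 1) * exp (x - v))
       + (\<Sum>i=1..l. - (exp v * inverse (y i)) - q i * y i * exp (x - v))"
      by (simp add: FA_def FB_def sum_subtractf sum_negf sum_distrib_left sum_distrib_right algebra_simps)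
    then show ?thesis by (simp add: exp_add exp_sum)
  qed
  have "(\<integral>\<^sup>+ y. ennreal (macdonald (x + lphi y)) \<partial>\<mu>)
      = (\<integral>\<^sup>+ y. \<integral>\<^sup>+ v. ?E v y \<partial>lborel \<partial>\<mu>)"
  proof (rule nn_integral_cong)
    fix y assume y: "y \<in> space \<mu>"
    show "ennreal (macdonald (x + lphi y)) = (\<integral>\<^sup>+ v. ?E v y \<partial>lborel)"
      using FA_pos[OF y] FB_pos[OF y]
      by (subst nn_integral_macdonald_scaled) (auto simp: lphi_def phi_eq ln_mult add.assoc)
  qed
  also have "\<dots> = (\<integral>\<^sup>+ v. \<integral>\<^sup>+ y. ?E v y \<partial>\<mu> \<partial>lborel)"
    by (rule Fubini') measurable
  also have "\<dots> = (\<integral>\<^sup>+ v. ?H v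
      * ?P \<partial>lborel)"
  proof (rule nn_integral_cong)
    fix v :: real
    have "(\<integral>\<^sup>+ y. ?E v y \<partial>\<mu>)
      = (\<integral>\<^sup>+ y. (\<Prod>i=1..l. indicator {0<..} (y i) * ennreal (1 / y i)) *
           ?E v y \<partial>(\<Pi>\<^sub>M i\<in>{1..l}. lborel))"
      by (rule nn_integral_banana_measure) measurable
    also have "\<dots> = (\<integral>\<^sup>+ y. ?H v * (\<Prod>i=1..l. f v i (y i)) \<partial>(\<Pi>\<^sub>M i\<in>{1..l}. lborel))"
    proof (rule nn_integral_cong)
      fix y :: "nat \<Rightarrow> real"
      have "?E v y
          = ?H v
            * (\<Prod>i=1..l. ennreal (exp (- (exp v * inverse (y i)) - q i * y i * exp (x - v))))"
        unfolding factor by (simp only: ennreal_mult' exp_ge_zero prod_ennreal)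
      then show "(\<Prod>i=1..l. indicator {0<..} (y i) * ennreal (1 / y i)) *
           ?E v y
         = ?H v * (\<Prod>i=1..l. f v i (y i))"
        by (simp only: f_def prod.distrib mult_ac)
    qed
    also have "\<dots> = ?H v * (\<integral>\<^sup>+ y. (\<Prod>i=1..l. f v i (y i)) \<partial>(\<Pi>\<^sub>M i\<in>{1..l}. lborel))"
      by (rule nn_integral_cmult) (intro borel_measurable_prod_ennreal, measurable)
    also have "(\<integral>\<^sup>+ y. (\<Prod>i=1..l. f v i (y i)) \<partial>(\<Pi>\<^sub>M i\<in>{1..l}. lborel)) = (\<Prod>i=1..l. \<integral>\<^sup>+ r. f v i r \<partial>lborel)"
      by (rule product_nn_integral_prod) auto
    also have "\<dots> = (\<Prod>i=1..l. ennreal (macdonald (x + ln (q i))))"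
      by (intro prod.cong f_int) auto
    also have "\<dots> = ?P"
      by (rule prod_ennreal) simp
    finally show "(\<integral>\<^sup>+ y. ?E v y \<partial>\<mu>)
      = ?H v * ?P" .
  qed
  also have "\<dots> = ennreal (macdonald (x + ln (q (l + 1)))) * ?P"
    using q_pos[of "l + 1"] by (subst nn_integral_multc) (simp_all add: nn_integral_macdonald_scaled[of _ 1, simplified])
  also have "\<dots> = ennreal (\<Prod>i=1..l + 1. macdonald (x + ln (q i)))"
    by (simp add: ennreal_mult'[symmetric] mult.commute)
  finally show ?thesis .
qed

end

context banana begin

definition T :: real where "T = banana_threshold l q"

lemma T_pos: "T > 0"
proof -
  have "(\<Sum>i=1..l + 1. sqrt (q i)) > 0"
    using q_pos by (intro sum_pos) auto
  then show ?thesis by (simp add: T_def banana_threshold_def)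
qed

text \<open>Cauchy-Schwarz for the vectors \<open>sqrt (q i * y i)\<close> and
  \<open>sqrt (inverse (y i))\<close>, with a last coordinate \<open>y (l + 1) = 1\<close>
  added.\<close>

lemma phi_ge_T:
  assumes y: "y \<in> space \<mu>"
  shows "banana_phi l q y \<ge> T"
proof -
  define y' where "y' i = (if i = l + 1 then 1 else y i)" for i
  have y': "y' i > 0" if "i \<in> {1..l + 1}" for i
    using banana_measure_pos[OF y, of i] that by (auto simp: y'_def)
  have "(\<Sum>i=1..l + 1. sqrt (q i)) = (\<Sum>i=1..l + 1. sqrt (q i * y' i) * sqrt (inverse (y' i)))"
  proof (rule sum.cong)
    fix i assume i: "i \<in> {1..l + 1}"
    have "sqrt (q i * y' i) * sqrt (inverse (y' i)) = sqrt (q i * y' i * inverse (y' i))"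
      by (rule real_sqrt_mult[symmetric])
    then show "sqrt (q i) = sqrt (q i * y' i) * sqrt (inverse (y' i))" using y'[OF i] by simp
  qed simp
  then have "T \<le> (\<Sum>i=1..l + 1. (sqrt (q i * y' i))\<^sup>2) * (\<Sum>i=1..l + 1. (sqrt (inverse (y' i)))\<^sup>2)"
    unfolding T_def banana_threshold_def using Cauchy_Schwarz_ineq_sum by metis
  also have "(\<Sum>i=1..l + 1. (sqrt (q i * y' i))\<^sup>2) = (\<Sum>i=1..l + 1. q i * y' i)"
    using y' q_pos by (intro sum.cong) (auto intro!: real_sqrt_pow2 mult_nonneg_nonneg less_imp_le)
  also have "\<dots> = FA y" by (simp add: FA_def y'_def)
  also have "(\<Sum>i=1..l + 1. (sqrt (inverse (y' i)))\<^sup>2) = (\<Sum>i=1..l + 1. inverse (y' i))"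
    using y' by (intro sum.cong) (auto intro!: real_sqrt_pow2 less_imp_le)
  also have "\<dots> = FB y" by (simp add: FB_def y'_def)
  finally show ?thesis by (simp add: phi_eq)
qed

lemma lphi_ge: "y \<in> space \<mu> \<Longrightarrow> lphi y \<ge> ln T"
  using phi_ge_T[of y] T_pos phi_pos[of y] by (simp add: lphi_def)

text \<open>At \<open>+\<infinity>\<close> one Macdonald factor already gives the decay. The other
  \<open>l\<close> are replaced by exponentials of a rate \<open>r\<close> so small that together
  they use less than \<open>s\<close>.\<close>

lemma integrable_macdonald_prod:
  assumes "s > 0"
  shows "(\<integral>\<^sup>+ x. ennreal (exp (s * x) * (\<Prod>i=1..l + 1. macdonald (x + ln (q i)))) \<partial>lborel) < \<infinity>"
proof -
  define r where "r = min 1 (s / (2 * (real l + 1)))"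
  have r: "0 < r" "r \<le> 1" using assms by (auto simp: r_def)
  have "real l * r \<le> real l * (s / (2 * (real l + 1)))" by (intro mult_left_mono) (auto simp: r_def)
  also have "\<dots> < s" using assms by (simp add: field_simps) (smt (verit) mult_nonneg_nonneg of_nat_0_le_iff)
  finally have rs: "s - real l * r > 0" by simp
  define K where "K = (\<Prod>i=1..l. Gamma r * exp (- r * ln (q i)))"
  have le: "exp (s * x) * (\<Prod>i=1..l + 1. macdonald (x + ln (q i)))
      \<le> K * (exp ((s - real l * r) * x) * macdonald (x - (- ln (q (l + 1)))))" for x
  proof -
    have "(\<Prod>i=1..l. macdonald (x + ln (q i))) \<le> (\<Prod>i=1..l. Gamma r * exp (- r * (x + ln (q i))))"
      by (intro prod_mono conjI macdonald_le r macdonald_nonneg)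
    also have "\<dots> = (\<Prod>i=1..l. Gamma r * exp (- r * ln (q i)) * exp (- r * x))"
      by (intro prod.cong) (simp_all add: algebra_simps flip: exp_add)
    also have "\<dots> = K * exp (- r * x) ^ l" by (simp add: K_def prod.distrib)
    also have "exp (- r * x) ^ l = exp (- (real l * r) * x)" by (simp flip: exp_of_nat_mult)
    finally have "(\<Prod>i=1..l. macdonald (x + ln (q i))) \<le> K * exp (- (real l * r) * x)" .
    then have "exp (s * x) * ((\<Prod>i=1..l. macdonald (x + ln (q i))) * macdonald (x + ln (q (l + 1))))
      \<le> exp (s * x) * (K * exp (- (real l * r) * x) * macdonald (x + ln (q (l + 1))))"
      by (intro mult_left_mono mult_right_mono) auto
    also have "\<dots> = K * (exp ((s - real l * r) * x) * macdonald (x + ln (q (l + 1))))"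
    proof -
      have "exp ((s - real l * r) * x) = exp (s * x) * exp (- (real l * r) * x)"
        by (simp add: algebra_simps flip: exp_add)
      then show ?thesis by simp
    qed
    finally show ?thesis by simp
  qed
  have "integrable lborel (\<lambda>x. K * (exp ((s - real l * r) * x) * macdonald (x - (- ln (q (l + 1))))))"
    using integrable_power_macdonald[OF rs, of 0 "- ln (q (l + 1))"] by (intro integrable_mult_right) simp
  then have fin: "(\<integral>\<^sup>+ x. ennreal (K * (exp ((s - real l * r) * x) * macdonald (x - (- ln (q (l + 1)))))) \<partial>lborel) < \<infinity>"
    by (subst nn_integral_eq_integral) (use Gamma_real_pos[OF r(1)] in \<open>auto simp: K_def intro!: prod_nonneg mult_nonneg_nonneg\<close>)
  show ?thesis
    by (rule le_less_trans[OF nn_integral_mono fin]) (intro ennreal_leI le)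
qed

lemma nn_integral_macdonald_shift:
  assumes "s > 0"
  shows "(\<integral>\<^sup>+ x. ennreal (exp (s * x) * macdonald (x + a)) \<partial>lborel) = ennreal ((Gamma s)\<^sup>2 * exp (- s * a))"
proof -
  have "(\<integral>\<^sup>+ x. ennreal (exp (s * x) * macdonald (x + a)) \<partial>lborel)
     = (\<integral>\<^sup>+ x. ennreal (exp (s * (- a + 1 * x)) * macdonald ((- a + 1 * x) + a)) \<partial>lborel)"
    by (subst nn_integral_real_affine[where c = 1 and t = "- a"]) auto
  also have "\<dots> = (\<integral>\<^sup>+ x. ennreal (exp (- s * a)) * ennreal (exp (s * x) * macdonald x) \<partial>lborel)"
  proof (rule nn_integral_cong)
    fix x
    have "exp (s * (- a + 1 * x)) = exp (- s * a) * exp (s * x)" by (simp add: algebra_simps flip: exp_add)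
    then show "ennreal (exp (s * (- a + 1 * x)) * macdonald ((- a + 1 * x) + a))
        = ennreal (exp (- s * a)) * ennreal (exp (s * x) * macdonald x)"
      by (simp add: mult.assoc flip: ennreal_mult')
  qed
  also have "\<dots> = ennreal (exp (- s * a)) * ennreal ((Gamma s)\<^sup>2)"
    by (subst nn_integral_cmult) (simp_all add: nn_integral_macdonald_Mellin[OF assms])
  finally show ?thesis by (simp add: mult.commute flip: ennreal_mult')
qed

text \<open>Times \<open>(Gamma s)\<^sup>2\<close>, the integral of \<open>\<phi>\<close> to the
  power \<open>- s\<close> is by Tonelli the Mellin transform of the product of Macdonald functions,
  which is finite.\<close>

lemma integrable_phi_power:
  assumes "s > 0"
  shows "integrable \<mu> (\<lambda>y. exp (- s * lphi y))"
proof -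
  interpret N: sigma_finite_measure \<mu> by (rule sigma_finite_banana_measure)
  interpret pair_sigma_finite lborel \<mu> ..
  have "(\<integral>\<^sup>+ x. ennreal (exp (s * x) * (\<Prod>i=1..l + 1. macdonald (x + ln (q i)))) \<partial>lborel)
     = (\<integral>\<^sup>+ x. \<integral>\<^sup>+ y. ennreal (exp (s * x) * macdonald (x + lphi y)) \<partial>\<mu> \<partial>lborel)"
    by (intro nn_integral_cong) (simp only: ennreal_mult' exp_ge_zero nn_integral_macdonald_phi[symmetric],
      rule nn_integral_cmult[symmetric], measurable)
  also have "\<dots> = (\<integral>\<^sup>+ y. \<integral>\<^sup>+ x. ennreal (exp (s * x) * macdonald (x + lphi y)) \<partial>lborel \<partial>\<mu>)"
    by (rule Fubini'[symmetric]) measurable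
  also have "\<dots> = (\<integral>\<^sup>+ y. ennreal ((Gamma s)\<^sup>2) * ennreal (exp (- s * lphi y)) \<partial>\<mu>)"
    by (intro nn_integral_cong) (simp add: nn_integral_macdonald_shift[OF assms] flip: ennreal_mult')
  also have "\<dots> = ennreal ((Gamma s)\<^sup>2) * (\<integral>\<^sup>+ y. ennreal (exp (- s * lphi y)) \<partial>\<mu>)"
    by (rule nn_integral_cmult) measurable
  finally have "ennreal ((Gamma s)\<^sup>2) * (\<integral>\<^sup>+ y. ennreal (exp (- s * lphi y)) \<partial>\<mu>) < \<infinity>"
    using integrable_macdonald_prod[OF assms] by simp
  then have "(\<integral>\<^sup>+ y. ennreal (exp (- s * lphi y)) \<partial>\<mu>) < \<infinity>"
    using Gamma_real_pos[OF assms] by (auto simp: ennreal_mult_less_top ennreal_mult_eq_top_iff less_top[symmetric])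
  then show ?thesis by (intro integrableI_bounded) auto
qed

lemma nn_integral_todd_phi:
  "(\<integral>\<^sup>+ y. ennreal (todd (z + lphi y)) \<partial>\<mu>)
    = (\<integral>\<^sup>+ x. ennreal (exp x * macdonald x * (\<Prod>i=1..l + 1. macdonald (x + z + ln (q i)))) \<partial>lborel)"
proof -
  interpret N: sigma_finite_measure \<mu> by (rule sigma_finite_banana_measure)
  interpret pair_sigma_finite lborel \<mu> ..
  have "(\<integral>\<^sup>+ y. ennreal (todd (z + lphi y)) \<partial>\<mu>)
     = (\<integral>\<^sup>+ y. \<integral>\<^sup>+ x. ennreal (exp x * macdonald x * macdonald (x + z + lphi y)) \<partial>lborel \<partial>\<mu>)"
    by (simp only: nn_integral_macdonald_convolution[symmetric] add.assoc)
  also have "\<dots> = (\<integral>\<^sup>+ x. \<integral>\<^sup>+ y. ennreal (exp x * macdonald x * macdonald (x + z + lphi y)) \<partial>\<mu> \<partial>lborel)"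
    by (rule Fubini') measurable
  also have "\<dots> = (\<integral>\<^sup>+ x. ennreal (exp x * macdonald x * (\<Prod>i=1..l + 1. macdonald (x + z + ln (q i)))) \<partial>lborel)"
  proof (rule nn_integral_cong)
    fix x
    have nn: "0 \<le> exp x * macdonald x" by simp
    have "(\<integral>\<^sup>+ y. ennreal (exp x * macdonald x * macdonald (x + z + lphi y)) \<partial>\<mu>)
       = (\<integral>\<^sup>+ y. ennreal (exp x * macdonald x) * ennreal (macdonald (x + z + lphi y)) \<partial>\<mu>)"
      by (simp only: ennreal_mult'[OF nn])
    also have "\<dots> = ennreal (exp x * macdonald x) * (\<integral>\<^sup>+ y. ennreal (macdonald (x + z + lphi y)) \<partial>\<mu>)"
      by (rule nn_integral_cmult) measurable
    finally show "(\<integral>\<^sup>+ y. ennreal (exp x * macdonald x * macdonald (x + z + lphi y)) \<partial>\<mu>)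
       = ennreal (exp x * macdonald x * (\<Prod>i=1..l + 1. macdonald (x + z + ln (q i))))"
      by (simp only: nn_integral_macdonald_phi ennreal_mult'[OF nn])
  qed
  finally show ?thesis .
qed

section \<open>The analytic continuation of the amplitude\<close>

text \<open>The first expression for \<open>M\<close>, in the pole-free strip
  \<open>\<bar>Im z\<bar> < 2 * pi\<close>.\<close>

definition todd_integral :: "complex \<Rightarrow> complex" where
  "todd_integral z = (LINT y|\<mu>. todd (z + of_real (lphi y)))"

definition amplitude :: "complex \<Rightarrow> complex" where
  "amplitude t = (LINT y|\<mu>. 1 / (t - of_real (banana_phi l q y)))"

lemma todd_measurable [measurable]: "(todd :: complex \<Rightarrow> complex) \<in> borel_measurable borel"
  unfolding todd_def[abs_def] by measurable

lemma todd_phi_bound: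
  assumes "b < 2 * pi"
  obtains C where "C > 0" "\<And>z y. \<bar>Im z\<bar> \<le> b \<Longrightarrow> Re z \<ge> a \<Longrightarrow> y \<in> space \<mu> \<Longrightarrow>
    norm (todd (z + of_real (lphi y))) \<le> C * exp (- (1/2) * lphi y)"
proof -
  \<comment> \<open>Since \<open>\<phi> \<ge> T\<close>, the argument of \<open>todd\<close> has
    real part at least \<open>a + ln T\<close> for all \<open>y\<close> simultaneously.\<close>
  obtain C where C: "C > 0" "\<And>z. \<bar>Im z\<bar> \<le> b \<Longrightarrow> Re z \<ge> a + ln T \<Longrightarrow> norm (todd z) \<le> C * exp (- Re z / 2)"
    using todd_bound_strip[OF assms] by metis
  have "norm (todd (z + of_real (lphi y))) \<le> (C * exp (- a / 2)) * exp (- (1/2) * lphi y)"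
    if "\<bar>Im z\<bar> \<le> b" "Re z \<ge> a" "y \<in> space \<mu>" for z y
  proof -
    have "norm (todd (z + of_real (lphi y))) \<le> C * exp (- Re (z + of_real (lphi y)) / 2)"
      using that lphi_ge[of y] by (intro C) auto
    also have "\<dots> \<le> C * exp (- a / 2 + - (1/2) * lphi y)"
      using that C(1) by (intro mult_left_mono) (auto simp: field_simps)
    finally show ?thesis by (simp only: exp_add mult.assoc)
  qed
  then show ?thesis using C(1) by (intro that[of "C * exp (- a / 2)"]) auto
qed

lemma integrable_todd_phi:
  assumes "\<bar>Im z\<bar> < 2 * pi"
  shows "integrable \<mu> (\<lambda>y. todd (z + of_real (lphi y)))"
proof -
  obtain C where C: "C > 0" "\<And>w y. \<bar>Im w\<bar> \<le> \<bar>Im z\<bar> \<Longrightarrow> Re w \<ge> Re z \<Longrightarrow> y \<in> space \<mu> \<Longrightarrow>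
    norm (todd (w + of_real (lphi y))) \<le> C * exp (- (1/2) * lphi y)"
    using todd_phi_bound[OF assms] by metis
  show ?thesis
  proof (rule Bochner_Integration.integrable_bound[OF _ _ AE_I2])
    show "integrable \<mu> (\<lambda>y. C * exp (- (1/2) * lphi y))"
      by (intro integrable_mult_right integrable_phi_power) auto
    show "norm (todd (z + of_real (lphi y))) \<le> norm (C * exp (- (1/2) * lphi y))" if "y \<in> space \<mu>" for y
      using C(2)[of z, OF _ _ that] C(1) by simp
  qed measurable
qed

lemma todd_integral_holomorphic: "todd_integral holomorphic_on {z. \<bar>Im z\<bar> < 2 * pi}"
  unfolding todd_integral_def[abs_def]
proof (rule holomorphic_on_integral)
  have "continuous_on UNIV (\<lambda>z. \<bar>Im z\<bar>)" by (intro continuous_intros)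
  then show "open {z. \<bar>Im z\<bar> < 2 * pi}"
    using open_Collect_less[of "\<lambda>z. \<bar>Im z\<bar>" "\<lambda>_. 2 * pi"] by auto
  show "(\<lambda>z. todd (z + of_real (lphi y))) holomorphic_on {z. \<bar>Im z\<bar> < 2 * pi}" for y
  proof -
    have "todd \<circ> (\<lambda>z. z + of_real (lphi y)) holomorphic_on {z. \<bar>Im z\<bar> < 2 * pi}"
      by (rule holomorphic_on_compose_gen[OF _ todd_holomorphic]) (auto intro!: holomorphic_intros)
    then show ?thesis by (simp add: o_def)
  qed
  show "(\<lambda>y. todd (z + of_real (lphi y))) \<in> borel_measurable \<mu>" for z :: complex
    by measurable
  fix z assume z: "z \<in> {z. \<bar>Im z\<bar> < 2 * pi}"
  define r where "r = (2 * pi - \<bar>Im z\<bar>) / 2"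
  have r: "r > 0" using z by (simp add: r_def)
  have im: "\<bar>Im w\<bar> \<le> \<bar>Im z\<bar> + r" "Re w \<ge> Re z - r" if "w \<in> cball z r" for w
    using that abs_Im_le_cmod[of "z - w"] abs_Re_le_cmod[of "z - w"] by (auto simp: dist_norm)
  have b: "\<bar>Im z\<bar> + r < 2 * pi" using z by (auto simp: r_def field_simps)
  obtain C where C: "C > 0" "\<And>w y. \<bar>Im w\<bar> \<le> \<bar>Im z\<bar> + r \<Longrightarrow> Re w \<ge> Re z - r \<Longrightarrow> y \<in> space \<mu> \<Longrightarrow>
    norm (todd (w + of_real (lphi y))) \<le> C * exp (- (1/2) * lphi y)"
    using todd_phi_bound[OF b] by metis
  show "\<exists>r>0. \<exists>g. cball z r \<subseteq> {z. \<bar>Im z\<bar> < 2 * pi} \<and> integrable \<mu> g \<and>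
        (\<forall>w\<in>cball z r. \<forall>y\<in>space \<mu>. norm (todd (w + of_real (lphi y))) \<le> g y)"
  proof (intro exI[of _ r] exI[of _ "\<lambda>y. C * exp (- (1/2) * lphi y)"] conjI)
    show "cball z r \<subseteq> {z. \<bar>Im z\<bar> < 2 * pi}" using im(1) b by force
    show "integrable \<mu> (\<lambda>y. C * exp (- (1/2) * lphi y))"
      by (intro integrable_mult_right integrable_phi_power) auto
  qed (use im C(2) r in auto)
qed

lemma closed_cut: "closed (of_real ` {T..} :: complex set)"
  by (intro closed_injective_linear_image) (auto simp: linear_iff inj_on_def scaleR_conv_of_real)

text \<open>Locally uniformly in \<open>t\<close> the integrand is at most a constant over
  \<open>\<phi>\<close>: for bounded \<open>\<phi>\<close> because of the distance to the cut, for
  large \<open>\<phi>\<close> because it dominates \<open>t\<close>.\<close>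

lemma amplitude_holomorphic: "amplitude holomorphic_on (- of_real ` {T..})"
  unfolding amplitude_def[abs_def]
proof (rule holomorphic_on_integral)
  show op: "open (- of_real ` {T..} :: complex set)" using closed_cut by auto
  have ne: "t \<noteq> of_real (banana_phi l q y)" if "y \<in> space \<mu>" "t \<in> - of_real ` {T..}" for t :: complex and y
    using phi_ge_T[OF that(1)] that(2) by auto
  show "(\<lambda>t. 1 / (t - of_real (banana_phi l q y))) holomorphic_on - of_real ` {T..}" if "y \<in> space \<mu>" for y
    using ne[OF that] by (intro holomorphic_intros) force
  show "(\<lambda>y. 1 / (t - of_real (banana_phi l q y))) \<in> borel_measurable \<mu>" for t :: complex
    by measurable
  fix t :: complex assume t: "t \<in> - of_real ` {T..}"
  then obtain e where e: "e > 0" "cball t e \<subseteq> - of_real ` {T..}"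
    using op open_contains_cball by blast
  \<comment> \<open>Half of \<open>e\<close>, so that every point of the smaller disc still has
    distance at least \<open>r\<close> from the cut.\<close>
  define r where "r = e / 2"
  have r: "r > 0" using e by (simp add: r_def)
  have "cball t r \<subseteq> cball t e" using e by (intro subset_cball) (simp add: r_def)
  then have r_sub: "cball t r \<subseteq> - of_real ` {T..}" using e(2) by (rule order_trans)
  define R where "R = 2 * (norm t + r)"
  have R: "R > 0" using r by (simp add: R_def add_nonneg_pos)
  \<comment> \<open>\<open>R / r\<close> serves \<open>\<phi> \<le> R\<close>. Beyond
    \<open>R\<close> the point \<open>w\<close> has norm at most \<open>\<phi> / 2\<close>, and 2
    suffices.\<close>
  define C where "C = max 2 (R / r)"
  have bound: "norm (1 / (w - of_real (banana_phi l q y))) \<le> C * exp (- 1 * lphi y)"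
    if w: "w \<in> cball t r" and y: "y \<in> space \<mu>" for w y
  proof -
    define p where "p = banana_phi l q y"
    have p: "p > 0" "p \<ge> T" using phi_pos[OF y] phi_ge_T[OF y] by (auto simp: p_def)
    have nt: "norm w \<le> norm t + r" using w norm_triangle_ineq2[of w t] by (auto simp: dist_norm norm_minus_commute)
    have d: "r \<le> norm (w - of_real p)"
    proof (rule ccontr)
      assume "\<not> ?thesis"
      then have "dist w (of_real p) < r" by (simp add: dist_norm)
      then have "dist t (of_real p) \<le> e"
        using w dist_triangle[of t "of_real p" w] by (auto simp: r_def)
      then have "of_real p \<in> - (of_real ` {T..} :: complex set)" using e(2) by auto
      then show False using p by auto
    qed
    have "p \<le> C * norm (w - of_real p)"
    proof (cases "p \<le> R")
      case True
      then have "p \<le> (R / r) * r" using r by simp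
      also have "\<dots> \<le> C * norm (w - of_real p)" using d r R by (intro mult_mono) (auto simp: C_def)
      finally show ?thesis .
    next
      case False
      have "p - norm w \<le> norm (w - of_real p)"
        using norm_triangle_ineq2[of "of_real p" w] p by (simp add: norm_minus_commute)
      moreover have "norm w \<le> p / 2" using nt False by (simp add: R_def)
      ultimately have "p \<le> 2 * norm (w - of_real p)" by linarith
      also have "\<dots> \<le> C * norm (w - of_real p)" by (intro mult_right_mono) (auto simp: C_def)
      finally show ?thesis .
    qed
    moreover have e1: "exp (- 1 * lphi y) = 1 / p" using exp_lphi[OF y] by (simp add: exp_minus p_def divide_inverse)
    moreover have "norm (w - of_real p) > 0" using d r by linarith
    ultimately have "1 / norm (w - of_real p) \<le> C * (1 / p)"
      using p(1) by (simp only: divide_simps) (simp add: mult.commute)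
    then show ?thesis unfolding e1 by (simp add: norm_divide p_def)
  qed
  show "\<exists>r>0. \<exists>g. cball t r \<subseteq> - of_real ` {T..} \<and> integrable \<mu> g \<and>
        (\<forall>w\<in>cball t r. \<forall>y\<in>space \<mu>. norm (1 / (w - of_real (banana_phi l q y))) \<le> g y)"
  proof (intro exI[of _ r] exI[of _ "\<lambda>y. C * exp (- 1 * lphi y)"] conjI)
    show "integrable \<mu> (\<lambda>y. C * exp (- 1 * lphi y))"
      by (intro integrable_mult_right integrable_phi_power) auto
  qed (use r r_sub bound in auto)
qed

lemma amplitude_of_real: "amplitude (of_real t) = of_real (banana_integral l q t)"
proof -
  have "1 / (of_real t - of_real p) = (of_real (1 / (t - p)) :: complex)" for p by simp
  then show ?thesis
    unfolding amplitude_def banana_integral_eq by (simp only: integral_complex_of_real)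
qed

text \<open>At both arguments the exponential equals \<open>- \<phi> / s\<close>, so the
  denominators of \<open>todd\<close> agree and the numerators differ by
  \<open>2 * pi * \<i>\<close>. The condition on \<open>s\<close> keeps both arguments inside the
  strip.\<close>

lemma amplitude_eq_todd_integral:
  assumes s: "s \<notin> \<real>\<^sub>\<le>\<^sub>0"
  shows "amplitude (- s) = 1 / (2 * of_real pi * \<i> * s) *
    (todd_integral (\<i> * of_real pi - Ln s) - todd_integral (- \<i> * of_real pi - Ln s))"
proof -
  have s0: "s \<noteq> 0" using s by auto
  have Im: "\<bar>Im (Ln s)\<bar> < pi"
    using s s0 mpi_less_Im_Ln[of s] Im_Ln_less_pi[of s] by (auto simp: complex_nonpos_Reals_iff)
  have strip: "\<bar>Im (\<i> * of_real pi - Ln s)\<bar> < 2 * pi" "\<bar>Im (- \<i> * of_real pi - Ln s)\<bar> < 2 * pi"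
    using Im by auto
  have pt: "todd (\<i> * of_real pi - Ln s + of_real (lphi y)) - todd (- \<i> * of_real pi - Ln s + of_real (lphi y))
      = 2 * of_real pi * \<i> * s * (1 / (- s - of_real (banana_phi l q y)))" if y: "y \<in> space \<mu>" for y
  proof -
    define p where "p = banana_phi l q y"
    have p: "p > 0" "exp (lphi y) = p" using phi_pos[OF y] exp_lphi[OF y] by (auto simp: p_def)
    have sp: "s + of_real p \<noteq> 0"
    proof
      assume "s + of_real p = 0"
      then have "s = of_real (- p)" by (simp add: eq_neg_iff_add_eq_0)
      then show False using s p by (auto simp: complex_nonpos_Reals_iff)
    qed
    have ex: "exp (c * (\<i> * of_real pi) - Ln s + of_real (lphi y)) = - of_real p / s" if "c = 1 \<or> c = -1" for c :: complex
    proof -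
      have "exp (c * (\<i> * of_real pi)) = -1"
        using that by (auto simp: exp_minus)
      then show ?thesis using s0 p by (simp add: exp_add exp_diff exp_of_real exp_Ln)
    qed
    have ne: "- of_real p / s \<noteq> 1" 
    proof
      assume "- of_real p / s = 1"
      then have "s = - of_real p" using s0 by (simp only: divide_eq_1_iff) 
      then show False using sp by simp
    qed
    have td: "todd w = w / (- of_real p / s - 1)" if "exp w = - of_real p / s" for w :: complex
      using that ne by (auto simp: todd_def)
    have "todd (\<i> * of_real pi - Ln s + of_real (lphi y)) - todd (- \<i> * of_real pi - Ln s + of_real (lphi y))
      = 2 * of_real pi * \<i> / (- of_real p / s - 1)"
      using td[OF ex[of 1]] td[OF ex[of "-1"]] by (simp flip: diff_divide_distrib add: algebra_simps)
    also have "- of_real p / s - 1 = (- s - of_real p) / s" using s0 by (simp add: field_simps)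
    finally show ?thesis by (simp add: p_def)
  qed
  have "todd_integral (\<i> * of_real pi - Ln s) - todd_integral (- \<i> * of_real pi - Ln s)
     = (LINT y|\<mu>. 2 * of_real pi * \<i> * s * (1 / (- s - of_real (banana_phi l q y))))"
    unfolding todd_integral_def
    by (subst Bochner_Integration.integral_diff[OF integrable_todd_phi[OF strip(1)] integrable_todd_phi[OF strip(2)], symmetric])
       (rule Bochner_Integration.integral_cong[OF refl pt])
  also have "\<dots> = 2 * of_real pi * \<i> * s * amplitude (- s)"
    unfolding amplitude_def by (rule integral_mult_right_zero)
  finally show ?thesis using s0 by simp
qed

end

section \<open>The second expression for M, beyond the strip\<close>

context banana begin

definition Q :: real where "Q = (\<Sum>i=1..l + 1. \<bar>ln (q i)\<bar>)"

text \<open>Chosen so that each of the \<open>l + 1\<close> exponents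
  \<open>3 * exp ((x + Re z + ln (q i)) / 2)\<close> is at most
  \<open>exp (x / 2) / (l + 1)\<close>. The 3 comes from \<open>macdonald_ext_approx\<close>, and
  \<open>Q\<close> absorbs the logarithms of the \<open>q i\<close>.\<close>

definition S :: real where "S = Q + 2 * ln (3 * (real l + 1))"

lemma abs_ln_q_le: "i \<in> {1..l + 1} \<Longrightarrow> \<bar>ln (q i)\<bar> \<le> Q"
  unfolding Q_def by (rule member_le_sum) auto

lemma Q_nonneg: "Q \<ge> 0" unfolding Q_def by (rule sum_nonneg) auto

text \<open>Beyond \<open>Re z = -S\<close> the growth of the product is absorbed by \<^const>\<open>macdonald\<close>.\<close>

lemma prod_exp_exp_le:
  assumes "r \<le> - S"
  shows "(\<Prod>i=1..l + 1. exp (3 * exp ((x + r + ln (q i)) / 2))) \<le> exp (exp (x / 2))"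
proof -
  have "(\<Prod>i=1..l + 1. exp (3 * exp ((x + r + ln (q i)) / 2))) = exp (\<Sum>i=1..l + 1. 3 * exp ((x + r + ln (q i)) / 2))"
    by (rule exp_sum[symmetric]) simp
  also have "(\<Sum>i=1..l + 1. 3 * exp ((x + r + ln (q i)) / 2)) \<le> (\<Sum>i=1..l + 1. 3 * exp (x / 2 - ln (3 * (real l + 1))))"
  proof (intro sum_mono mult_left_mono)
    fix i assume "i \<in> {1..l + 1}"
    then have "(x + r + ln (q i)) / 2 \<le> x / 2 - ln (3 * (real l + 1))"
      using abs_ln_q_le[of i] assms by (simp add: S_def)
    then show "exp ((x + r + ln (q i)) / 2) \<le> exp (x / 2 - ln (3 * (real l + 1)))" by simp
  qed simp
  also have "\<dots> = (real l + 1) * (3 * exp (x / 2 - ln (3 * (real l + 1))))"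
    by (simp only: sum_constant card_atLeastAtMost) simp
  also have "\<dots> = exp (x / 2)"
  proof -
    have "3 * (real l + 1) > 0" by simp
    then have "exp (x / 2 - ln (3 * (real l + 1))) = exp (x / 2) / (3 * (real l + 1))"
      by (simp only: exp_diff exp_ln)
    then show ?thesis by (simp add: field_simps)
  qed
  finally show ?thesis by simp
qed

definition ext_factor :: "complex \<Rightarrow> real \<Rightarrow> nat \<Rightarrow> complex" where
  "ext_factor z x i = macdonald_ext (of_real x + z + of_real (ln (q i)))"

definition log_factor :: "complex \<Rightarrow> real \<Rightarrow> nat \<Rightarrow> complex" where
  "log_factor z x i = - (of_real x + z + of_real (ln (q i))) - 2 * of_real euler_mascheroni"

abbreviation "ext_prod z x \<equiv> \<Prod>i=1..l + 1. ext_factor z x i"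

abbreviation "log_prod z x \<equiv> \<Prod>i=1..l + 1. log_factor z x i"

abbreviation "weight x \<equiv> complex_of_real (exp x * macdonald x)"

text \<open>\<open>macdonald (x - ln 4)\<close> is what \<open>macdonald_mult_exp_exp_le\<close>
  leaves after absorbing the double exponential; \<open>1 * x\<close> keeps the shape of
  \<open>integrable_power_macdonald\<close>.\<close>

abbreviation "majorant x \<equiv> (1 + \<bar>x\<bar>) ^ (l + 1) * (exp (1 * x) * macdonald (x - ln 4))"

text \<open>The exact and the logarithmic factors share the majorants
  \<open>D z x * e z x i\<close>. Normalised by these they lie in the unit disc, where a difference
  of products is at most the sum of the differences of the factors.\<close>

lemma ext_prod_bounds:
  obtains C where "C > 0"
    "\<And>z x. Re z \<le> - S \<Longrightarrow> norm (ext_prod z x)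
       \<le> C * (1 + norm z) ^ (l + 1) * ((1 + \<bar>x\<bar>) ^ (l + 1) * exp (exp (x / 2)))"
    "\<And>z x. Re z \<le> - S \<Longrightarrow> norm (ext_prod z x - log_prod z x)
       \<le> C * ((1 + norm z) ^ (l + 1) * exp (Re z)) * ((1 + \<bar>x\<bar>) ^ (l + 1) * exp x * exp (exp (x / 2)))"
proof -
  obtain C0 where C0: "C0 > 0"
    "\<And>z::complex. norm (macdonald_ext z + z + 2 * of_real euler_mascheroni)
       \<le> C0 * (1 + norm z) * exp (Re z) * exp (3 * exp (Re z / 2))"
    "\<And>z::complex. norm (macdonald_ext z) \<le> C0 * (1 + norm z) * exp (3 * exp (Re z / 2))"
    using macdonald_ext_approx by blast
  \<comment> \<open>\<open>C0\<close> serves the exact factors,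
    \<open>1 + 2 * euler_mascheroni\<close> the logarithmic ones, and \<open>1 + Q\<close> absorbs
    \<open>ln (q i)\<close>.\<close>
  define C1 where "C1 = (C0 + 1 + 2 * euler_mascheroni) * (1 + Q)"
  have g: "(euler_mascheroni :: real) > 0" by (rule euler_mascheroni_pos)
  have C1: "C1 > 0" unfolding C1_def using C0 g Q_nonneg by (intro mult_pos_pos) auto
  define D where "D z x = C1 * ((1 + norm z) * (1 + \<bar>x\<bar>))" for z :: complex and x :: real
  have Dpos: "D z x > 0" for z x using C1 by (auto simp: D_def intro!: mult_pos_pos add_pos_nonneg)
  define e where "e z x i = exp (3 * exp ((x + Re z + ln (q i)) / 2))" for z x i
  have epos: "e z x i \<ge> 1" for z x i by (simp add: e_def)
  have arg: "K * (1 + norm (of_real x + z + of_real (ln (q i)))) \<le> D z x"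
    if "i \<in> {1..l + 1}" "0 \<le> K" "K \<le> C0 + 1 + 2 * euler_mascheroni" for z x i K
  proof -
    have "norm (of_real x + z + of_real (ln (q i))) \<le> \<bar>x\<bar> + norm z + \<bar>ln (q i)\<bar>"
      by (intro norm_triangle_le add_mono) auto
    also have "\<dots> \<le> \<bar>x\<bar> + norm z + Q" using abs_ln_q_le[OF that(1)] by simp
    finally have "1 + norm (of_real x + z + of_real (ln (q i))) \<le> 1 + \<bar>x\<bar> + norm z + Q" by simp
    also have "\<dots> \<le> (1 + Q) * ((1 + norm z) * (1 + \<bar>x\<bar>))"
      using Q_nonneg by (simp add: algebra_simps)
    finally have "K * (1 + norm (of_real x + z + of_real (ln (q i))))
        \<le> (C0 + 1 + 2 * euler_mascheroni) * ((1 + Q) * ((1 + norm z) * (1 + \<bar>x\<bar>)))"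
      using that g C0(1) by (intro mult_mono) auto
    then show ?thesis by (simp add: D_def C1_def mult.assoc)
  qed
  have ext: "norm (ext_factor z x i) \<le> D z x * e z x i" if i: "i \<in> {1..l + 1}" for z x i
  proof -
    have "norm (ext_factor z x i) \<le> C0 * (1 + norm (of_real x + z + of_real (ln (q i)))) * e z x i"
      using C0(3)[of "of_real x + z + of_real (ln (q i))"] by (simp add: ext_factor_def e_def)
    also have "\<dots> \<le> D z x * e z x i" using epos[of z x i] C0(1) g i
      by (intro mult_right_mono arg) auto
    finally show ?thesis .
  qed
  have log: "norm (log_factor z x i) \<le> D z x * e z x i" if i: "i \<in> {1..l + 1}" for z x i
  proof -
    define w where "w = of_real x + z + of_real (ln (q i))"
    have "norm (log_factor z x i) \<le> norm w + 2 * euler_mascheroni"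
    proof -
      have "norm (2 * of_real euler_mascheroni :: complex) = 2 * euler_mascheroni"
        unfolding norm_mult norm_of_real using g by simp
      then show ?thesis
        using norm_triangle_ineq4[of "- w" "2 * of_real euler_mascheroni"]
        by (simp only: log_factor_def w_def norm_minus_cancel)
    qed
    also have "\<dots> \<le> (1 + 2 * euler_mascheroni) * (1 + norm w)" using g by (simp add: algebra_simps)
    also have "\<dots> \<le> D z x" unfolding w_def using i C0 g by (intro arg) auto
    also have "\<dots> \<le> D z x * e z x i" using epos[of z x i] Dpos[of z x] by simp
    finally show ?thesis .
  qed
  have diff: "norm (ext_factor z x i - log_factor z x i) \<le> exp (x + Re z + Q) * (D z x * e z x i)"
    if i: "i \<in> {1..l + 1}" for z x i
  proof -
    define w where "w = of_real x + z + of_real (ln (q i))"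
    have "ext_factor z x i - log_factor z x i = macdonald_ext w + w + 2 * of_real euler_mascheroni"
      by (simp add: ext_factor_def log_factor_def w_def)
    then have "norm (ext_factor z x i - log_factor z x i) \<le> C0 * (1 + norm w) * exp (Re w) * e z x i"
      using C0(2)[of w] by (simp add: e_def w_def)
    also have "\<dots> \<le> D z x * exp (x + Re z + Q) * e z x i"
      using epos[of z x i] arg[OF i, of C0 x z] C0 g abs_ln_q_le[OF i] Dpos[of z x]
      by (intro mult_right_mono mult_mono) (auto simp: w_def)
    finally show ?thesis by (simp add: mult_ac)
  qed
  have prod: "(\<Prod>i=1..l + 1. D z x * e z x i) \<le> C1 ^ (l + 1) * (1 + norm z) ^ (l + 1) * ((1 + \<bar>x\<bar>) ^ (l + 1) * exp (exp (x / 2)))"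
    if "Re z \<le> - S" for z x
  proof -
    have "(\<Prod>i=1..l + 1. D z x * e z x i) = D z x ^ (l + 1) * (\<Prod>i=1..l + 1. e z x i)"
      by (simp add: prod.distrib)
    also have "\<dots> \<le> D z x ^ (l + 1) * exp (exp (x / 2))"
      unfolding e_def using Dpos[of z x] by (intro mult_left_mono prod_exp_exp_le that) auto
    also have "\<dots> = C1 ^ (l + 1) * (1 + norm z) ^ (l + 1) * ((1 + \<bar>x\<bar>) ^ (l + 1) * exp (exp (x / 2)))"
      unfolding D_def power_mult_distrib by (simp only: mult_ac)
    finally show ?thesis .
  qed
  define C where "C = C1 ^ (l + 1) * (1 + real (l + 1) * exp Q)"
  show ?thesis
  proof (rule that[of C])
    show "C > 0" unfolding C_def using C1 by (intro mult_pos_pos) (auto intro: add_pos_nonneg)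
    fix z x assume z: "Re z \<le> - S"
    define B where "B = (1 + norm z) ^ (l + 1) * ((1 + \<bar>x\<bar>) ^ (l + 1) * exp (exp (x / 2)))"
    have B: "B \<ge> 0" by (simp add: B_def)
    have prodB: "(\<Prod>i=1..l + 1. D z x * e z x i) \<le> C1 ^ (l + 1) * B"
      using prod[OF z, of x] by (simp only: B_def mult_ac)
    have "norm (ext_prod z x) \<le> (\<Prod>i=1..l + 1. D z x * e z x i)"
      unfolding prod_norm[symmetric] by (intro prod_mono conjI ext) auto
    also have "\<dots> \<le> C1 ^ (l + 1) * 1 * B" using prodB by simp
    also have "\<dots> \<le> C * B" unfolding C_def using C1 B by (intro mult_right_mono mult_left_mono) auto
    finally show "norm (ext_prod z x)
       \<le> C * (1 + norm z) ^ (l + 1) * ((1 + \<bar>x\<bar>) ^ (l + 1) * exp (exp (x / 2)))"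
      by (simp only: B_def mult.assoc)
    define P where "P = (\<Prod>i=1..l + 1. D z x * e z x i)"
    have pos: "D z x * e z x i > 0" for i using Dpos[of z x] epos[of z x i] by (intro mult_pos_pos) auto
    have P: "P > 0" unfolding P_def using pos by (intro prod_pos) auto
    \<comment> \<open>\<open>P\<close> is the product of all majorants; pulling it out leaves
      factors of norm at most 1, as \<open>norm_prod_diff\<close> requires.\<close>
    have scale: "(\<Prod>i=1..l + 1. f i) = of_real P * (\<Prod>i=1..l + 1. f i / of_real (D z x * e z x i))" for f :: "nat \<Rightarrow> complex"
    proof -
      have "(\<Prod>i=1..l + 1. f i / of_real (D z x * e z x i)) = (\<Prod>i=1..l + 1. f i) / of_real P"
        by (simp only: prod_dividef P_def of_real_prod)
      then show ?thesis using P by simp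
    qed
    have "norm (ext_prod z x - log_prod z x)
      = P * norm ((\<Prod>i=1..l + 1. ext_factor z x i / of_real (D z x * e z x i)) - (\<Prod>i=1..l + 1. log_factor z x i / of_real (D z x * e z x i)))"
      unfolding scale[of "ext_factor z x"] scale[of "log_factor z x"] using P
      by (simp only: right_diff_distrib[symmetric] norm_mult norm_of_real abs_of_pos)
    also have "\<dots> \<le> P * (\<Sum>i=1..l + 1. norm (ext_factor z x i / of_real (D z x * e z x i) - log_factor z x i / of_real (D z x * e z x i)))"
    proof (intro mult_left_mono norm_prod_diff)
      fix i assume "i \<in> {1..l + 1}"
      then show "norm (ext_factor z x i / of_real (D z x * e z x i)) \<le> 1" "norm (log_factor z x i / of_real (D z x * e z x i)) \<le> 1"
        using ext[of i z x] log[of i z x] pos[of i]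
        by (simp_all only: norm_divide norm_of_real abs_of_pos divide_le_eq_1_pos)
    qed (use P in simp)
    also have "\<dots> \<le> P * (\<Sum>i=1..l + 1. exp (x + Re z + Q))"
    proof (intro mult_left_mono sum_mono)
      fix i assume "i \<in> {1..l + 1}"
      then show "norm (ext_factor z x i / of_real (D z x * e z x i) - log_factor z x i / of_real (D z x * e z x i)) \<le> exp (x + Re z + Q)"
        using diff[of i z x] pos[of i]
        by (simp only: diff_divide_distrib[symmetric] norm_divide norm_of_real abs_of_pos pos_divide_le_eq)
    qed (use P in simp)
    also have "\<dots> = P * (real (l + 1) * exp Q) * (exp x * exp (Re z))" by (simp add: exp_add)
    also have "\<dots> \<le> (C1 ^ (l + 1) * B) * (1 + real (l + 1) * exp Q) * (exp x * exp (Re z))"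
      using prodB P B C1 unfolding P_def[symmetric] by (intro mult_right_mono mult_mono) auto
    also have "\<dots> = C * ((1 + norm z) ^ (l + 1) * exp (Re z)) * ((1 + \<bar>x\<bar>) ^ (l + 1) * exp x * exp (exp (x / 2)))"
      by (simp only: C_def B_def mult_ac)
    finally show "norm (ext_prod z x - log_prod z x)
       \<le> C * ((1 + norm z) ^ (l + 1) * exp (Re z)) * ((1 + \<bar>x\<bar>) ^ (l + 1) * exp x * exp (exp (x / 2)))" .
  qed
qed

lemma ext_factor_of_real: "ext_factor (of_real z) x i = of_real (macdonald (x + z + ln (q i)))"
  unfolding ext_factor_def by (simp flip: macdonald_ext_eq of_real_add)

lemma macdonald_ext_measurable [measurable]: "(macdonald_ext :: complex \<Rightarrow> complex) \<in> borel_measurable borel"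
  by (intro borel_measurable_continuous_onI holomorphic_on_imp_continuous_on macdonald_ext_holomorphic)

lemma ext_factor_measurable [measurable]: "(\<lambda>x. ext_factor z x i) \<in> borel_measurable borel"
  unfolding ext_factor_def by measurable

text \<open>The second expression for \<open>M\<close>; on \<open>Re z \<le> - S\<close> it
  converges for every imaginary part.\<close>

definition bessel_moment :: "complex \<Rightarrow> complex" where
  "bessel_moment z = (LINT x|lborel. weight x * ext_prod z x)"

lemma macdonald_weight_le: "exp (s * x) * macdonald x * exp (exp (x / 2)) \<le> exp (s * x) * macdonald (x - ln 4)"
  using mult_left_mono[OF macdonald_mult_exp_exp_le[of x], of "exp (s * x)"] by (simp add: mult.assoc)

lemma bessel_moment_dominated:
  obtains C where "C > 0" "\<And>z x. Re z \<le> - S \<Longrightarrow>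
    norm (weight x * ext_prod z x)
      \<le> C * (1 + norm z) ^ (l + 1) * majorant x"
proof -
  obtain C where C: "C > 0" "\<And>z x. Re z \<le> - S \<Longrightarrow> norm (ext_prod z x)
       \<le> C * (1 + norm z) ^ (l + 1) * ((1 + \<bar>x\<bar>) ^ (l + 1) * exp (exp (x / 2)))"
    using ext_prod_bounds by metis
  show ?thesis
  proof (rule that[OF C(1)])
    fix z x assume z: "Re z \<le> - S"
    have "norm (weight x * ext_prod z x)
      = (exp x * macdonald x) * norm (ext_prod z x)"
      by (simp add: norm_mult)
    also have "\<dots> \<le> (exp x * macdonald x) * (C * (1 + norm z) ^ (l + 1) * ((1 + \<bar>x\<bar>) ^ (l + 1) * exp (exp (x / 2))))"
      by (intro mult_left_mono C z) auto
    also have "\<dots> = C * (1 + norm z) ^ (l + 1) * ((1 + \<bar>x\<bar>) ^ (l + 1) * (exp (1 * x) * macdonald x * exp (exp (x / 2))))"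
      by (simp add: mult_ac)
    also have "\<dots> \<le> C * (1 + norm z) ^ (l + 1) * majorant x"
      using C(1) by (intro mult_left_mono macdonald_weight_le) auto
    finally show "norm (weight x * ext_prod z x)
      \<le> C * (1 + norm z) ^ (l + 1) * majorant x" .
  qed
qed

lemma integrable_bessel_moment:
  assumes "Re z \<le> - S"
  shows "integrable lborel (\<lambda>x. weight x * ext_prod z x)"
proof -
  obtain C where C: "C > 0" "\<And>z x. Re z \<le> - S \<Longrightarrow>
    norm (weight x * ext_prod z x)
      \<le> C * (1 + norm z) ^ (l + 1) * majorant x"
    using bessel_moment_dominated by metis
  show ?thesis
  proof (rule Bochner_Integration.integrable_bound[OF _ _ AE_I2])
    show "integrable lborel (\<lambda>x. C * (1 + norm z) ^ (l + 1) * majorant x)"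
      by (intro integrable_mult_right integrable_power_macdonald) auto
    show "norm (weight x * ext_prod z x)
      \<le> norm (C * (1 + norm z) ^ (l + 1) * majorant x)" for x
      by (rule order_trans[OF C(2)[OF assms] abs_ge_self[THEN order_trans[OF _ eq_refl[OF real_norm_def[symmetric]]]]])
  qed measurable
qed

lemma bessel_moment_holomorphic: "bessel_moment holomorphic_on {z. Re z < - S}"
  unfolding bessel_moment_def[abs_def]
proof (rule holomorphic_on_integral)
  show "open {z. Re z < - S}" by (rule open_halfspace_Re_lt)
  show "(\<lambda>z. weight x * ext_prod z x) holomorphic_on {z. Re z < - S}" for x
  proof -
    have "macdonald_ext \<circ> (\<lambda>z. of_real x + z + of_real (ln (q i))) holomorphic_on {z. Re z < - S}" for i
      by (rule holomorphic_on_compose) (auto intro!: holomorphic_intros macdonald_ext_holomorphic)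
    then show ?thesis unfolding ext_factor_def by (intro holomorphic_intros) (simp add: o_def)
  qed
  show "(\<lambda>x. weight x * ext_prod z x) \<in> borel_measurable lborel" for z
    by measurable
  fix z assume z: "z \<in> {z. Re z < - S}"
  obtain C where C: "C > 0" "\<And>z x. Re z \<le> - S \<Longrightarrow>
    norm (weight x * ext_prod z x)
      \<le> C * (1 + norm z) ^ (l + 1) * majorant x"
    using bessel_moment_dominated by metis
  obtain r where r: "r > 0" "cball z r \<subseteq> {z. Re z < - S}"
    using open_halfspace_Re_lt[of "- S"] z open_contains_cball by blast
  define g where "g x = C * (1 + (norm z + r)) ^ (l + 1) * majorant x" for x
  show "\<exists>r>0. \<exists>g. cball z r \<subseteq> {z. Re z < - S} \<and> integrable lborel g \<and>
      (\<forall>w\<in>cball z r. \<forall>x\<in>space lborel. norm (weight x * ext_prod w x) \<le> g x)"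
  proof (intro exI[of _ r] exI[of _ g] conjI ballI)
    show "integrable lborel g" unfolding g_def
      by (intro integrable_mult_right integrable_power_macdonald) auto
    fix w x assume w: "w \<in> cball z r"
    have nw: "norm w \<le> norm z + r" using w norm_triangle_ineq2[of w z] by (auto simp: dist_norm norm_minus_commute)
    have "Re w \<le> - S" using r(2) w by force
    from C(2)[OF this, of x] have "norm (weight x * ext_prod w x)
      \<le> C * (1 + norm w) ^ (l + 1) * majorant x" .
    also have "\<dots> \<le> g x" unfolding g_def using C(1) nw
      by (intro mult_right_mono mult_left_mono power_mono add_mono) auto
    finally show "norm (weight x * ext_prod w x) \<le> g x" .
  qed (use r in auto)
qed

text \<open>For real \<open>z\<close> both integrands are nonnegative, so each Bochner integral is
  \<open>enn2real\<close> of an extended integral, and Tonelli has already identified these.\<close>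

lemma todd_integral_eq_bessel_moment_real:
  "todd_integral (of_real z) = bessel_moment (of_real z)"
proof -
  have "todd_integral (of_real z) = of_real (LINT y|\<mu>. todd (z + lphi y))"
    unfolding todd_integral_def by (simp only: of_real_add[symmetric] todd_of_real integral_complex_of_real)
  also have "(LINT y|\<mu>. todd (z + lphi y)) = enn2real (\<integral>\<^sup>+ y. ennreal (todd (z + lphi y)) \<partial>\<mu>)"
  proof (rule integral_eq_nn_integral)
    have [measurable]: "(todd :: real \<Rightarrow> real) \<in> borel_measurable borel"
      unfolding todd_def[abs_def] by measurable
    show "(\<lambda>y. todd (z + lphi y)) \<in> borel_measurable \<mu>" by measurable
  qed (simp add: todd_nonneg)
  also have "\<dots> = enn2real (\<integral>\<^sup>+ x. ennreal (exp x * macdonald x * (\<Prod>i=1..l + 1. macdonald (x + z + ln (q i)))) \<partial>lborel)"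
    by (simp only: nn_integral_todd_phi)
  also have "\<dots> = (LINT x|lborel. exp x * macdonald x * (\<Prod>i=1..l + 1. macdonald (x + z + ln (q i))))"
    by (rule integral_eq_nn_integral[symmetric]) (auto intro!: AE_I2 mult_nonneg_nonneg prod_nonneg)
  also have "of_real \<dots> = bessel_moment (of_real z)"
    unfolding bessel_moment_def ext_factor_of_real
    by (simp only: of_real_mult of_real_prod integral_complex_of_real[symmetric])
  finally show ?thesis .
qed

text \<open>Both sides are holomorphic on a convex half strip and agree on its real half-line, so
  the identity theorem applies.\<close>

lemma todd_integral_eq_bessel_moment:
  assumes "\<bar>Im z\<bar> < 2 * pi" "Re z < - S"
  shows "todd_integral z = bessel_moment z"
proof -
  define U where "U = {z. Im z < 2 * pi} \<inter> {z. Im z > - 2 * pi} \<inter> {z. Re z < - S}"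
  have U: "open U" "connected U"
    unfolding U_def by (intro open_Int open_halfspace_Re_lt open_halfspace_Im_lt open_halfspace_Im_gt)
      (intro convex_connected convex_Int convex_halfspace_Re_lt convex_halfspace_Im_lt convex_halfspace_Im_gt)
  define c where "c = complex_of_real (- S - 1)"
  define R where "R = complex_of_real ` {..< - S}"
  have "c islimpt R"
    unfolding islimpt_approachable
  proof (intro allI impI)
    fix e :: real assume "e > 0"
    then show "\<exists>x'\<in>R. x' \<noteq> c \<and> dist x' c < e"
      by (intro bexI[of _ "complex_of_real (- S - 1 - e / 2)"]) (auto simp: R_def c_def dist_norm simp flip: of_real_diff)
  qed
  have "todd_integral z - bessel_moment z = 0"
  proof (rule analytic_continuation[of "\<lambda>z. todd_integral z - bessel_moment z" U R c])
    show "(\<lambda>z. todd_integral z - bessel_moment z) holomorphic_on U"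
      by (intro holomorphic_on_diff holomorphic_on_subset[OF todd_integral_holomorphic]
            holomorphic_on_subset[OF bessel_moment_holomorphic]) (auto simp: U_def)
  qed (use U \<open>c islimpt R\<close> assms in \<open>auto simp: U_def R_def c_def todd_integral_eq_bessel_moment_real\<close>)
  then show ?thesis by simp
qed

end

section \<open>Boundary values on the cut\<close>

context banana begin

text \<open>As \<open>T > 0\<close>, the slit plane is starlike about 0, hence connected; the
  identity theorem from the negative axis removes the ambiguity of the choice.\<close>

lemma feynman_amplitude_eq:
  assumes "t \<in> - of_real ` {T..}"
  shows "feynman_amplitude l q t = amplitude t"
proof -
  define U :: "complex set" where "U = - of_real ` {T..}"
  have U: "- complex_of_real ` {banana_threshold l q..} = U" by (simp add: U_def T_def)
  have ex: "\<exists>f. f holomorphic_on U \<and> (\<forall>t<0. f (complex_of_real t) = complex_of_real (banana_integral l q t))"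
    using amplitude_holomorphic amplitude_of_real unfolding U_def by blast
  have F: "feynman_amplitude l q holomorphic_on U"
    "\<And>t. t < 0 \<Longrightarrow> feynman_amplitude l q (complex_of_real t) = complex_of_real (banana_integral l q t)"
    using someI_ex[OF ex] unfolding feynman_amplitude_def U by auto
  have op: "open U" using closed_cut by (auto simp: U_def)
  have "starlike U"
    unfolding starlike_def
  proof (intro bexI[of _ 0] ballI subsetI)
    show "0 \<in> U" using T_pos by (auto simp: U_def)
    fix z w assume z: "z \<in> U" and w: "w \<in> closed_segment 0 z"
    obtain u where u: "0 \<le> u" "u \<le> 1" "w = of_real u * z"
      using w by (auto simp: in_segment scaleR_conv_of_real)
    show "w \<in> U"
    proof (rule ccontr)
      assume "w \<notin> U"
      then obtain r where r: "r \<ge> T" "of_real u * z = complex_of_real r" using u by (auto simp: U_def)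
      then have "u \<noteq> 0" using T_pos by auto
      then have u0: "u > 0" using u by auto
      then have zeq: "z = complex_of_real (r / u)" using r(2) by (simp add: field_simps)
      have "r / u \<ge> T"
      proof -
        have "T * u \<le> T * 1" using u T_pos by (intro mult_left_mono) auto
        then show ?thesis using r(1) u0 by (simp add: pos_le_divide_eq)
      qed
      then have "z \<in> complex_of_real ` {T..}" unfolding zeq by (intro imageI) simp
      then show False using z by (simp add: U_def)
    qed
  qed
  then have con: "connected U" by (rule starlike_imp_connected)
  define R where "R = complex_of_real ` {..<0}"
  have lp: "- 1 islimpt R"
    unfolding islimpt_approachable
  proof (intro allI impI)
    fix e :: real assume "e > 0"
    then have "complex_of_real (- 1 - e / 2) \<in> R" unfolding R_def by (intro imageI) simp
    then show "\<exists>x'\<in>R. x' \<noteq> - 1 \<and> dist x' (- 1) < e"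
      using \<open>e > 0\<close> by (intro bexI[of _ "complex_of_real (- 1 - e / 2)"]) (auto simp: dist_norm norm_divide)
  qed
  have neg: "of_real r \<in> U" if "r < 0" for r
    using that T_pos by (auto simp: U_def)
  have "feynman_amplitude l q t - amplitude t = 0"
  proof (rule analytic_continuation[of "\<lambda>t. feynman_amplitude l q t - amplitude t" U R "-1"])
    show "(\<lambda>t. feynman_amplitude l q t - amplitude t) holomorphic_on U"
      using F(1) amplitude_holomorphic unfolding U_def by (intro holomorphic_on_diff)
    show "- 1 \<in> U" using neg[of "-1"] by simp
  qed (use op con lp assms F(2) neg in \<open>auto simp: U_def[symmetric] R_def amplitude_of_real\<close>)
  then show ?thesis by simp
qed

text \<open>As \<open>t - \<sigma> \<i> \<epsilon>\<close> approaches the cut, one argument of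
  \<open>M\<close> tends to \<open>- ln t\<close> and the other to the edge of the strip. There
  \<open>bessel_moment\<close> is still continuous, because \<open>t > exp S\<close> puts both
  limits to the left of \<open>- S\<close>.\<close>

lemma feynman_boundary_value_eq:
  assumes \<sigma>: "\<sigma> \<in> {1, -1}" and t: "t > exp S"
  shows "feynman_boundary_value \<sigma> l q t = of_real \<sigma> / (2 * of_real pi * \<i> * of_real t) *
    (bessel_moment (- of_real (ln t) - 2 * of_real pi * \<i> * of_real \<sigma>) - bessel_moment (- of_real (ln t)))"
proof -
  have t0: "t > 0" using t exp_gt_zero[of S] by linarith
  define w where "w e = of_real t - of_real \<sigma> * \<i> * complex_of_real e" for e :: real
  \<comment> \<open>\<open>Ln (- w e)\<close> jumps at \<open>e = 0\<close>. Off the cut it equals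
    \<open>Ln (w e) + \<sigma> \<i> \<pi>\<close>, which is continuous there, so \<open>G\<close>
    extends the values to \<open>e = 0\<close>.\<close>
  define G where "G e = 1 / (2 * of_real pi * \<i> * (- w e)) *
    (bessel_moment (\<i> * of_real pi - (Ln (w e) + of_real \<sigma> * \<i> * of_real pi))
      - bessel_moment (- \<i> * of_real pi - (Ln (w e) + of_real \<sigma> * \<i> * of_real pi)))" for e
  have wn: "norm (w e) \<ge> t" for e
    using complex_Re_le_cmod[of "w e"] by (simp add: w_def)
  have w0: "w e \<noteq> 0" for e using wn[of e] t0 by auto
  have ReLn: "Re (Ln (w e)) > S" for e
  proof -
    have "exp S < norm (w e)" using wn[of e] t by linarith
    then have "ln (exp S) < ln (norm (w e))" by (subst ln_less_cancel_iff) (use w0 in auto)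
    then show ?thesis using w0 by simp
  qed
  have val: "feynman_amplitude l q (w e) = G e" if e: "e > 0" for e
  proof -
    have Im: "Im (w e) = - \<sigma> * e" "Re (w e) = t" by (simp_all add: w_def)
    then have Im0: "Im (w e) \<noteq> 0" using e \<sigma> by auto
    have U: "w e \<in> - of_real ` {T..}" using Im0 by auto
    have nn: "- w e \<notin> \<real>\<^sub>\<le>\<^sub>0" using Im0 by (auto simp: complex_nonpos_Reals_iff)
    have Ln: "Ln (- w e) = Ln (w e) + of_real \<sigma> * \<i> * of_real pi"
      using Ln_minus[OF w0[of e]] \<sigma> e Im t0 by auto
    have Im_lt: "\<bar>Im (Ln (- w e))\<bar> < pi"
      using nn w0[of e] mpi_less_Im_Ln[of "- w e"] Im_Ln_less_pi[of "- w e"] by (auto simp: complex_nonpos_Reals_iff)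
    have Re_eq: "Re (Ln (- w e)) = Re (Ln (w e))" using w0[of e] by simp
    have "todd_integral (\<i> * of_real pi - Ln (- w e)) = bessel_moment (\<i> * of_real pi - Ln (- w e))"
      "todd_integral (- \<i> * of_real pi - Ln (- w e)) = bessel_moment (- \<i> * of_real pi - Ln (- w e))"
      using Im_lt ReLn[of e] by (intro todd_integral_eq_bessel_moment; simp add: Re_eq del: Re_Ln)+
    then show ?thesis
      using feynman_amplitude_eq[OF U] amplitude_eq_todd_integral[OF nn] by (simp only: G_def Ln minus_minus)
  qed
  have cont: "isCont bessel_moment z" if "Re z < - S" for z
    using holomorphic_on_imp_continuous_on[OF bessel_moment_holomorphic] that open_halfspace_Re_lt
    by (auto simp: continuous_on_eq_continuous_at)
  have "isCont G 0"
  proof -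
    have wc: "isCont w 0" unfolding w_def by (intro continuous_intros)
    have LnC: "isCont (\<lambda>e. Ln (w e)) 0"
    proof (rule isCont_o2[OF wc continuous_at_Ln])
      show "w 0 \<notin> \<real>\<^sub>\<le>\<^sub>0" using t0 by (simp add: w_def complex_nonpos_Reals_iff)
    qed
    have "isCont (\<lambda>e. bessel_moment (c - (Ln (w e) + of_real \<sigma> * \<i> * of_real pi))) 0" if "Re c = 0" for c
    proof (rule isCont_o2[OF _ cont])
      show "isCont (\<lambda>e. c - (Ln (w e) + of_real \<sigma> * \<i> * of_real pi)) 0"
        by (intro continuous_diff continuous_add continuous_const LnC)
      show "Re (c - (Ln (w 0) + of_real \<sigma> * \<i> * of_real pi)) < - S"
        using that ReLn[of 0] by (simp del: Re_Ln)
    qed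
    from this[of "\<i> * of_real pi"] this[of "- \<i> * of_real pi"] show ?thesis
      unfolding G_def using w0[of 0] wc by (intro continuous_intros) auto
  qed
  then have "(G \<longlongrightarrow> G 0) (at_right 0)"
    unfolding isCont_def by (rule filterlim_at_split[THEN iffD1, THEN conjunct2])
  then have "((\<lambda>e. feynman_amplitude l q (w e)) \<longlongrightarrow> G 0) (at_right 0)"
    by (rule Lim_transform_eventually) (auto simp: eventually_at_right_less val intro!: eventually_mono[OF eventually_at_right_less[of 0]])
  then have "feynman_boundary_value \<sigma> l q t = G 0"
    unfolding feynman_boundary_value_def w_def by (intro tendsto_Lim) auto
  also have "G 0 = of_real \<sigma> / (2 * of_real pi * \<i> * of_real t) *
    (bessel_moment (- of_real (ln t) - 2 * of_real pi * \<i> * of_real \<sigma>) - bessel_moment (- of_real (ln t)))"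
  proof -
    have w00: "w 0 = of_real t" by (simp add: w_def)
    have L: "Ln (of_real t) = of_real (ln t)" using t0 by (rule Ln_of_real)
    consider "\<sigma> = 1" | "\<sigma> = -1" using \<sigma> by auto
    then show ?thesis
    proof cases
      case 1
      have a: "\<i> * of_real pi - (of_real (ln t) + of_real \<sigma> * \<i> * of_real pi) = - of_real (ln t)"
        "- \<i> * of_real pi - (of_real (ln t) + of_real \<sigma> * \<i> * of_real pi)
          = - of_real (ln t) - 2 * of_real pi * \<i> * of_real \<sigma>"
        using 1 by (simp_all add: algebra_simps)
      then show ?thesis unfolding G_def w00 L a using 1 t0 by (simp add: divide_simps)
    next
      case 2
      have a: "\<i> * of_real pi - (of_real (ln t) + of_real \<sigma> * \<i> * of_real pi)
          = - of_real (ln t) - 2 * of_real pi * \<i> * of_real \<sigma>"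
        "- \<i> * of_real pi - (of_real (ln t) + of_real \<sigma> * \<i> * of_real pi) = - of_real (ln t)"
        using 2 by (simp_all add: algebra_simps)
      then show ?thesis unfolding G_def w00 L a using 2 t0 by (simp add: divide_simps)
    qed
  qed
  finally show ?thesis .
qed

section \<open>Logarithmic moments\<close>

definition log_moment :: "complex \<Rightarrow> complex" where
  "log_moment z = (LINT x|lborel. weight x * log_prod z x)"

lemma integrable_weight_power:
  "integrable lborel (\<lambda>x. weight x * (c - of_real x) ^ k :: complex)"
proof (rule Bochner_Integration.integrable_bound[OF _ _ AE_I2])
  show "integrable lborel (\<lambda>x. (1 + norm c) ^ k * ((1 + \<bar>x\<bar>) ^ k * (exp (1 * x) * macdonald (x - 0))))"
    by (intro integrable_mult_right integrable_power_macdonald) auto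
  fix x
  have "norm (c - of_real x) \<le> norm c + \<bar>x\<bar>" using norm_triangle_ineq4[of c "of_real x"] by simp
  also have "\<dots> \<le> (1 + norm c) * (1 + \<bar>x\<bar>)" by (simp add: algebra_simps)
  finally have "norm (c - of_real x) ^ k \<le> ((1 + norm c) * (1 + \<bar>x\<bar>)) ^ k"
    by (intro power_mono) auto
  then have "exp x * macdonald x * norm (c - of_real x) ^ k \<le> exp x * macdonald x * ((1 + norm c) * (1 + \<bar>x\<bar>)) ^ k"
    by (intro mult_left_mono) auto
  then show "norm (weight x * (c - of_real x) ^ k)
      \<le> norm ((1 + norm c) ^ k * ((1 + \<bar>x\<bar>) ^ k * (exp (1 * x) * macdonald (x - 0))))"
    by (simp add: norm_mult norm_power power_mult_distrib abs_mult mult_ac)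
qed measurable

text \<open>The factor \<open>exp x\<close> of the difference bound only raises the weight to
  \<open>exp (2 * x)\<close>, still integrable. At \<open>Re z = - ln t\<close> the error is a power
  of \<open>ln t\<close> over \<open>t\<close>, and the amplitude carries a further
  \<open>1 / t\<close>.\<close>

lemma bessel_moment_minus_log_moment:
  obtains C where "C > 0" "\<And>z. Re z \<le> - S \<Longrightarrow>
    integrable lborel (\<lambda>x. weight x * log_prod z x) \<Longrightarrow>
    norm (bessel_moment z - log_moment z) \<le> C * ((1 + norm z) ^ (l + 1) * exp (Re z))"
proof -
  obtain C where C: "C > 0" "\<And>z x. Re z \<le> - S \<Longrightarrow> norm (ext_prod z x - log_prod z x)
       \<le> C * ((1 + norm z) ^ (l + 1) * exp (Re z)) * ((1 + \<bar>x\<bar>) ^ (l + 1) * exp x * exp (exp (x / 2)))"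
    using ext_prod_bounds by metis
  define J where "J = (LINT x|lborel. (1 + \<bar>x\<bar>) ^ (l + 1) * (exp (2 * x) * macdonald (x - ln 4)))"
  have J: "J \<ge> 0" unfolding J_def by (rule Bochner_Integration.integral_nonneg) auto
  show ?thesis
  proof (rule that[of "C * (J + 1)"])
    show "C * (J + 1) > 0" using C J by simp
    fix z
    assume z: "Re z \<le> - S" and int: "integrable lborel (\<lambda>x. weight x * log_prod z x)"
    define B where "B = (1 + norm z) ^ (l + 1) * exp (Re z)"
    have B: "B \<ge> 0" by (simp add: B_def)
    have "bessel_moment z - log_moment z = (LINT x|lborel. weight x * ext_prod z x
       - weight x * log_prod z x)"
      unfolding bessel_moment_def log_moment_def
      by (rule Bochner_Integration.integral_diff[OF integrable_bessel_moment[OF z] int, symmetric])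
    also have "norm \<dots> \<le> (LINT x|lborel. C * B * ((1 + \<bar>x\<bar>) ^ (l + 1) * (exp (2 * x) * macdonald (x - ln 4))))"
    proof (rule Bochner_Integration.integral_norm_bound_integral)
      show "integrable lborel (\<lambda>x. C * B * ((1 + \<bar>x\<bar>) ^ (l + 1) * (exp (2 * x) * macdonald (x - ln 4))))"
        by (intro integrable_mult_right integrable_power_macdonald) auto
      fix x
      have "norm (weight x * ext_prod z x
         - weight x * log_prod z x)
        = exp x * macdonald x * norm (ext_prod z x - log_prod z x)"
        unfolding right_diff_distrib[symmetric] norm_mult[of "of_real _"] norm_of_real by simp
      also have "\<dots> \<le> exp x * macdonald x * (C * B * ((1 + \<bar>x\<bar>) ^ (l + 1) * exp x * exp (exp (x / 2))))"
        using C(2)[OF z, of x] unfolding B_def by (intro mult_left_mono) auto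
      also have "\<dots> = C * B * ((1 + \<bar>x\<bar>) ^ (l + 1) * (exp (2 * x) * macdonald x * exp (exp (x / 2))))"
      proof -
        have "exp (2 * x) = exp x * exp x" by (simp flip: exp_add)
        then show ?thesis by (simp only: mult_ac)
      qed
      also have "\<dots> \<le> C * B * ((1 + \<bar>x\<bar>) ^ (l + 1) * (exp (2 * x) * macdonald (x - ln 4)))"
        using C(1) B by (intro mult_left_mono macdonald_weight_le) auto
      finally show "norm (weight x * ext_prod z x
         - weight x * log_prod z x)
        \<le> C * B * ((1 + \<bar>x\<bar>) ^ (l + 1) * (exp (2 * x) * macdonald (x - ln 4)))" .
    qed (intro Bochner_Integration.integrable_diff integrable_bessel_moment[OF z] int)
    also have "\<dots> = C * B * J" unfolding J_def by (rule integral_mult_right_zero)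
    also have "\<dots> \<le> C * (J + 1) * B" using C(1) B by (simp add: algebra_simps)
    finally show "norm (bessel_moment z - log_moment z) \<le> C * (J + 1) * ((1 + norm z) ^ (l + 1) * exp (Re z))"
      by (simp only: B_def)
  qed
qed

end

lemma one_pm_not_nonpos_Ints:
  assumes "norm z < 1"
  shows "1 + z \<notin> \<int>\<^sub>\<le>\<^sub>0" "1 - z \<notin> (\<int>\<^sub>\<le>\<^sub>0 :: complex set)"
proof -
  have *: "1 + w \<notin> \<int>\<^sub>\<le>\<^sub>0" if "norm w < 1" for w :: complex
  proof
    assume "1 + w \<in> \<int>\<^sub>\<le>\<^sub>0"
    then obtain n where "1 + w = of_int n" "n \<le> 0" by (auto elim: nonpos_Ints_cases)
    then have "Re (1 + w) \<le> 0" by simp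
    then show False using that abs_Re_le_cmod[of w] by simp
  qed
  show "1 + z \<notin> \<int>\<^sub>\<le>\<^sub>0" "1 - z \<notin> (\<int>\<^sub>\<le>\<^sub>0 :: complex set)"
    using *[of z] *[of "- z"] assms by simp_all
qed

text \<open>The Mellin transform at \<open>s = 1 - w\<close>, first for real \<open>w\<close> and
  then by the identity theorem; each derivative in \<open>w\<close> brings down a factor
  \<open>c - x\<close>.\<close>

lemma higher_deriv_Gamma_square:
  "(deriv ^^ k) (\<lambda>w. exp (c * w) * (Gamma (1 - w))\<^sup>2) 0
    = (LINT x|lborel. of_real (exp x * macdonald x) * (c - of_real x) ^ k)" for c :: complex
proof -
  \<comment> \<open>Radius 1/2 keeps the rate \<open>1 - Re w\<close> between 1/2 and 3/2, the two
    rates that make up \<open>g\<close>.\<close>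
  define B where "B = ball (0::complex) (1/2)"
  define h where "h j w x = of_real (exp x * macdonald x) * (c - of_real x) ^ j * exp ((c - of_real x) * w)" for j w x
  define H where "H j w = (LINT x|lborel. h j w x)" for j w
  define g where "g j x = exp (norm c) * (1 + norm c) ^ j *
      ((1 + \<bar>x\<bar>) ^ j * (exp (1/2 * x) * macdonald (x - 0)) + (1 + \<bar>x\<bar>) ^ j * (exp (3/2 * x) * macdonald (x - 0)))" for j x
  have g_int: "integrable lborel (g j)" for j
    unfolding g_def
    by (intro integrable_mult_right Bochner_Integration.integrable_add integrable_power_macdonald) auto
  have h_le: "norm (h j w x) \<le> g j x" if "w \<in> B" for j w x
  proof -
    have w: "norm w < 1/2" using that by (simp add: B_def)
    then have rw: "\<bar>Re w\<bar> < 1/2" using abs_Re_le_cmod[of w] by linarith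
    have "norm (c - of_real x) \<le> norm c + \<bar>x\<bar>" using norm_triangle_ineq4[of c "of_real x"] by simp
    also have "\<dots> \<le> (1 + norm c) * (1 + \<bar>x\<bar>)" by (simp add: algebra_simps)
    finally have 1: "norm (c - of_real x) ^ j \<le> ((1 + norm c) * (1 + \<bar>x\<bar>)) ^ j"
      by (intro power_mono) auto
    have "Re (c * w) \<le> norm c * norm w" using complex_Re_le_cmod[of "c * w"] by (simp add: norm_mult)
    also have "\<dots> \<le> norm c * 1" using w by (intro mult_left_mono) auto
    finally have "Re ((c - of_real x) * w) \<le> norm c - x * Re w" by (simp add: left_diff_distrib)
    then have 2: "norm (exp ((c - of_real x) * w)) \<le> exp (norm c) * exp (- x * Re w)"
      by (simp flip: exp_add)
    have 3: "exp x * exp (- x * Re w) \<le> exp (1/2 * x) + exp (3/2 * x)"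
    proof (cases "x \<ge> 0")
      case True
      then have "x * (1 - Re w) \<le> x * (3/2)" using rw by (intro mult_left_mono) auto
      then have "exp x * exp (- x * Re w) \<le> exp (3/2 * x)" by (simp add: algebra_simps flip: exp_add)
      then show ?thesis by (smt (verit) exp_gt_zero)
    next
      case False
      then have "x * (1 - Re w) \<le> x * (1/2)" using rw by (intro mult_left_mono_neg) auto
      then have "exp x * exp (- x * Re w) \<le> exp (1/2 * x)" by (simp add: algebra_simps flip: exp_add)
      then show ?thesis by (smt (verit) exp_gt_zero)
    qed
    have "norm (h j w x) = exp x * macdonald x * norm (c - of_real x) ^ j * norm (exp ((c - of_real x) * w))"
      by (simp add: h_def norm_mult norm_power)
    also have "\<dots> \<le> exp x * macdonald x * ((1 + norm c) * (1 + \<bar>x\<bar>)) ^ j * (exp (norm c) * exp (- x * Re w))"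
      using 1 2 by (intro mult_mono) auto
    also have "\<dots> = exp (norm c) * (1 + norm c) ^ j * ((1 + \<bar>x\<bar>) ^ j * macdonald x * (exp x * exp (- x * Re w)))"
      by (simp only: power_mult_distrib mult_ac)
    also have "\<dots> \<le> exp (norm c) * (1 + norm c) ^ j * ((1 + \<bar>x\<bar>) ^ j * macdonald x * (exp (1/2 * x) + exp (3/2 * x)))"
      using 3 by (intro mult_left_mono) auto
    also have "\<dots> = g j x" by (simp add: g_def algebra_simps)
    finally show ?thesis .
  qed
  have h_int: "integrable lborel (h j w)" if "w \<in> B" for j w
  proof (rule Bochner_Integration.integrable_bound[OF g_int[of j] _ AE_I2])
    show "h j w \<in> borel_measurable lborel" unfolding h_def by measurable
    show "norm (h j w x) \<le> norm (g j x)" for x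
      using h_le[OF that, of j x] by simp
  qed
  have H': "(H j has_field_derivative H (Suc j) w) (at w)" if "w \<in> B" for j w
    unfolding H_def
  proof (rule has_field_derivative_integral(1)[where S = B and g = "g (Suc j)"])
    show "((\<lambda>w. h j w x) has_field_derivative h (Suc j) w x) (at w)" for w x
      unfolding h_def by (auto intro!: derivative_eq_intros simp: mult_ac)
  qed (use that h_int h_le g_int in \<open>auto simp: B_def\<close>)
  have iter: "w \<in> B \<Longrightarrow> (deriv ^^ j) (H 0) w = H j w" for j w
  proof (induction j arbitrary: w)
    case (Suc j)
    have "((deriv ^^ j) (H 0) has_field_derivative H (Suc j) w) (at w)"
      by (rule has_field_derivative_transform_within_open[OF H'[OF Suc.prems], of B])
         (use Suc in \<open>auto simp: B_def\<close>)
    then show ?case by (simp add: DERIV_imp_deriv)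
  qed simp
  define f where "f w = exp (c * w) * (Gamma (1 - w))\<^sup>2" for w :: complex
  have f_hol: "f holomorphic_on B"
  proof -
    have "1 - w \<notin> \<int>\<^sub>\<le>\<^sub>0" if "w \<in> B" for w
      using that by (intro one_pm_not_nonpos_Ints) (simp add: B_def)
    then show ?thesis unfolding f_def by (intro holomorphic_intros) auto
  qed
  have H_hol: "H 0 holomorphic_on B"
  proof -
    have "open B" by (simp add: B_def)
    then show ?thesis using H'[of _ 0] holomorphic_on_open by blast
  qed
  have real: "H 0 (of_real r) = f (of_real r)" if "\<bar>r\<bar> < 1/2" for r
  proof -
    have "h 0 (of_real r) x = exp (c * of_real r) * of_real (exp ((1 - r) * x) * macdonald x)" for x
    proof -
      have "exp ((1 - r) * x) = exp x * exp (- x * r)" by (simp add: algebra_simps flip: exp_add)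
      moreover have "exp ((c - of_real x) * of_real r) = exp (c * of_real r) * of_real (exp (- x * r))"
        by (simp add: algebra_simps exp_diff exp_minus exp_of_real[symmetric] divide_inverse)
      ultimately show ?thesis by (simp add: h_def mult_ac)
    qed
    then have "(\<lambda>x. h 0 (of_real r) x) = (\<lambda>x. exp (c * of_real r) * of_real (exp ((1 - r) * x) * macdonald x))"
      by (rule ext)
    then have "H 0 (of_real r) = exp (c * of_real r) * of_real (LINT x|lborel. exp ((1 - r) * x) * macdonald x)"
      unfolding H_def
      by (simp only: integral_mult_right_zero integral_complex_of_real)
    also have "(LINT x|lborel. exp ((1 - r) * x) * macdonald x) = (Gamma (1 - r))\<^sup>2"
      using that by (intro integrable_macdonald_Mellin) auto
    finally show ?thesis by (simp add: f_def flip: Gamma_complex_of_real)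
  qed
  have "H 0 w - f w = 0" if "w \<in> B" for w
  proof (rule analytic_continuation[of "\<lambda>w. H 0 w - f w" B "of_real ` {-1/2<..<1/2}" 0])
    show "(\<lambda>w. H 0 w - f w) holomorphic_on B" using f_hol H_hol by (intro holomorphic_on_diff)
    show "(0::complex) islimpt of_real ` {-1/2<..<1/2}"
      unfolding islimpt_approachable
    proof (intro allI impI)
      fix e :: real assume "e > 0"
      then show "\<exists>x'\<in>complex_of_real ` {-1/2<..<1/2}. x' \<noteq> 0 \<and> dist x' 0 < e"
        by (intro bexI[of _ "complex_of_real (min (1/4) (e / 2))"]) (auto simp: min_def)
    qed
  qed (use that real in \<open>auto simp: B_def\<close>)
  then have "(deriv ^^ k) f 0 = (deriv ^^ k) (H 0) 0"
    using f_hol H_hol by (intro higher_deriv_transform_within_open[of _ B]) (auto simp: B_def)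
  also have "\<dots> = H k 0" by (rule iter) (simp add: B_def)
  finally show ?thesis by (simp add: f_def[abs_def] H_def h_def)
qed

section \<open>Cohomology of products of projective lines\<close>

lemma cohom_const_0 [simp]: "cohom_const 0 = 0"
  by transfer (simp add: p1_rel_def)

lemma cohom_const_1 [simp]: "cohom_const 1 = 1"
  by transfer (simp add: p1_rel_def)

lemma cohom_const_add: "cohom_const (a + b) = cohom_const a + cohom_const b"
  by transfer (simp add: p1_rel_def single_add)

lemma cohom_const_uminus: "cohom_const (- a) = - cohom_const a"
  by transfer (simp add: p1_rel_def single_uminus)

lemma cohom_const_mult: "cohom_const (a * b) = cohom_const a * cohom_const b"
  by transfer (simp add: p1_rel_def mult_single)

lemma cohom_const_power: "cohom_const (a ^ k) = cohom_const a ^ k"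
  by (induction k) (simp_all add: cohom_const_mult)

lemma cohom_const_sum: "cohom_const (sum f A) = (\<Sum>x\<in>A. cohom_const (f x))"
  by (induction A rule: infinite_finite_induct) (simp_all add: cohom_const_add)

lemma cohom_const_prod: "cohom_const (prod f A) = (\<Prod>x\<in>A. cohom_const (f x))"
  by (induction A rule: infinite_finite_induct) (simp_all add: cohom_const_mult)

lemma integral_P1_power_add: "integral_P1_power n (a + b) = integral_P1_power n a + integral_P1_power n b"
  by transfer (simp add: lookup_add)

lemma integral_P1_power_0 [simp]: "integral_P1_power n 0 = 0"
  by transfer simp

lemma integral_P1_power_sum: "integral_P1_power n (sum f A) = (\<Sum>x\<in>A. integral_P1_power n (f x))"
  by (induction A rule: infinite_finite_induct) (simp_all add: integral_P1_power_add)

lemma integral_P1_power_const_mult: "integral_P1_power n (cohom_const c * a) = c * integral_P1_power n a"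
proof transfer
  fix n c and a :: "(nat \<Rightarrow>\<^sub>0 nat) \<Rightarrow>\<^sub>0 complex"
  show "Poly_Mapping.lookup (Poly_Mapping.single 0 c * a) (\<Sum>i=1..n. Poly_Mapping.single i 1)
    = c * Poly_Mapping.lookup a (\<Sum>i=1..n. Poly_Mapping.single i 1)"
    by (simp add: mult_map_scale_conv_mult[symmetric] Poly_Mapping.map.rep_eq when_def)
qed

lemma prod_point_class:
  "finite A \<Longrightarrow> (\<Prod>i\<in>A. point_class i) = abs_p1_cohom (Poly_Mapping.single (\<Sum>i\<in>A. Poly_Mapping.single i 1) 1)"
proof (induction A rule: finite_induct)
  case empty
  show ?case by (simp add: one_p1_cohom_def)
next
  case (insert i A)
  then show ?case
    by (simp add: point_class_def times_p1_cohom.abs_eq mult_single)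
qed

text \<open>Different subsets give different squarefree monomials, and only the full set gives the
  top one.\<close>

lemma integral_prod_point_class:
  assumes "A \<subseteq> {1..n}"
  shows "integral_P1_power n (\<Prod>i\<in>A. point_class i) = (if A = {1..n} then 1 else 0)"
proof -
  have fin: "finite A" using assms finite_subset by blast
  have lk: "Poly_Mapping.lookup (\<Sum>i\<in>B. Poly_Mapping.single i (1::nat)) j = (if j \<in> B then 1 else 0)" if "finite B" for B and j :: nat
    using that by (simp add: lookup_sum lookup_single when_def sum.delta)
  have "(\<Sum>i\<in>A. Poly_Mapping.single i (1::nat)) = (\<Sum>i=1..n. Poly_Mapping.single i 1) \<longleftrightarrow> A = {1..n}"
  proof
    assume eq: "(\<Sum>i\<in>A. Poly_Mapping.single i (1::nat)) = (\<Sum>i=1..n. Poly_Mapping.single i 1)"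
    show "A = {1..n}"
    proof (rule set_eqI)
      fix j
      show "j \<in> A \<longleftrightarrow> j \<in> {1..n}"
      proof -
        have "(if j \<in> A then 1 else 0) = (if j \<in> {1..n} then 1 else (0::nat))"
          using arg_cong[OF eq, of "\<lambda>m. Poly_Mapping.lookup m j"]
          unfolding lk[OF fin] lk[OF finite_atLeastAtMost] .
        then show ?thesis by (metis zero_neq_one)
      qed
    qed
  qed simp
  then show ?thesis
    by (simp add: prod_point_class[OF fin] integral_P1_power.abs_eq lookup_single when_def)
qed

text \<open>Expanding over subsets, only the term that takes the linear part from every factor
  reaches the top monomial.\<close>

lemma integral_prod_linear:
  "integral_P1_power n (\<Prod>i=1..n. 1 + point_class i * cohom_const (b i)) = (\<Prod>i=1..n. b i)"
proof -
  have "(\<Prod>i=1..n. 1 + point_class i * cohom_const (b i))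
      = (\<Prod>i=1..n. cohom_const (b i) * point_class i + 1)"
    by (simp add: add.commute mult.commute)
  also have "\<dots> = (\<Sum>B\<in>Pow {1..n}. (\<Prod>i\<in>B. cohom_const (b i) * point_class i) * (\<Prod>i\<in>{1..n} - B. 1))"
    by (rule prod_add) simp
  also have "\<dots> = (\<Sum>B\<in>Pow {1..n}. cohom_const (\<Prod>i\<in>B. b i) * (\<Prod>i\<in>B. point_class i))"
    by (simp add: prod.distrib cohom_const_prod)
  finally have "integral_P1_power n (\<Prod>i=1..n. 1 + point_class i * cohom_const (b i))
      = (\<Sum>B\<in>Pow {1..n}. (\<Prod>i\<in>B. b i) * (if B = {1..n} then 1 else 0))"
    by (simp add: integral_P1_power_sum integral_P1_power_const_mult integral_prod_point_class)
  also have "\<dots> = (\<Sum>B\<in>Pow {1..n}. if B = {1..n} then (\<Prod>i=1..n. b i) else 0)"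
    by (intro sum.cong) auto
  also have "\<dots> = (\<Prod>i=1..n. b i)" by (subst sum.delta) auto
  finally show ?thesis .
qed

section \<open>Taylor expansions at nilpotent classes\<close>

definition linear_class :: "nat \<Rightarrow> (nat \<Rightarrow> complex) \<Rightarrow> p1_cohom" where
  "linear_class n b = (\<Sum>i=1..n. point_class i * cohom_const (b i))"

text \<open>The exponential of a sum of square-zero classes is the product of their exponentials
  \<open>1 + b\<^sub>i p\<^sub>i\<close>. Nilpotency is carried along in the induction because it
  drops the top power of the old class.\<close>

lemma linear_class_exp:
  "linear_class n b ^ Suc n = 0 \<and>
   (\<Sum>k\<le>n. cohom_const (1 / fact k) * linear_class n b ^ k) = (\<Prod>i=1..n. 1 + point_class i * cohom_const (b i))"
proof (induction n)
  case 0
  then show ?case by (simp add: linear_class_def)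
next
  case (Suc n)
  define c where "c = linear_class n b"
  define u where "u = point_class (Suc n) * cohom_const (b (Suc n))"
  have u2: "u * u = 0"
  proof -
    have "u * u = point_class (Suc n) ^ 2 * (cohom_const (b (Suc n)) * cohom_const (b (Suc n)))"
      by (simp only: u_def power2_eq_square mult_ac)
    then show ?thesis by (simp only: point_class_square mult_zero_left)
  qed
  have lin: "linear_class (Suc n) b = c + u" by (simp add: linear_class_def c_def u_def)
  \<comment> \<open>The binomial theorem cut off after the linear term in \<open>u\<close>, since
    \<open>u * u = 0\<close>.\<close>
  have pw: "(c + u) ^ Suc k = c ^ Suc k + of_nat (Suc k) * c ^ k * u" for k
  proof (induction k)
    case (Suc k)
    have "(c + u) ^ Suc (Suc k) = (c + u) * (c ^ Suc k + of_nat (Suc k) * c ^ k * u)"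
      using Suc by simp
    also have "\<dots> = c ^ Suc (Suc k) + of_nat (Suc (Suc k)) * c ^ Suc k * u + of_nat (Suc k) * c ^ k * (u * u)"
      by (simp add: algebra_simps)
    finally show ?case using u2 by simp
  qed simp
  have cn: "c ^ Suc n = 0" and ce: "(\<Sum>k\<le>n. cohom_const (1 / fact k) * c ^ k) = (\<Prod>i=1..n. 1 + point_class i * cohom_const (b i))"
    using Suc by (simp_all add: c_def)
  have 1: "linear_class (Suc n) b ^ Suc (Suc n) = 0"
    unfolding lin pw using cn by simp
  have nat: "cohom_const (1 / fact (Suc k)) * of_nat (Suc k) = cohom_const (1 / fact k)" for k
  proof -
    have of_nat: "(of_nat m :: p1_cohom) = cohom_const (of_nat m)" for m
      by (induction m) (simp_all add: cohom_const_add)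
    have "1 / fact (Suc k) * of_nat (Suc k) = (1 / fact k :: complex)"
      by (simp add: divide_simps del: of_nat_Suc)
    then show ?thesis unfolding of_nat cohom_const_mult[symmetric] by (simp only:)
  qed
  have "(\<Sum>k\<le>Suc n. cohom_const (1 / fact k) * (c + u) ^ k)
      = 1 + (\<Sum>k\<le>n. cohom_const (1 / fact (Suc k)) * (c + u) ^ Suc k)"
    by (subst sum.atMost_Suc_shift) simp
  also have "\<dots> = 1 + (\<Sum>k\<le>n. cohom_const (1 / fact (Suc k)) * c ^ Suc k + (cohom_const (1 / fact (Suc k)) * of_nat (Suc k)) * c ^ k * u)"
    by (simp only: pw distrib_left mult.assoc)
  also have "\<dots> = (1 + (\<Sum>k\<le>n. cohom_const (1 / fact (Suc k)) * c ^ Suc k)) + (\<Sum>k\<le>n. cohom_const (1 / fact k) * c ^ k) * u"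
    unfolding nat by (simp add: sum.distrib sum_distrib_right add.assoc)
  also have "1 + (\<Sum>k\<le>n. cohom_const (1 / fact (Suc k)) * c ^ Suc k) = (\<Sum>k\<le>Suc n. cohom_const (1 / fact k) * c ^ k)"
    by (subst sum.atMost_Suc_shift) simp
  also have "\<dots> = (\<Sum>k\<le>n. cohom_const (1 / fact k) * c ^ k)" using cn by simp
  finally have "(\<Sum>k\<le>Suc n. cohom_const (1 / fact k) * (c + u) ^ k) = (\<Prod>i=1..n. 1 + point_class i * cohom_const (b i)) * (1 + u)"
    unfolding ce by (simp add: distrib_left)
  then show ?case using 1 by (simp add: lin u_def)
qed

lemma taylor_at_nilpotent:
  assumes "a ^ Suc N = 0"
  shows "taylor_at f a = (\<Sum>k\<le>N. cohom_const ((deriv ^^ k) f 0 / fact k) * a ^ k)"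
  unfolding taylor_at_def
proof (rule Sum_any.expand_superset)
  have nilk: "a ^ k = 0" if "k > N" for k
    using assms that by (metis le_add_diff_inverse less_eq_Suc_le mult_zero_left power_add)
  have "cohom_const ((deriv ^^ k) f 0 / fact k) * a ^ k = 0" if "\<not> k \<le> N" for k
    using nilk[of k] that by simp
  then show "{k. cohom_const ((deriv ^^ k) f 0 / fact k) * a ^ k \<noteq> 0} \<subseteq> {..N}"
    by blast
qed simp

text \<open>Leibniz' rule makes the Taylor coefficients multiply as a Cauchy product; the pairs with
  \<open>i + j > N\<close> are killed by nilpotency.\<close>

lemma taylor_at_mult:
  assumes nil: "a ^ Suc N = 0" and hol: "f holomorphic_on A" "g holomorphic_on A" "open A" "0 \<in> A"
  shows "taylor_at f a * taylor_at g a = taylor_at (\<lambda>z. f z * g z) a"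
proof -
  define F where "F k = (deriv ^^ k) f 0 / fact k" for k
  define G where "G k = (deriv ^^ k) g 0 / fact k" for k
  have nilk: "a ^ k = 0" if "k > N" for k
    using nil that by (metis le_add_diff_inverse less_eq_Suc_le mult_zero_left power_add)
  have co: "(deriv ^^ k) (\<lambda>z. f z * g z) 0 / fact k = (\<Sum>i\<le>k. F i * G (k - i))" for k
  proof -
    have "(deriv ^^ k) (\<lambda>z. f z * g z) 0 / fact k
       = (\<Sum>i\<le>k. of_nat (k choose i) * (deriv ^^ i) f 0 * (deriv ^^ (k - i)) g 0 / fact k)"
      by (subst higher_deriv_mult[OF hol]) (simp add: sum_divide_distrib atMost_atLeast0)
    also have "\<dots> = (\<Sum>i\<le>k. F i * G (k - i))"
      by (intro sum.cong) (simp_all add: F_def G_def binomial_fact)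
    finally show ?thesis .
  qed
  have "taylor_at f a * taylor_at g a = (\<Sum>i\<le>N. \<Sum>j\<le>N. cohom_const (F i * G j) * a ^ (i + j))"
    unfolding taylor_at_nilpotent[OF nil] F_def[symmetric] G_def[symmetric] sum_product
    by (simp add: cohom_const_mult power_add mult_ac)
  also have "\<dots> = (\<Sum>(i, j)\<in>{..N} \<times> {..N}. cohom_const (F i * G j) * a ^ (i + j))"
    by (simp add: sum.cartesian_product)
  also have "\<dots> = (\<Sum>(i, j)\<in>{(i, j). i + j \<le> N}. cohom_const (F i * G j) * a ^ (i + j))"
  proof (rule sum.mono_neutral_right)
    show "\<forall>x\<in>{..N} \<times> {..N} - {(i, j). i + j \<le> N}. (case x of (i, j) \<Rightarrow> cohom_const (F i * G j) * a ^ (i + j)) = 0"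
    proof
      fix x assume x: "x \<in> {..N} \<times> {..N} - {(i, j). i + j \<le> N}"
      obtain i j where ij: "x = (i, j)" by (cases x)
      then have "N < i + j" using x by auto
      then show "(case x of (i, j) \<Rightarrow> cohom_const (F i * G j) * a ^ (i + j)) = 0"
        using nilk[of "i + j"] by (simp add: ij)
    qed
  qed auto
  also have "\<dots> = (\<Sum>k\<le>N. \<Sum>i\<le>k. cohom_const (F i * G (k - i)) * a ^ (i + (k - i)))"
    by (rule sum.triangle_reindex_eq)
  also have "\<dots> = (\<Sum>k\<le>N. cohom_const (\<Sum>i\<le>k. F i * G (k - i)) * a ^ k)"
    by (simp add: cohom_const_sum sum_distrib_right)
  also have "\<dots> = taylor_at (\<lambda>z. f z * g z) a"
    unfolding taylor_at_nilpotent[OF nil] co ..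
  finally show ?thesis .
qed

lemma higher_deriv_exp_linear: "(deriv ^^ k) (\<lambda>z. exp (s * z)) w = s ^ k * exp (s * w)" for s w :: complex
proof (induction k arbitrary: w)
  case (Suc k)
  have "(deriv ^^ k) (\<lambda>z. exp (s * z)) = (\<lambda>w. s ^ k * exp (s * w))" using Suc by auto
  moreover have "((\<lambda>w. s ^ k * exp (s * w)) has_field_derivative s ^ Suc k * exp (s * w)) (at w)"
    by (auto intro!: derivative_eq_intros)
  ultimately show ?case by (simp add: DERIV_imp_deriv)
qed simp

lemma taylor_at_exp_linear: "taylor_at exp (linear_class n b) = (\<Prod>i=1..n. 1 + point_class i * cohom_const (b i))"
proof -
  have "(deriv ^^ k) exp (0::complex) = 1" for k
    using higher_deriv_exp_linear[of k 1 0] by simp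
  then show ?thesis
    using linear_class_exp[of n b] taylor_at_nilpotent[of "linear_class n b" n exp] by simp
qed

lemma c1_F_eq_linear_class: "c1_F l = linear_class (l + 1) (\<lambda>_. 1)"
  by (simp add: c1_F_def linear_class_def)

lemma c1_F_nilpotent: "c1_F l ^ Suc (l + 1) = 0"
  unfolding c1_F_eq_linear_class using linear_class_exp by blast

lemma taylor_at_c1_F_id: "taylor_at (\<lambda>z. z) (c1_F l) = c1_F l"
proof -
  have "taylor_at (\<lambda>z. z) (c1_F l) = (\<Sum>k\<le>l + 1. if k = 1 then c1_F l else 0)"
    unfolding taylor_at_nilpotent[OF c1_F_nilpotent] by (intro sum.cong) auto
  then show ?thesis by simp
qed

lemma taylor_at_exp_c1_F: "taylor_at exp (cohom_const s * c1_F l) = taylor_at (\<lambda>z. exp (s * z)) (c1_F l)"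
proof -
  have nil: "(cohom_const s * c1_F l) ^ Suc (l + 1) = 0"
    by (simp only: power_mult_distrib c1_F_nilpotent mult_zero_right)
  have "(deriv ^^ k) exp (0::complex) = 1" for k
    using higher_deriv_exp_linear[of k 1 0] by simp
  then show ?thesis
    unfolding taylor_at_nilpotent[OF nil] taylor_at_nilpotent[OF c1_F_nilpotent] higher_deriv_exp_linear
    by (simp add: power_mult_distrib cohom_const_power[symmetric] mult.assoc[symmetric] cohom_const_mult[symmetric] del: sum.atMost_Suc)
qed

text \<open>Since \<open>p\<^sub>i\<^sup>2 = 0\<close>, only \<open>\<Gamma>(1) = 1\<close> and
  \<open>\<Gamma>'(1) = - \<gamma>\<close> survive, and squaring doubles the linear
  coefficient.\<close>

lemma taylor_at_Gamma_point_class: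
  "(taylor_at (\<lambda>z. Gamma (1 + z)) (point_class i))\<^sup>2 = 1 + point_class i * cohom_const (- 2 * of_real euler_mascheroni)"
proof -
  have nil: "point_class i ^ Suc 1 = 0" using point_class_square[of i] by (simp add: power2_eq_square)
  have "((\<lambda>z. Gamma (1 + z)) has_field_derivative - euler_mascheroni) (at (0::complex))"
    by (rule derivative_eq_intros refl | simp)+
  then have "deriv (\<lambda>z. Gamma (1 + z)) (0::complex) = - euler_mascheroni" by (rule DERIV_imp_deriv)
  then have "taylor_at (\<lambda>z. Gamma (1 + z)) (point_class i) = 1 + cohom_const (- euler_mascheroni) * point_class i"
    by (simp add: taylor_at_nilpotent[OF nil])
  then have "(taylor_at (\<lambda>z. Gamma (1 + z)) (point_class i))\<^sup>2
     = 1 + (cohom_const (- euler_mascheroni) + cohom_const (- euler_mascheroni)) * point_class i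
       + cohom_const (- euler_mascheroni) ^ 2 * point_class i ^ 2"
    by (simp add: power2_eq_square algebra_simps)
  then show ?thesis
    unfolding point_class_square cohom_const_add[symmetric] by (simp add: mult.commute)
qed

lemma point_class_linear_mult:
  "(1 + point_class i * cohom_const b) * (1 + point_class i * cohom_const c) = 1 + point_class i * cohom_const (b + c)"
proof -
  have "(1 + point_class i * cohom_const b) * (1 + point_class i * cohom_const c)
    = 1 + point_class i * (cohom_const b + cohom_const c) + point_class i ^ 2 * (cohom_const b * cohom_const c)"
    by (simp add: power2_eq_square algebra_simps)
  then show ?thesis unfolding point_class_square cohom_const_add by simp
qed

section \<open>Comparison of the two sides\<close>

text \<open>The reflection formula replaces \<open>z / Gamma (1 + z)\<close> by
  \<open>Gamma (1 - z) * sin (pi * z) / pi\<close>, and the exponential in front turns the sine into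
  a difference. The term \<open>exp (0 * z)\<close> presents the second summand as the case
  \<open>c = 0\<close> of the same family.\<close>

lemma Gamma_quotient_eq:
  assumes z: "norm z < 1" and \<sigma>: "\<sigma> \<in> {1, -1}"
  shows "exp (of_real (\<sigma> * pi) * \<i> * z) * (1 / Gamma (1 + z)) * Gamma (1 - z) * z
    = of_real \<sigma> / (2 * of_real pi * \<i>) *
      (exp (2 * of_real pi * \<i> * of_real \<sigma> * z) * (Gamma (1 - z))\<^sup>2 - exp (0 * z) * (Gamma (1 - z))\<^sup>2)"
proof (cases "z = 0")
  case False
  have "1 + z \<notin> \<int>\<^sub>\<le>\<^sub>0" by (rule one_pm_not_nonpos_Ints[OF z])
  then have G: "Gamma (1 + z) \<noteq> 0" by (simp add: Gamma_eq_zero_iff)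
  have "z \<notin> \<int>\<^sub>\<le>\<^sub>0"
  proof
    assume "z \<in> \<int>\<^sub>\<le>\<^sub>0"
    then obtain n where n: "z = of_int n" by (auto elim: nonpos_Ints_cases)
    then have "\<bar>n\<bar> < 1" using z by simp
    then show False using n False by simp
  qed
  then have "Gamma (1 + z) = z * Gamma z" using Gamma_plus1[of z] by (simp add: add.commute)
  then have refl: "Gamma (1 + z) * Gamma (1 - z) = z * (of_real pi / sin (of_real pi * z))"
    using Gamma_reflection_complex[of z] by (simp add: mult.assoc)
  have G': "Gamma (1 - z) \<noteq> 0"
    using one_pm_not_nonpos_Ints(2)[OF z] by (simp add: Gamma_eq_zero_iff)
  have s0: "sin (of_real pi * z) \<noteq> 0"
    using refl G G' by (metis div_0 divide_eq_0_iff mult_eq_0_iff)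
  have key: "z / Gamma (1 + z) = Gamma (1 - z) * sin (of_real pi * z) / of_real pi"
    using refl G s0 by (simp add: field_simps)
  define E where "E = exp (\<i> * (of_real pi * z))"
  have E: "E \<noteq> 0" by (simp add: E_def)
  have sin: "sin (of_real pi * z) = (E - inverse E) / (2 * \<i>)"
    by (simp add: sin_exp_eq E_def exp_minus)
  have "exp (of_real (\<sigma> * pi) * \<i> * z) * (1 / Gamma (1 + z)) * Gamma (1 - z) * z
    = exp (of_real (\<sigma> * pi) * \<i> * z) * Gamma (1 - z) * (z / Gamma (1 + z))" by simp
  also have "\<dots> = exp (of_real (\<sigma> * pi) * \<i> * z) * (E - inverse E) * (Gamma (1 - z))\<^sup>2 / (2 * of_real pi * \<i>)"
    unfolding key sin
    by (simp only: times_divide_eq_right times_divide_eq_left divide_divide_eq_left power2_eq_square mult_ac)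
  also have "exp (of_real (\<sigma> * pi) * \<i> * z) * (E - inverse E)
      = of_real \<sigma> * (exp (2 * of_real pi * \<i> * of_real \<sigma> * z) - 1)"
  proof -
    have E2: "exp (2 * of_real pi * \<i> * z) = E * E"
      by (simp add: E_def algebra_simps flip: exp_add)
    consider "\<sigma> = 1" | "\<sigma> = -1" using \<sigma> by auto
    then show ?thesis
    proof cases
      case 1
      have "exp (of_real (\<sigma> * pi) * \<i> * z) = E" using 1 by (simp add: E_def mult_ac)
      moreover have "exp (2 * of_real pi * \<i> * of_real \<sigma> * z) = E * E" using 1 E2 by simp
      ultimately show ?thesis using 1 E by (simp add: algebra_simps)
    next
      case 2
      have "exp (of_real (\<sigma> * pi) * \<i> * z) = inverse E" using 2 by (simp add: E_def mult_ac flip: exp_minus)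
      moreover have "exp (2 * of_real pi * \<i> * of_real \<sigma> * z) = inverse (E * E)"
        using 2 by (simp flip: E2 exp_minus)
      ultimately show ?thesis using 2 E by (simp add: algebra_simps)
    qed
  qed
  also have "of_real \<sigma> * (exp (2 * of_real pi * \<i> * of_real \<sigma> * z) - 1) * (Gamma (1 - z))\<^sup>2 / (2 * of_real pi * \<i>)
     = of_real \<sigma> / (2 * of_real pi * \<i>) *
      (exp (2 * of_real pi * \<i> * of_real \<sigma> * z) * (Gamma (1 - z))\<^sup>2 - exp (0 * z) * (Gamma (1 - z))\<^sup>2)"
    by (simp add: left_diff_distrib)
  finally show ?thesis .
qed simp

context banana begin

definition log_coeff :: "real \<Rightarrow> nat \<Rightarrow> complex" where
  "log_coeff t i = of_real (- ln (q i / t)) - 2 * of_real euler_mascheroni"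

definition total_class :: "real \<Rightarrow> p1_cohom" where
  "total_class t = (\<Prod>i=1..l + 1. 1 + point_class i * cohom_const (log_coeff t i))"

definition pairing :: "real \<Rightarrow> nat \<Rightarrow> complex" where
  "pairing t k = integral_P1_power (l + 1) (total_class t * c1_F l ^ k)"

text \<open>The bridge between the two sides: the pairings with powers of \<open>c1_F l\<close> are
  the coefficients of a polynomial in \<open>X\<close>, and \<open>X = c - x\<close> integrated
  against the weight gives the logarithmic moments.\<close>

lemma prod_log_coeff_add:
  "(\<Prod>i=1..l + 1. log_coeff t i + X) = (\<Sum>k\<le>l + 1. pairing t k / fact k * X ^ k)"
proof -
  have lin: "linear_class (l + 1) (\<lambda>_. X) = cohom_const X * c1_F l"
    by (simp only: linear_class_def c1_F_def sum_distrib_left mult.commute)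
  have pow: "cohom_const (1 / fact k) * linear_class (l + 1) (\<lambda>_. X) ^ k = cohom_const (X ^ k / fact k) * c1_F l ^ k" for k
  proof -
    have "cohom_const (X ^ k / fact k) = cohom_const (1 / fact k) * cohom_const X ^ k"
      by (simp flip: cohom_const_mult cohom_const_power)
    then show ?thesis by (simp only: lin power_mult_distrib mult.assoc)
  qed
  have "(\<Prod>i=1..l + 1. log_coeff t i + X)
      = integral_P1_power (l + 1) (\<Prod>i=1..l + 1. 1 + point_class i * cohom_const (log_coeff t i + X))"
    by (rule integral_prod_linear[symmetric])
  also have "(\<Prod>i=1..l + 1. 1 + point_class i * cohom_const (log_coeff t i + X))
      = total_class t * (\<Prod>i=1..l + 1. 1 + point_class i * cohom_const X)"
    unfolding total_class_def prod.distrib[symmetric] point_class_linear_mult ..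
  also have "(\<Prod>i=1..l + 1. 1 + point_class i * cohom_const X)
      = (\<Sum>k\<le>l + 1. cohom_const (X ^ k / fact k) * c1_F l ^ k)"
    using linear_class_exp[of "l + 1" "\<lambda>_. X", THEN conjunct2, symmetric] unfolding pow .
  also have "total_class t * \<dots> = (\<Sum>k\<le>l + 1. cohom_const (X ^ k / fact k) * (total_class t * c1_F l ^ k))"
    by (simp only: sum_distrib_left mult_ac)
  also have "integral_P1_power (l + 1) \<dots> = (\<Sum>k\<le>l + 1. pairing t k / fact k * X ^ k)"
    unfolding integral_P1_power_sum integral_P1_power_const_mult pairing_def
    by (intro sum.cong) (simp_all add: mult.commute)
  finally show ?thesis .
qed

lemma log_moment_integrand:
  assumes t: "t > 0"
  shows "weight x * log_prod (- of_real (ln t) - c) x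
    = (\<Sum>k\<le>l + 1. pairing t k / fact k * (weight x * (c - of_real x) ^ k))"
proof -
  have "log_factor (- of_real (ln t) - c) x i = log_coeff t i + (c - of_real x)" if "i \<in> {1..l + 1}" for i
    using q_pos[OF that] t by (simp add: log_factor_def log_coeff_def ln_div)
  then have "log_prod (- of_real (ln t) - c) x = (\<Prod>i=1..l + 1. log_coeff t i + (c - of_real x))"
    by (intro prod.cong) auto
  then show ?thesis unfolding prod_log_coeff_add by (simp only: sum_distrib_left mult_ac)
qed

lemma integrable_log_moment:
  assumes "t > 0"
  shows "integrable lborel (\<lambda>x. weight x * log_prod (- of_real (ln t) - c) x)"
  unfolding log_moment_integrand[OF assms]
  by (intro Bochner_Integration.integrable_sum integrable_mult_right integrable_weight_power)

lemma log_moment_eq: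
  assumes "t > 0"
  shows "log_moment (- of_real (ln t) - c)
    = (\<Sum>k\<le>l + 1. pairing t k / fact k * (deriv ^^ k) (\<lambda>w. exp (c * w) * (Gamma (1 - w))\<^sup>2) 0)"
  unfolding log_moment_def log_moment_integrand[OF assms] higher_deriv_Gamma_square
  by (subst Bochner_Integration.integral_sum)
     (intro integrable_mult_right integrable_weight_power, simp only: integral_mult_right_zero)

definition leading_term :: "real \<Rightarrow> real \<Rightarrow> complex" where
  "leading_term \<sigma> t = integral_F l
     (taylor_at exp (- p_log l q t) * Gamma_class_F l
      * taylor_at exp (cohom_const (complex_of_real (\<sigma> * pi) * \<i>) * c1_F l)
      * taylor_at (\<lambda>z. Gamma (1 - z)) (c1_F l))"

text \<open>Both sides are sums of \<open>pairing t k / fact k\<close> times \<open>k\<close>-th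
  derivatives at 0, and \<open>Gamma_quotient_eq\<close> identifies the functions being
  differentiated.\<close>

lemma leading_term_eq:
  assumes t: "t > 0" and \<sigma>: "\<sigma> \<in> {1, -1}"
  shows "leading_term \<sigma> t
    = of_real \<sigma> / (2 * of_real pi * \<i>) *
      (log_moment (- of_real (ln t) - 2 * of_real pi * \<i> * of_real \<sigma>) - log_moment (- of_real (ln t)))"
proof -
  define B where "B = ball (0::complex) 1"
  have B: "open B" "0 \<in> B" by (simp_all add: B_def)
  have nz: "1 + z \<notin> \<int>\<^sub>\<le>\<^sub>0" "1 - z \<notin> (\<int>\<^sub>\<le>\<^sub>0 :: complex set)" if "z \<in> B" for z
    using one_pm_not_nonpos_Ints[of z] that by (auto simp: B_def)
  define s where "s = complex_of_real (\<sigma> * pi) * \<i>"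
  define c where "c = 2 * of_real pi * \<i> * complex_of_real \<sigma>"
  have h1: "(\<lambda>z. 1 / Gamma (1 + z)) holomorphic_on B"
    using nz by (intro holomorphic_intros) (auto simp: Gamma_eq_zero_iff)
  have h2: "(\<lambda>z. exp (s * z)) holomorphic_on B" by (intro holomorphic_intros)
  have h3: "(\<lambda>z. Gamma (1 - z)) holomorphic_on B"
    using nz by (intro holomorphic_intros) auto
  have h4: "(\<lambda>z. z) holomorphic_on B" by (intro holomorphic_intros)
  \<comment> \<open>The last factor \<open>z\<close> stands for the Poincare dual class by which
    \<open>integral_F\<close> multiplies.\<close>
  define g where "g z = exp (s * z) * (1 / Gamma (1 + z)) * Gamma (1 - z) * z" for z
  define f where "f c w = exp (c * w) * (Gamma (1 - w))\<^sup>2" for c w :: complex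
  have fh: "f c holomorphic_on B" for c
    unfolding f_def using nz by (intro holomorphic_intros) auto
  have gh: "g holomorphic_on B"
    unfolding g_def by (intro holomorphic_on_mult h1 h2 h3 h4)
  note nil = c1_F_nilpotent[of l]
  have tg: "taylor_at (\<lambda>z. 1 / Gamma (1 + z)) (c1_F l) * taylor_at exp (cohom_const s * c1_F l)
      * taylor_at (\<lambda>z. Gamma (1 - z)) (c1_F l) * c1_F l = taylor_at g (c1_F l)"
  proof -
    have "taylor_at exp (cohom_const s * c1_F l) * taylor_at (\<lambda>z. 1 / Gamma (1 + z)) (c1_F l)
        * taylor_at (\<lambda>z. Gamma (1 - z)) (c1_F l) * taylor_at (\<lambda>z. z) (c1_F l) = taylor_at g (c1_F l)"
      unfolding taylor_at_exp_c1_F g_def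
      by (subst taylor_at_mult[OF nil h2 h1 B], subst taylor_at_mult[OF nil holomorphic_on_mult[OF h2 h1] h3 B],
          subst taylor_at_mult[OF nil holomorphic_on_mult[OF holomorphic_on_mult[OF h2 h1] h3] h4 B]) (rule refl)
    then show ?thesis unfolding taylor_at_c1_F_id by (simp only: mult_ac)
  qed
  have tot: "taylor_at exp (- p_log l q t) * (\<Prod>i=1..l + 1. (taylor_at (\<lambda>z. Gamma (1 + z)) (point_class i))\<^sup>2) = total_class t"
  proof -
    have "- p_log l q t = linear_class (l + 1) (\<lambda>i. of_real (- ln (q i / t)))"
      by (simp only: p_log_def linear_class_def sum_negf[symmetric] of_real_minus cohom_const_uminus mult_minus_right)
    then have "taylor_at exp (- p_log l q t) = (\<Prod>i=1..l + 1. 1 + point_class i * cohom_const (of_real (- ln (q i / t))))"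
      by (simp only: taylor_at_exp_linear)
    moreover have "log_coeff t i = of_real (- ln (q i / t)) + (- 2 * of_real euler_mascheroni)" for i
      by (simp add: log_coeff_def)
    ultimately show ?thesis
      by (simp only: taylor_at_Gamma_point_class total_class_def prod.distrib[symmetric] point_class_linear_mult)
  qed
  have "leading_term \<sigma> t = integral_P1_power (l + 1) ((taylor_at exp (- p_log l q t) * (\<Prod>i=1..l + 1. (taylor_at (\<lambda>z. Gamma (1 + z)) (point_class i))\<^sup>2))
       * (taylor_at (\<lambda>z. 1 / Gamma (1 + z)) (c1_F l) * taylor_at exp (cohom_const s * c1_F l)
          * taylor_at (\<lambda>z. Gamma (1 - z)) (c1_F l) * c1_F l))"
    unfolding leading_term_def integral_F_def Gamma_class_F_def s_def c1_F_def[symmetric] by (simp only: mult_ac)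
  also have "\<dots> = integral_P1_power (l + 1) (total_class t * taylor_at g (c1_F l))"
    by (simp only: tg tot)
  also have "total_class t * taylor_at g (c1_F l)
      = (\<Sum>k\<le>l + 1. cohom_const ((deriv ^^ k) g 0 / fact k) * (total_class t * c1_F l ^ k))"
    unfolding taylor_at_nilpotent[OF nil] by (simp only: sum_distrib_left mult_ac)
  also have "integral_P1_power (l + 1) \<dots> = (\<Sum>k\<le>l + 1. (deriv ^^ k) g 0 / fact k * pairing t k)"
    by (simp only: integral_P1_power_sum integral_P1_power_const_mult pairing_def)
  also have "\<dots> = (\<Sum>k\<le>l + 1. of_real \<sigma> / (2 * of_real pi * \<i>) *
      (pairing t k / fact k * (deriv ^^ k) (f c) 0 - pairing t k / fact k * (deriv ^^ k) (f 0) 0))"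
  proof (rule sum.cong)
    fix k
    have "(deriv ^^ k) g 0 = (deriv ^^ k) (\<lambda>w. of_real \<sigma> / (2 * of_real pi * \<i>) * (f c w - f 0 w)) 0"
    proof (rule higher_deriv_transform_within_open[OF gh _ B])
      show "(\<lambda>w. of_real \<sigma> / (2 * of_real pi * \<i>) * (f c w - f 0 w)) holomorphic_on B"
        by (intro holomorphic_on_mult holomorphic_on_const holomorphic_on_diff fh)
      show "g w = of_real \<sigma> / (2 * of_real pi * \<i>) * (f c w - f 0 w)" if "w \<in> B" for w
        using Gamma_quotient_eq[OF _ \<sigma>, of w] that by (simp only: g_def f_def s_def c_def B_def mem_ball_0)
    qed
    also have "\<dots> = of_real \<sigma> / (2 * of_real pi * \<i>) * ((deriv ^^ k) (f c) 0 - (deriv ^^ k) (f 0) 0)"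
      by (subst higher_deriv_cmult[OF holomorphic_on_diff[OF fh fh] B(2,1)], subst higher_deriv_diff[OF fh fh B]) (rule refl)
    finally have e: "(deriv ^^ k) g 0 = of_real \<sigma> / (2 * of_real pi * \<i>) * ((deriv ^^ k) (f c) 0 - (deriv ^^ k) (f 0) 0)" .
    have "\<kappa> * (a - b) / n * p = \<kappa> * (p / n * a - p / n * b)" for \<kappa> a b n p :: complex
      by (simp add: divide_inverse algebra_simps)
    then show "(deriv ^^ k) g 0 / fact k * pairing t k = of_real \<sigma> / (2 * of_real pi * \<i>) *
      (pairing t k / fact k * (deriv ^^ k) (f c) 0 - pairing t k / fact k * (deriv ^^ k) (f 0) 0)"
      unfolding e .
  qed simp
  also have "\<dots> = of_real \<sigma> / (2 * of_real pi * \<i>) * (log_moment (- of_real (ln t) - c) - log_moment (- of_real (ln t) - 0))"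
    unfolding log_moment_eq[OF t] f_def sum_subtractf[symmetric] sum_distrib_left ..
  finally show ?thesis by (simp add: c_def)
qed

text \<open>For \<open>t > exp S\<close> the difference of the two sides, divided by
  \<open>1 / t\<close>, is exactly a constant times \<open>D c t - D 0 t\<close>, so it remains to
  show that these two errors tend to 0.\<close>

theorem banana_asymptotics:
  assumes \<sigma>: "\<sigma> \<in> {1, -1}"
  shows "(\<lambda>t::real. feynman_boundary_value \<sigma> l q t
            - 1 / complex_of_real t *
leading_term \<sigma> t)
         \<in> o[at_top](\<lambda>t. 1 / complex_of_real t)"
proof -
  obtain C where C: "C > 0" "\<And>z. Re z \<le> - S \<Longrightarrow>
    integrable lborel (\<lambda>x. weight x * log_prod z x) \<Longrightarrow>
    norm (bessel_moment z - log_moment z) \<le> C * ((1 + norm z) ^ (l + 1) * exp (Re z))"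
    by (rule bessel_moment_minus_log_moment) (rule that, assumption, blast)
  define c where "c = 2 * of_real pi * \<i> * complex_of_real \<sigma>"
  define D where "D b t = bessel_moment (- of_real (ln t) - b) - log_moment (- of_real (ln t) - b)" for b t
  have Dlim: "(D b \<longlongrightarrow> 0) at_top" if b: "Re b = 0" for b
  proof -
    define K where "K = 1 + norm b"
    have K: "K > 0" by (simp add: K_def add_pos_nonneg)
    \<comment> \<open>At rate 1/2 a power of \<open>ln t\<close> is at most a multiple of
      \<open>sqrt t + 1 / sqrt t\<close>, which the factor \<open>1 / t\<close> of the error still
      beats.\<close>
    obtain C2 where C2: "C2 > 0" "\<And>u::real. (1 + \<bar>u\<bar>) ^ (l + 1) \<le> C2 * (exp (1/2 * u) + exp (- (1/2) * u))"
      using one_plus_abs_power_le_exp[of "1/2" "l + 1"] by auto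
    have null: "((\<lambda>t. C * ((K + 1) ^ (l + 1) * C2) * ((exp (1/2 * ln t) + exp (- (1/2) * ln t)) / t)) \<longlongrightarrow> 0) at_top"
      by (rule tendsto_mult_right_zero) real_asymp
    have "eventually (\<lambda>t. t > max 1 (exp S)) at_top" by (rule eventually_gt_at_top)
    then have "eventually (\<lambda>t. norm (D b t) \<le> C * ((K + 1) ^ (l + 1) * C2) * ((exp (1/2 * ln t) + exp (- (1/2) * ln t)) / t)) at_top"
    proof eventually_elim
      case (elim t)
      then have t: "t > 1" "t > exp S" by auto
      then have "ln (exp S) < ln t" by (subst ln_less_cancel_iff) auto
      then have S: "Re (- of_real (ln t) - b) \<le> - S" using b by simp
      have "norm (- of_real (ln t) - b) \<le> ln t + norm b"
        using norm_triangle_ineq4[of "- complex_of_real (ln t)" b] t by simp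
      then have n: "1 + norm (- of_real (ln t) - b) \<le> K + ln t" by (simp add: K_def)
      have "norm (D b t) \<le> C * ((1 + norm (- of_real (ln t) - b)) ^ (l + 1) * exp (Re (- of_real (ln t) - b)))"
        unfolding D_def using t by (intro C(2) S integrable_log_moment) auto
      also have "exp (Re (- of_real (ln t) - b)) = 1 / t"
        using b t by (simp add: exp_minus divide_inverse)
      also have "C * ((1 + norm (- of_real (ln t) - b)) ^ (l + 1) * (1 / t)) \<le> C * ((K + ln t) ^ (l + 1) * (1 / t))"
        using n C(1) t by (intro mult_left_mono mult_right_mono power_mono) auto
      also have "\<dots> \<le> C * ((K + 1) ^ (l + 1) * C2 * (exp (1/2 * ln t) + exp (- (1/2) * ln t)) * (1 / t))"
      proof -
        have "K + ln t \<le> (K + 1) * (1 + \<bar>ln t\<bar>)" using K t by (simp add: algebra_simps)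
        then have "(K + ln t) ^ (l + 1) \<le> ((K + 1) * (1 + \<bar>ln t\<bar>)) ^ (l + 1)"
          using K t by (intro power_mono) auto
        also have "\<dots> \<le> (K + 1) ^ (l + 1) * (C2 * (exp (1/2 * ln t) + exp (- (1/2) * ln t)))"
          unfolding power_mult_distrib using K by (intro mult_left_mono C2) auto
        finally show ?thesis using C(1) t by (intro mult_left_mono mult_right_mono) (auto simp: mult.assoc)
      qed
      finally show ?case by (simp add: mult.assoc)
    qed
    then show ?thesis using null by (rule Lim_null_comparison)
  qed
  have "((\<lambda>t. of_real \<sigma> / (2 * of_real pi * \<i>) * (D c t - D 0 t)) \<longlongrightarrow> of_real \<sigma> / (2 * of_real pi * \<i>) * (0 - 0)) at_top"
    by (intro tendsto_intros Dlim) (auto simp: c_def)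
  then have lim: "((\<lambda>t. of_real \<sigma> / (2 * of_real pi * \<i>) * (D c t - D 0 t)) \<longlongrightarrow> 0) at_top" by simp
  show ?thesis
  proof (rule smalloI_tendsto)
    show "((\<lambda>t. (feynman_boundary_value \<sigma> l q t
            - 1 / complex_of_real t *
leading_term \<sigma> t) / (1 / complex_of_real t)) \<longlongrightarrow> 0) at_top"
    proof (rule Lim_transform_eventually[OF lim])
      have "eventually (\<lambda>t. t > max 1 (exp S)) at_top" by (rule eventually_gt_at_top)
      then show "eventually (\<lambda>t. of_real \<sigma> / (2 * of_real pi * \<i>) * (D c t - D 0 t)
         = (feynman_boundary_value \<sigma> l q t
            - 1 / complex_of_real t *
leading_term \<sigma> t) / (1 / complex_of_real t)) at_top"
      proof eventually_elim
        case (elim t)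
        then have t: "t > 0" "t > exp S" by auto
        show ?case
          unfolding leading_term_eq[OF t(1) \<sigma>] feynman_boundary_value_eq[OF \<sigma> t(2)] D_def c_def
          using t(1) by (simp add: field_simps)
      qed
    qed
    show "eventually (\<lambda>t. 1 / complex_of_real t \<noteq> 0) at_top"
      using eventually_gt_at_top[of 0] by eventually_elim simp
  qed
qed

end

theorem theorem1:
  fixes l :: nat and q :: "nat \<Rightarrow> real" and \<sigma> :: real
  assumes "l \<ge> 1"
    and "\<And>i. i \<in> {1..l + 1} \<Longrightarrow> q i > 0"
    and "\<sigma> \<in> {1, -1}"
  shows "(\<lambda>t::real. feynman_boundary_value \<sigma> l q t
            - 1 / complex_of_real t *
              integral_F l
                (taylor_at exp (- p_log l q t) * Gamma_class_F l
                 * taylor_at exp (cohom_const (complex_of_real (\<sigma> * pi) * \<i>) * c1_F l)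
                 * taylor_at (\<lambda>z. Gamma (1 - z)) (c1_F l)))
         \<in> o[at_top](\<lambda>t. 1 / complex_of_real t)"
proof -
  interpret banana l q by unfold_locales (rule assms(2))
  show ?thesis using banana_asymptotics[OF assms(3)] by (simp only: leading_term_def)
qed

end
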